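(* Let $(\Lambda,\le)$ be a well-founded partially ordered set and $\{B_\lambda\}_{\lambda\in\Lambda}$ a family of $\mathcal V$-algebras. Let $A$ be a standardly filtered algebra over $\{B_\lambda\}$, and take a prestandard filter of $A$ over $\{B_\lambda\}$, with ideal filter $\{A^{\le\lambda}\}$, ideals $B'_\lambda\subset B_\lambda$ and Morita contexts $(M_\lambda,N_\lambda)$ between $A/A^{<\lambda}$ and $B_\lambda/B'_\lambda$. For each $\lambda$ let $B''_\lambda/B'_\lambda\subset B_\lambda/B'_\lambda$ be the trace ideal in $B_\lambda/B'_\lambda$ of this Morita context. Then $$\operatorname{Irr}(A)=\bigsqcup_{\lambda\in\Lambda}\operatorname{Irr}^{A^{\le\lambda}}_{A^{<\lambda}}(A),$$ and the Morita contexts induce a one-to-one correspondence $$\operatorname{Irr}(A)=\bigsqcup_{\lambda\in\Lambda}\operatorname{Irr}^{A^{\le\lambda}}_{A^{<\lambda}}(A)\;\longleftrightarrow\;\bigsqcup_{\lambda\in\Lambda}\operatorname{Irr}^{B''_\lambda}_{B'_\lambda}(B_\lambda).$$ (Here the bijection $\operatorname{Irr}^{B''_\lambda}_{B'_\lambda}(B_\lambda)\to\operatorname{Irr}^{A^{\le\lambda}}_{A^{<\lambda}}(A)$ induced by the Morita context sends $W$ to the image of the map $M_\lambda\otimes_{B_\lambda}W\to\operatorname{Hom}_{B_\lambda}(N_\lambda,W)$ induced by $\rho_\lambda$.)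
   Context: Fix a commutative ring $\Bbbk$; $\mathcal V$ is one of the symmetric tensor categories of $\Bbbk$-modules, of $\Bbbk$-supermodules, or of $\mathbb Z$-graded $\Bbbk$-modules (with Koszul sign symmetry); a $\mathcal V$-algebra is a monoid object in $\mathcal V$, and modules and ideals are graded accordingly. $\operatorname{Irr}(A)$ is the set of simple left $A$-modules up to degree-preserving isomorphism. For 2-sided ideals $J\subset I\subset A$, $\operatorname{Irr}^I_J(A)$ is the set of $V\in\operatorname{Irr}(A)$ with $JV=0$ and $IV=V$ (equivalently $IV\ne0$). A partially ordered set is well-founded if every non-empty subset has a minimal element. Morita context between algebras $A$, $B$: an $(A,B)$-bimodule $M$ and a $(B,A)$-bimodule $N$ with degree-preserving bimodule homomorphisms $\eta\colon M\otimes_BN\to A$, $\rho\colon N\otimes_AM\to B$ such that $\eta(x\otimes y)x'=x\rho(y\otimes x')$ and $\rho(y\otimes x)y'=y\eta(x\otimes y')$. The images of $\eta$ and $\rho$ are its trace ideals in $A$ and $B$. An ideal filter on $A$ indexed by $\Lambda$ is a family of 2-sided ideals $\{A^{\le\lambda}\}_{\lambda\in\Lambda}$ with $A^{\le\lambda}\subset A^{\le\mu}$ if $\lambda\le\mu$, $A=\sum_\lambda A^{\le\lambda}$, and $A^{\le\lambda}A^{\le\mu}\subset\sum_{\nu\le\lambda,\,\nu\le\mu}A^{\le\nu}$. Put $A^{<\lambda}:=\sum_{\mu<\lambda}A^{\le\mu}$. A prestandard filter of $A$ over $\{B_\lambda\}$ consists of an ideal filter $\{A^{\le\lambda}\}$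 on $A$, and for each $\lambda$ a 2-sided ideal $B'_\lambda\subset B_\lambda$ and a Morita context $(M_\lambda,N_\lambda)$ between $A/A^{<\lambda}$ and $B_\lambda/B'_\lambda$ whose trace ideal in $A/A^{<\lambda}$ is $A^{\le\lambda}/A^{<\lambda}$. It is a standard filter if moreover $A^{\le\mu}M_\lambda=0$ and $N_\lambda A^{\le\mu}=0$ whenever $\lambda\not\le\mu$. A standardly filtered algebra is an algebra equipped with a standard filter. *)

theory Defs
  imports "HOL-Algebra.Module" "HOL-Algebra.QuotRing" "HOL-Algebra.Ideal_Product"
    "HOL-Algebra.Free_Abelian_Groups" "HOL-Library.Disjoint_Sets"
begin

section \<open>The symmetric tensor categories\<close>

datatype vcat = Modules | Supermodules | Graded_Modules

text \<open>The grading groups \<open>0\<close>, \<open>\<int>/2 = {0, 1}\<close> and \<open>\<int>\<close>.\<close>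

fun degs :: "vcat \<Rightarrow> int set" where
  "degs Modules = {0}"
| "degs Supermodules = {0, 1}"
| "degs Graded_Modules = UNIV"

fun dplus :: "vcat \<Rightarrow> int \<Rightarrow> int \<Rightarrow> int" where
  "dplus Modules i j = 0"
| "dplus Supermodules i j = (i + j) mod 2"
| "dplus Graded_Modules i j = i + j"

text \<open>
  An object is a \<open>k\<close>-module together with its homogeneous components.  As in \<^theory>\<open>HOL-Algebra.Module\<close>,
  the record also has a multiplication and a unit; they are meaningful only for algebras.
\<close>

record ('k, 'm) vobj = "('k, 'm) module" +
  hcomp :: "int \<Rightarrow> 'm set"

definition homog_decomp ::
  "vcat \<Rightarrow> ('k, 'm, 'z) vobj_scheme \<Rightarrow> 'm \<Rightarrow> (int \<Rightarrow> 'm) \<Rightarrow> bool" where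
  "homog_decomp \<V> V v f \<longleftrightarrow>
     f \<in> (\<Pi>\<^sub>E i\<in>degs \<V>. hcomp V i) \<and>
     finite {i \<in> degs \<V>. f i \<noteq> \<zero>\<^bsub>V\<^esub>} \<and>
     v = (\<Oplus>\<^bsub>V\<^esub> i\<in>{i \<in> degs \<V>. f i \<noteq> \<zero>\<^bsub>V\<^esub>}. f i)"

definition vobject :: "vcat \<Rightarrow> 'k ring \<Rightarrow> ('k, 'm, 'z) vobj_scheme \<Rightarrow> bool" where
  "vobject \<V> k V \<longleftrightarrow>
     module k V \<and>
     (\<forall>i\<in>degs \<V>. submodule (hcomp V i) k V) \<and>
     (\<forall>v\<in>carrier V. \<exists>!f. homog_decomp \<V> V v f)"

definition subobject :: "vcat \<Rightarrow> 'k ring \<Rightarrow> ('k, 'm, 'z) vobj_scheme \<Rightarrow> 'm set \<Rightarrow> bool" where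
  "subobject \<V> k V U \<longleftrightarrow>
     submodule U k V \<and>
     (\<forall>u\<in>U. \<exists>f. homog_decomp \<V> V u f \<and> (\<forall>i\<in>degs \<V>. f i \<in> U))"

section \<open>Algebras, ideals, modules and bimodules\<close>

definition valgebra :: "vcat \<Rightarrow> 'k ring \<Rightarrow> ('k, 'a, 'z) vobj_scheme \<Rightarrow> bool" where
  "valgebra \<V> k A \<longleftrightarrow>
     vobject \<V> k A \<and> ring A \<and>
     (\<forall>c\<in>carrier k. \<forall>a\<in>carrier A. \<forall>b\<in>carrier A.
        (c \<odot>\<^bsub>A\<^esub> a) \<otimes>\<^bsub>A\<^esub> b = c \<odot>\<^bsub>A\<^esub> (a \<otimes>\<^bsub>A\<^esub> b) \<and>
        a \<otimes>\<^bsub>A\<^esub> (c \<odot>\<^bsub>A\<^esub> b) = c \<odot>\<^bsub>A\<^esub> (a \<otimes>\<^bsub>A\<^esub> b)) \<and>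
     \<one>\<^bsub>A\<^esub> \<in> hcomp A 0 \<and>
     (\<forall>i\<in>degs \<V>. \<forall>j\<in>degs \<V>. \<forall>a\<in>hcomp A i. \<forall>b\<in>hcomp A j. a \<otimes>\<^bsub>A\<^esub> b \<in> hcomp A (dplus \<V> i j))"

definition videal :: "vcat \<Rightarrow> 'k ring \<Rightarrow> ('k, 'a, 'z) vobj_scheme \<Rightarrow> 'a set \<Rightarrow> bool" where
  "videal \<V> k A I \<longleftrightarrow> ideal I A \<and> subobject \<V> k A I"

definition quot_algebra ::
  "('k, 'a, 'z) vobj_scheme \<Rightarrow> 'a set \<Rightarrow> ('k, 'a set) vobj" where
  "quot_algebra A I =
     \<lparr>carrier = carrier (A Quot I), mult = mult (A Quot I), one = one (A Quot I),
      ring.zero = ring.zero (A Quot I), add = add (A Quot I),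
      smult = (\<lambda>c X. \<Union>x\<in>X. I +>\<^bsub>A\<^esub> (c \<odot>\<^bsub>A\<^esub> x)),
      hcomp = (\<lambda>i. (\<lambda>a. I +>\<^bsub>A\<^esub> a) ` hcomp A i)\<rparr>"

record ('k, 'a, 'm) lmodule = "('k, 'm) vobj" +
  lact :: "'a \<Rightarrow> 'm \<Rightarrow> 'm"

record ('k, 'a, 'b, 'm) bimodule = "('k, 'a, 'm) lmodule" +
  ract :: "'m \<Rightarrow> 'b \<Rightarrow> 'm"

definition left_module ::
  "vcat \<Rightarrow> 'k ring \<Rightarrow> ('k, 'a, 'y) vobj_scheme \<Rightarrow> ('k, 'a, 'm, 'z) lmodule_scheme \<Rightarrow> bool" where
  "left_module \<V> k A M \<longleftrightarrow>
     vobject \<V> k M \<and>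
     (\<forall>a\<in>carrier A. \<forall>x\<in>carrier M. lact M a x \<in> carrier M) \<and>
     (\<forall>a\<in>carrier A. \<forall>b\<in>carrier A. \<forall>x\<in>carrier M.
        lact M (a \<oplus>\<^bsub>A\<^esub> b) x = lact M a x \<oplus>\<^bsub>M\<^esub> lact M b x \<and>
        lact M (a \<otimes>\<^bsub>A\<^esub> b) x = lact M a (lact M b x)) \<and>
     (\<forall>a\<in>carrier A. \<forall>x\<in>carrier M. \<forall>y\<in>carrier M.
        lact M a (x \<oplus>\<^bsub>M\<^esub> y) = lact M a x \<oplus>\<^bsub>M\<^esub> lact M a y) \<and>
     (\<forall>c\<in>carrier k. \<forall>a\<in>carrier A. \<forall>x\<in>carrier M.
        lact M (c \<odot>\<^bsub>A\<^esub> a) x = c \<odot>\<^bsub>M\<^esub> lact M a x \<and>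
        lact M a (c \<odot>\<^bsub>M\<^esub> x) = c \<odot>\<^bsub>M\<^esub> lact M a x) \<and>
     (\<forall>x\<in>carrier M. lact M \<one>\<^bsub>A\<^esub> x = x) \<and>
     (\<forall>i\<in>degs \<V>. \<forall>j\<in>degs \<V>. \<forall>a\<in>hcomp A i. \<forall>x\<in>hcomp M j. lact M a x \<in> hcomp M (dplus \<V> i j))"

definition right_module ::
  "vcat \<Rightarrow> 'k ring \<Rightarrow> ('k, 'b, 'y) vobj_scheme \<Rightarrow> ('k, 'a, 'b, 'm, 'z) bimodule_scheme \<Rightarrow> bool" where
  "right_module \<V> k B M \<longleftrightarrow>
     vobject \<V> k M \<and>
     (\<forall>x\<in>carrier M. \<forall>b\<in>carrier B. ract M x b \<in> carrier M) \<and>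
     (\<forall>x\<in>carrier M. \<forall>a\<in>carrier B. \<forall>b\<in>carrier B.
        ract M x (a \<oplus>\<^bsub>B\<^esub> b) = ract M x a \<oplus>\<^bsub>M\<^esub> ract M x b \<and>
        ract M x (a \<otimes>\<^bsub>B\<^esub> b) = ract M (ract M x a) b) \<and>
     (\<forall>x\<in>carrier M. \<forall>y\<in>carrier M. \<forall>b\<in>carrier B.
        ract M (x \<oplus>\<^bsub>M\<^esub> y) b = ract M x b \<oplus>\<^bsub>M\<^esub> ract M y b) \<and>
     (\<forall>c\<in>carrier k. \<forall>x\<in>carrier M. \<forall>b\<in>carrier B.
        ract M x (c \<odot>\<^bsub>B\<^esub> b) = c \<odot>\<^bsub>M\<^esub> ract M x b \<and>
        ract M (c \<odot>\<^bsub>M\<^esub> x) b = c \<odot>\<^bsub>M\<^esub> ract M x b) \<and>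
     (\<forall>x\<in>carrier M. ract M x \<one>\<^bsub>B\<^esub> = x) \<and>
     (\<forall>i\<in>degs \<V>. \<forall>j\<in>degs \<V>. \<forall>x\<in>hcomp M i. \<forall>b\<in>hcomp B j. ract M x b \<in> hcomp M (dplus \<V> i j))"

definition is_bimodule ::
  "vcat \<Rightarrow> 'k ring \<Rightarrow> ('k, 'a, 'x) vobj_scheme \<Rightarrow> ('k, 'b, 'y) vobj_scheme \<Rightarrow>
   ('k, 'a, 'b, 'm, 'z) bimodule_scheme \<Rightarrow> bool" where
  "is_bimodule \<V> k A B M \<longleftrightarrow>
     left_module \<V> k A M \<and> right_module \<V> k B M \<and>
     (\<forall>a\<in>carrier A. \<forall>x\<in>carrier M. \<forall>b\<in>carrier B.
        ract M (lact M a x) b = lact M a (ract M x b))"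

definition regular_bimodule :: "('k, 'a) vobj \<Rightarrow> ('k, 'a, 'a, 'a) bimodule" where
  "regular_bimodule A =
     \<lparr>carrier = carrier A, mult = mult A, one = one A, ring.zero = ring.zero A, add = add A,
      smult = smult A, hcomp = hcomp A, lact = mult A, ract = mult A\<rparr>"

definition lmod_linear ::
  "'k ring \<Rightarrow> ('k, 'a, 'x) vobj_scheme \<Rightarrow> ('k, 'a, 'm, 'y) lmodule_scheme \<Rightarrow>
   ('k, 'a, 'n, 'z) lmodule_scheme \<Rightarrow> ('m \<Rightarrow> 'n) \<Rightarrow> bool" where
  "lmod_linear k A V W f \<longleftrightarrow>
     f \<in> carrier V \<rightarrow> carrier W \<and>
     (\<forall>x\<in>carrier V. \<forall>y\<in>carrier V. f (x \<oplus>\<^bsub>V\<^esub> y) = f x \<oplus>\<^bsub>W\<^esub> f y) \<and>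
     (\<forall>c\<in>carrier k. \<forall>x\<in>carrier V. f (c \<odot>\<^bsub>V\<^esub> x) = c \<odot>\<^bsub>W\<^esub> f x) \<and>
     (\<forall>a\<in>carrier A. \<forall>x\<in>carrier V. f (lact V a x) = lact W a (f x))"

definition lmod_hom ::
  "vcat \<Rightarrow> 'k ring \<Rightarrow> ('k, 'a, 'x) vobj_scheme \<Rightarrow> ('k, 'a, 'm, 'y) lmodule_scheme \<Rightarrow>
   ('k, 'a, 'n, 'z) lmodule_scheme \<Rightarrow> ('m \<Rightarrow> 'n) \<Rightarrow> bool" where
  "lmod_hom \<V> k A V W f \<longleftrightarrow>
     lmod_linear k A V W f \<and> (\<forall>i\<in>degs \<V>. f ` hcomp V i \<subseteq> hcomp W i)"

definition bimod_hom ::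
  "vcat \<Rightarrow> 'k ring \<Rightarrow> ('k, 'a, 'v) vobj_scheme \<Rightarrow> ('k, 'b, 'x) vobj_scheme \<Rightarrow>
   ('k, 'a, 'b, 'm, 'y) bimodule_scheme \<Rightarrow> ('k, 'a, 'b, 'n, 'z) bimodule_scheme \<Rightarrow>
   ('m \<Rightarrow> 'n) \<Rightarrow> bool" where
  "bimod_hom \<V> k A B V W f \<longleftrightarrow>
     lmod_hom \<V> k A V W f \<and>
     (\<forall>x\<in>carrier V. \<forall>b\<in>carrier B. f (ract V x b) = ract W (f x) b)"

definition lmod_iso ::
  "vcat \<Rightarrow> 'k ring \<Rightarrow> ('k, 'a, 'x) vobj_scheme \<Rightarrow> ('k, 'a, 'm, 'y) lmodule_scheme \<Rightarrow>
   ('k, 'a, 'n, 'z) lmodule_scheme \<Rightarrow> bool" where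
  "lmod_iso \<V> k A V W \<longleftrightarrow> (\<exists>f. lmod_hom \<V> k A V W f \<and> bij_betw f (carrier V) (carrier W))"

section \<open>Simple modules\<close>

definition simple_module ::
  "vcat \<Rightarrow> 'k ring \<Rightarrow> ('k, 'a, 'x) vobj_scheme \<Rightarrow> ('k, 'a, 'm, 'y) lmodule_scheme \<Rightarrow> bool" where
  "simple_module \<V> k A V \<longleftrightarrow>
     left_module \<V> k A V \<and> carrier V \<noteq> {\<zero>\<^bsub>V\<^esub>} \<and>
     (\<forall>U. subobject \<V> k V U \<and> (\<forall>a\<in>carrier A. \<forall>u\<in>U. lact V a u \<in> U) \<longrightarrow>
          U = {\<zero>\<^bsub>V\<^esub>} \<or> U = carrier V)"

text \<open>The product \<open>I V\<close>.\<close>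

definition ideal_act :: "'a set \<Rightarrow> ('k, 'a, 'm, 'y) lmodule_scheme \<Rightarrow> 'm set" where
  "ideal_act I V = generate (add_monoid V) {lact V a v | a v. a \<in> I \<and> v \<in> carrier V}"

text \<open>
  The modules, with underlying set in a fixed type \<open>'u\<close>, that are isomorphic to a module \<open>X\<close>,
  which may itself live in any type.
\<close>

definition iso_class ::
  "vcat \<Rightarrow> 'k ring \<Rightarrow> ('k, 'a, 'x) vobj_scheme \<Rightarrow> ('k, 'a, 'm, 'y) lmodule_scheme \<Rightarrow>
   ('k, 'a, 'u) lmodule set" where
  "iso_class \<V> k A X = {V. left_module \<V> k A V \<and> lmod_iso \<V> k A X V}"

text \<open>
  The type \<open>'u\<close> plays the role of a universe.  A simple module is generated by any nonzero homogeneous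
  element, hence is a quotient of \<open>A\<close> as a set; so all simple modules are accounted for as soon as
  \<open>carrier A\<close> injects into \<open>'u\<close>.
\<close>

definition Irr ::
  "vcat \<Rightarrow> 'k ring \<Rightarrow> ('k, 'a, 'x) vobj_scheme \<Rightarrow> ('k, 'a, 'u) lmodule set set" where
  "Irr \<V> k A = iso_class \<V> k A ` {V :: ('k, 'a, 'u) lmodule. simple_module \<V> k A V}"

text \<open>\<open>simple_between \<V> k A J I V\<close>: the class of \<open>V\<close> belongs to \<open>Irr\<^sup>I\<^sub>J(A)\<close>.\<close>

definition simple_between ::
  "vcat \<Rightarrow> 'k ring \<Rightarrow> ('k, 'a, 'x) vobj_scheme \<Rightarrow> 'a set \<Rightarrow> 'a set \<Rightarrow>
   ('k, 'a, 'm, 'y) lmodule_scheme \<Rightarrow> bool" where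
  "simple_between \<V> k A J I V \<longleftrightarrow>
     simple_module \<V> k A V \<and> ideal_act J V = {\<zero>\<^bsub>V\<^esub>} \<and> ideal_act I V = carrier V"

definition Irr_between ::
  "vcat \<Rightarrow> 'k ring \<Rightarrow> ('k, 'a, 'x) vobj_scheme \<Rightarrow> 'a set \<Rightarrow> 'a set \<Rightarrow>
   ('k, 'a, 'u) lmodule set set" where
  "Irr_between \<V> k A J I =
     iso_class \<V> k A ` {V :: ('k, 'a, 'u) lmodule. simple_between \<V> k A J I V}"

section \<open>Tensor products over a noncommutative algebra\<close>

definition tensor_rels ::
  "('k, 'b, 'x) vobj_scheme \<Rightarrow> ('k, 'a, 'b, 'm, 'y) bimodule_scheme \<Rightarrow>
   ('k, 'b, 'n, 'z) lmodule_scheme \<Rightarrow> ('m \<times> 'n \<Rightarrow>\<^sub>0 int) set" where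
  "tensor_rels B M N =
     {frag_of (x \<oplus>\<^bsub>M\<^esub> x', y) - frag_of (x, y) - frag_of (x', y) | x x' y.
        x \<in> carrier M \<and> x' \<in> carrier M \<and> y \<in> carrier N} \<union>
     {frag_of (x, y \<oplus>\<^bsub>N\<^esub> y') - frag_of (x, y) - frag_of (x, y') | x y y'.
        x \<in> carrier M \<and> y \<in> carrier N \<and> y' \<in> carrier N} \<union>
     {frag_of (ract M x b, y) - frag_of (x, lact N b y) | x b y.
        x \<in> carrier M \<and> b \<in> carrier B \<and> y \<in> carrier N}"

definition tensor_free ::
  "('k, 'a, 'b, 'm, 'y) bimodule_scheme \<Rightarrow> ('k, 'b, 'n, 'z) lmodule_scheme \<Rightarrow>
   ('m \<times> 'n \<Rightarrow>\<^sub>0 int) monoid" where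
  "tensor_free M N = free_Abelian_group (carrier M \<times> carrier N)"

definition tensor_ker ::
  "('k, 'b, 'x) vobj_scheme \<Rightarrow> ('k, 'a, 'b, 'm, 'y) bimodule_scheme \<Rightarrow>
   ('k, 'b, 'n, 'z) lmodule_scheme \<Rightarrow> ('m \<times> 'n \<Rightarrow>\<^sub>0 int) set" where
  "tensor_ker B M N = generate (tensor_free M N) (tensor_rels B M N)"

definition pure_tensor ::
  "('k, 'b, 'x) vobj_scheme \<Rightarrow> ('k, 'a, 'b, 'm, 'y) bimodule_scheme \<Rightarrow>
   ('k, 'b, 'n, 'z) lmodule_scheme \<Rightarrow> 'm \<Rightarrow> 'n \<Rightarrow> ('m \<times> 'n \<Rightarrow>\<^sub>0 int) set" where
  "pure_tensor B M N x y = tensor_ker B M N #>\<^bsub>tensor_free M N\<^esub> frag_of (x, y)"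

text \<open>The endomorphism of \<open>M \<otimes>\<^sub>B N\<close> induced by the map \<open>h\<close> on pairs.\<close>

definition tensor_map ::
  "('k, 'b, 'x) vobj_scheme \<Rightarrow> ('k, 'a, 'b, 'm, 'y) bimodule_scheme \<Rightarrow>
   ('k, 'b, 'n, 'z) lmodule_scheme \<Rightarrow> ('m \<times> 'n \<Rightarrow> 'm \<times> 'n) \<Rightarrow>
   ('m \<times> 'n \<Rightarrow>\<^sub>0 int) set \<Rightarrow> ('m \<times> 'n \<Rightarrow>\<^sub>0 int) set" where
  "tensor_map B M N h X =
     (\<Union>p\<in>X. tensor_ker B M N #>\<^bsub>tensor_free M N\<^esub> frag_extend (\<lambda>s. frag_of (h s)) p)"

definition tensor_lmodule ::
  "vcat \<Rightarrow> ('k, 'b, 'x) vobj_scheme \<Rightarrow> ('k, 'a, 'b, 'm, 'y) bimodule_scheme \<Rightarrow>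
   ('k, 'b, 'n, 'z) lmodule_scheme \<Rightarrow> ('k, 'a, ('m \<times> 'n \<Rightarrow>\<^sub>0 int) set) lmodule" where
  "tensor_lmodule \<V> B M N =
     (let T = tensor_free M N Mod tensor_ker B M N in
      \<lparr>carrier = carrier T, mult = undefined, one = undefined, ring.zero = one T, add = mult T,
       smult = (\<lambda>c. tensor_map B M N (\<lambda>(x, y). (c \<odot>\<^bsub>M\<^esub> x, y))),
       hcomp = (\<lambda>d. generate T {pure_tensor B M N x y | x y i j.
                  i \<in> degs \<V> \<and> j \<in> degs \<V> \<and> dplus \<V> i j = d \<and> x \<in> hcomp M i \<and> y \<in> hcomp N j}),
       lact = (\<lambda>a. tensor_map B M N (\<lambda>(x, y). (lact M a x, y)))\<rparr>)"

definition tensor_bimodule ::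
  "vcat \<Rightarrow> ('k, 'b, 'x) vobj_scheme \<Rightarrow> ('k, 'a, 'b, 'm, 'y) bimodule_scheme \<Rightarrow>
   ('k, 'b, 'c, 'n, 'z) bimodule_scheme \<Rightarrow> ('k, 'a, 'c, ('m \<times> 'n \<Rightarrow>\<^sub>0 int) set) bimodule" where
  "tensor_bimodule \<V> B M N =
     lmodule.extend (tensor_lmodule \<V> B M N)
       (bimodule.fields (\<lambda>X c. tensor_map B M N (\<lambda>(x, y). (x, ract N y c)) X))"

text \<open>
  The additive map \<open>M \<otimes>\<^sub>B N \<rightarrow> G\<close> induced by a balanced biadditive map \<open>g\<close>: extend \<open>g\<close> to the
  free abelian group and evaluate at any representative.
\<close>

definition tensor_lift ::
  "('g, 'z) ring_scheme \<Rightarrow> ('m \<times> 'n \<Rightarrow> 'g) \<Rightarrow> ('m \<times> 'n \<Rightarrow>\<^sub>0 int) set \<Rightarrow> 'g" where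
  "tensor_lift G g X =
     the_elem ((\<lambda>p. \<Oplus>\<^bsub>G\<^esub> s\<in>Poly_Mapping.keys p. [Poly_Mapping.lookup p s] \<cdot>\<^bsub>G\<^esub> g s) ` X)"

section \<open>The internal Hom module\<close>

definition hom_degree ::
  "vcat \<Rightarrow> 'k ring \<Rightarrow> ('k, 'b, 'x) vobj_scheme \<Rightarrow> ('k, 'b, 'a, 'n, 'y) bimodule_scheme \<Rightarrow>
   ('k, 'b, 'w, 'z) lmodule_scheme \<Rightarrow> int \<Rightarrow> ('n \<Rightarrow> 'w) set" where
  "hom_degree \<V> k B N W d =
     {f \<in> extensional (carrier N). lmod_linear k B N W f \<and>
        (\<forall>i\<in>degs \<V>. f ` hcomp N i \<subseteq> hcomp W (dplus \<V> i d))}"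

text \<open>
  \<open>Hom\<^sub>B(N, W)\<close> for an object \<open>N\<close> with commuting left \<open>B\<close>- and right \<open>A\<close>-action, as the right
  adjoint of \<open>N \<otimes>\<^sub>A -\<close>: it consists of the finite sums of homogeneous maps, and \<open>(a f)(y) = f(y a)\<close>.
  The evaluation of this adjunction is a map \<open>N \<otimes>\<^sub>A Hom\<^sub>B(N, W) \<rightarrow> W\<close>, with the argument to the left of the
  map, so no two symbols are interchanged and no Koszul sign appears.  (Writing maps on the left of
  their arguments gives an isomorphic module, via \<open>f \<mapsto> (y \<mapsto> (-1)\<^bsup>|f||y|\<^esup> f y)\<close>.)
\<close>

definition hom_lmodule ::
  "vcat \<Rightarrow> 'k ring \<Rightarrow> ('k, 'b, 'x) vobj_scheme \<Rightarrow> ('k, 'b, 'a, 'n, 'y) bimodule_scheme \<Rightarrow>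
   ('k, 'b, 'w, 'z) lmodule_scheme \<Rightarrow> ('k, 'a, 'n \<Rightarrow> 'w) lmodule" where
  "hom_lmodule \<V> k B N W =
     \<lparr>carrier = {f \<in> extensional (carrier N). \<exists>S g. finite S \<and> S \<subseteq> degs \<V> \<and>
                   (\<forall>d\<in>S. g d \<in> hom_degree \<V> k B N W d) \<and>
                   (\<forall>y\<in>carrier N. f y = (\<Oplus>\<^bsub>W\<^esub> d\<in>S. g d y))},
      mult = undefined, one = undefined,
      ring.zero = (\<lambda>y\<in>carrier N. \<zero>\<^bsub>W\<^esub>),
      add = (\<lambda>f g. \<lambda>y\<in>carrier N. f y \<oplus>\<^bsub>W\<^esub> g y),
      smult = (\<lambda>c f. \<lambda>y\<in>carrier N. c \<odot>\<^bsub>W\<^esub> f y),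
      hcomp = hom_degree \<V> k B N W,
      lact = (\<lambda>a f. \<lambda>y\<in>carrier N. f (ract N y a))\<rparr>"

section \<open>Morita contexts\<close>

record ('k, 'a, 'b, 'm, 'n) morita =
  mor_M :: "('k, 'a, 'b, 'm) bimodule"
  mor_N :: "('k, 'b, 'a, 'n) bimodule"
  mor_eta :: "('m \<times> 'n \<Rightarrow>\<^sub>0 int) set \<Rightarrow> 'a"
  mor_rho :: "('n \<times> 'm \<Rightarrow>\<^sub>0 int) set \<Rightarrow> 'b"

definition morita_context ::
  "vcat \<Rightarrow> 'k ring \<Rightarrow> ('k, 'a) vobj \<Rightarrow> ('k, 'b) vobj \<Rightarrow> ('k, 'a, 'b, 'm, 'n) morita \<Rightarrow> bool" where
  "morita_context \<V> k A B C \<longleftrightarrow>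
     (let M = mor_M C; N = mor_N C; \<eta> = mor_eta C; \<rho> = mor_rho C in
      is_bimodule \<V> k A B M \<and> is_bimodule \<V> k B A N \<and>
      bimod_hom \<V> k A A (tensor_bimodule \<V> B M N) (regular_bimodule A) \<eta> \<and>
      bimod_hom \<V> k B B (tensor_bimodule \<V> A N M) (regular_bimodule B) \<rho> \<and>
      (\<forall>x\<in>carrier M. \<forall>y\<in>carrier N. \<forall>x'\<in>carrier M.
         lact M (\<eta> (pure_tensor B M N x y)) x' = ract M x (\<rho> (pure_tensor A N M y x'))) \<and>
      (\<forall>y\<in>carrier N. \<forall>x\<in>carrier M. \<forall>y'\<in>carrier N.
         lact N (\<rho> (pure_tensor A N M y x)) y' = ract N y (\<eta> (pure_tensor B M N x y'))))"

definition trace_left :: "vcat \<Rightarrow> ('k, 'b) vobj \<Rightarrow> ('k, 'a, 'b, 'm, 'n) morita \<Rightarrow> 'a set" where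
  "trace_left \<V> B C = mor_eta C ` carrier (tensor_bimodule \<V> B (mor_M C) (mor_N C))"

definition trace_right :: "vcat \<Rightarrow> ('k, 'a) vobj \<Rightarrow> ('k, 'a, 'b, 'm, 'n) morita \<Rightarrow> 'b set" where
  "trace_right \<V> A C = mor_rho C ` carrier (tensor_bimodule \<V> A (mor_N C) (mor_M C))"

text \<open>Restriction of scalars of an \<open>(A/I, B/J)\<close>-bimodule along \<open>A \<rightarrow> A/I\<close> and \<open>B \<rightarrow> B/J\<close>.\<close>

definition inflate ::
  "('k, 'a) vobj \<Rightarrow> 'a set \<Rightarrow> ('k, 'b) vobj \<Rightarrow> 'b set \<Rightarrow>
   ('k, 'a set, 'b set, 'm) bimodule \<Rightarrow> ('k, 'a, 'b, 'm) bimodule" where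
  "inflate A I B J M =
     \<lparr>carrier = carrier M, mult = mult M, one = one M, ring.zero = ring.zero M, add = add M,
      smult = smult M, hcomp = hcomp M,
      lact = (\<lambda>a. lact M (I +>\<^bsub>A\<^esub> a)), ract = (\<lambda>x b. ract M x (J +>\<^bsub>B\<^esub> b))\<rparr>"

text \<open>The action of a residue class in \<open>B/J\<close> on a \<open>B\<close>-module annihilated by \<open>J\<close>.\<close>

definition coset_act :: "('k, 'b, 'w, 'z) lmodule_scheme \<Rightarrow> 'b set \<Rightarrow> 'w \<Rightarrow> 'w" where
  "coset_act W X w = the_elem ((\<lambda>b. lact W b w) ` X)"

text \<open>
  For a Morita context \<open>C\<close> between \<open>A/I\<close> and \<open>B/J\<close> and a \<open>B\<close>-module \<open>W\<close> annihilated by \<open>J\<close>, the map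
  \<open>M \<otimes>\<^sub>B W \<rightarrow> Hom\<^sub>B(N, W)\<close>, \<open>x \<otimes> w \<mapsto> (y \<mapsto> \<rho>(y \<otimes> x) w)\<close>, and its image.
\<close>

definition morita_map ::
  "vcat \<Rightarrow> 'k ring \<Rightarrow> ('k, 'a) vobj \<Rightarrow> 'a set \<Rightarrow> ('k, 'b) vobj \<Rightarrow> 'b set \<Rightarrow>
   ('k, 'a set, 'b set, 'm, 'n) morita \<Rightarrow> ('k, 'b, 'w) lmodule \<Rightarrow>
   ('m \<times> 'w \<Rightarrow>\<^sub>0 int) set \<Rightarrow> 'n \<Rightarrow> 'w" where
  "morita_map \<V> k A I B J C W =
     tensor_lift (hom_lmodule \<V> k B (inflate B J A I (mor_N C)) W)
       (\<lambda>(x, w). \<lambda>y\<in>carrier (mor_N C).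
          coset_act W (mor_rho C (pure_tensor (quot_algebra A I) (mor_N C) (mor_M C) y x)) w)"

definition morita_image ::
  "vcat \<Rightarrow> 'k ring \<Rightarrow> ('k, 'a) vobj \<Rightarrow> 'a set \<Rightarrow> ('k, 'b) vobj \<Rightarrow> 'b set \<Rightarrow>
   ('k, 'a set, 'b set, 'm, 'n) morita \<Rightarrow> ('k, 'b, 'w) lmodule \<Rightarrow>
   ('k, 'a, 'n \<Rightarrow> 'w) lmodule" where
  "morita_image \<V> k A I B J C W =
     (let H = hom_lmodule \<V> k B (inflate B J A I (mor_N C)) W;
          U = morita_map \<V> k A I B J C W
                ` carrier (tensor_lmodule \<V> B (inflate A I B J (mor_M C)) W)
      in H\<lparr>carrier := U, hcomp := (\<lambda>i. hcomp H i \<inter> U)\<rparr>)"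

section \<open>Prestandard and standard filters\<close>

text \<open>The poset is a subset \<open>\<Lambda>\<close> of an ordered type, so that it may be empty.\<close>

definition well_founded_poset :: "'l::order set \<Rightarrow> bool" where
  "well_founded_poset \<Lambda> \<longleftrightarrow> (\<forall>S\<subseteq>\<Lambda>. S \<noteq> {} \<longrightarrow> (\<exists>m\<in>S. \<forall>s\<in>S. \<not> s < m))"

definition ideal_sum :: "('k, 'a) vobj \<Rightarrow> ('l \<Rightarrow> 'a set) \<Rightarrow> 'l set \<Rightarrow> 'a set" where
  "ideal_sum A F S = generate (add_monoid A) (\<Union>l\<in>S. F l)"

definition ideal_filter ::
  "vcat \<Rightarrow> 'k ring \<Rightarrow> 'l::order set \<Rightarrow> ('k, 'a) vobj \<Rightarrow> ('l \<Rightarrow> 'a set) \<Rightarrow> bool" where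
  "ideal_filter \<V> k \<Lambda> A F \<longleftrightarrow>
     (\<forall>l\<in>\<Lambda>. videal \<V> k A (F l)) \<and>
     (\<forall>l\<in>\<Lambda>. \<forall>m\<in>\<Lambda>. l \<le> m \<longrightarrow> F l \<subseteq> F m) \<and>
     carrier A = ideal_sum A F \<Lambda> \<and>
     (\<forall>l\<in>\<Lambda>. \<forall>m\<in>\<Lambda>. F l \<cdot>\<^bsub>A\<^esub> F m \<subseteq> ideal_sum A F {n\<in>\<Lambda>. n \<le> l \<and> n \<le> m})"

text \<open>The ideal \<open>A\<^sup><\<^sup>l\<close>.\<close>

definition below :: "'l::order set \<Rightarrow> ('k, 'a) vobj \<Rightarrow> ('l \<Rightarrow> 'a set) \<Rightarrow> 'l \<Rightarrow> 'a set" where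
  "below \<Lambda> A F l = ideal_sum A F {m\<in>\<Lambda>. m < l}"

text \<open>The ideals \<open>A\<^sup>\<le>\<^sup>l\<close> and \<open>B'\<^sub>l\<close>, and the Morita contexts.\<close>

record ('k, 'l, 'a, 'b, 'm, 'n) filter_data =
  flt :: "'l \<Rightarrow> 'a set"
  bideal :: "'l \<Rightarrow> 'b set"
  ctx :: "'l \<Rightarrow> ('k, 'a set, 'b set, 'm, 'n) morita"

definition prestandard_filter ::
  "vcat \<Rightarrow> 'k ring \<Rightarrow> 'l::order set \<Rightarrow> ('k, 'a) vobj \<Rightarrow> ('l \<Rightarrow> ('k, 'b) vobj) \<Rightarrow>
   ('k, 'l, 'a, 'b, 'm, 'n) filter_data \<Rightarrow> bool" where
  "prestandard_filter \<V> k \<Lambda> A B P \<longleftrightarrow>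
     ideal_filter \<V> k \<Lambda> A (flt P) \<and>
     (\<forall>l\<in>\<Lambda>. videal \<V> k (B l) (bideal P l) \<and>
        morita_context \<V> k (quot_algebra A (below \<Lambda> A (flt P) l))
          (quot_algebra (B l) (bideal P l)) (ctx P l) \<and>
        trace_left \<V> (quot_algebra (B l) (bideal P l)) (ctx P l) =
          (\<lambda>a. below \<Lambda> A (flt P) l +>\<^bsub>A\<^esub> a) ` flt P l)"

definition standard_filter ::
  "vcat \<Rightarrow> 'k ring \<Rightarrow> 'l::order set \<Rightarrow> ('k, 'a) vobj \<Rightarrow> ('l \<Rightarrow> ('k, 'b) vobj) \<Rightarrow>
   ('k, 'l, 'a, 'b, 'm, 'n) filter_data \<Rightarrow> bool" where
  "standard_filter \<V> k \<Lambda> A B P \<longleftrightarrow>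
     prestandard_filter \<V> k \<Lambda> A B P \<and>
     (\<forall>l\<in>\<Lambda>. \<forall>m\<in>\<Lambda>. \<not> l \<le> m \<longrightarrow>
        (\<forall>a\<in>flt P m.
           (\<forall>x\<in>carrier (mor_M (ctx P l)).
              lact (mor_M (ctx P l)) (below \<Lambda> A (flt P) l +>\<^bsub>A\<^esub> a) x = \<zero>\<^bsub>mor_M (ctx P l)\<^esub>) \<and>
           (\<forall>y\<in>carrier (mor_N (ctx P l)).
              ract (mor_N (ctx P l)) y (below \<Lambda> A (flt P) l +>\<^bsub>A\<^esub> a) = \<zero>\<^bsub>mor_N (ctx P l)\<^esub>)))"

text \<open>The ideal \<open>B''\<^sub>l \<supseteq> B'\<^sub>l\<close> whose quotient by \<open>B'\<^sub>l\<close> is the trace ideal in \<open>B\<^sub>l/B'\<^sub>l\<close>.\<close>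

definition btrace ::
  "vcat \<Rightarrow> 'l::order set \<Rightarrow> ('k, 'a) vobj \<Rightarrow> ('l \<Rightarrow> ('k, 'b) vobj) \<Rightarrow>
   ('k, 'l, 'a, 'b, 'm, 'n) filter_data \<Rightarrow> 'l \<Rightarrow> 'b set" where
  "btrace \<V> \<Lambda> A B P l =
     {b \<in> carrier (B l). bideal P l +>\<^bsub>B l\<^esub> b \<in>
        trace_right \<V> (quot_algebra A (below \<Lambda> A (flt P) l)) (ctx P l)}"

end

theory Submission
  imports Defs
begin

text \<open>
  Call an \<open>A\<close>-module \<open>V\<close> and a \<open>B\<close>-module \<open>W\<close> linked by a Morita context \<open>(M, N, \<eta>, \<rho>)\<close> if there are
  module maps \<open>\<sigma>: M \<otimes> W \<rightarrow> V\<close> and \<open>\<tau>: N \<otimes> V \<rightarrow> W\<close> with \<open>\<sigma>(x, \<tau>(y, v)) = \<eta>(x, y) v\<close> and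
  \<open>\<tau>(y, \<sigma>(x, w)) = \<rho>(y, x) w\<close>.  The image of \<open>M \<otimes> W \<rightarrow> Hom(N, W)\<close> is linked to \<open>W\<close>, with \<open>\<tau>\<close> the
  evaluation, and it is simple if \<open>W\<close> is simple and generated by the trace ideal.  Two simple modules
  \<open>V\<close> and \<open>V'\<close> linked to the same \<open>W\<close>, both generated by the trace ideal, are isomorphic: \<open>v\<close>
  corresponds to the unique \<open>v'\<close> with \<open>\<tau>'(y, v') = \<tau>(y, v)\<close> for all \<open>y\<close>.  As the notion is symmetric in
  \<open>A\<close> and \<open>B\<close>, this gives the bijection for a single index.  A simple \<open>A\<close>-module belongs to the
  layer of a minimal \<open>\<lambda>\<close> such that the ideal \<open>A\<^sup>\<le>\<^sup>\<lambda>\<close> acts nontrivially; the multiplication rule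
  of the filter makes the layer unique.
\<close>

section \<open>Additive maps\<close>

text \<open>Two features of the setting shape the proof. Subobjects and maps must respect the
  grading, although for a general \<open>y\<close> the map \<open>\<tau> y\<close> mixes degrees. So
  submodules are generated by homogeneous elements, and claims about degrees are tested on
  homogeneous \<open>y\<close>, where \<open>\<tau> y\<close> merely shifts degrees. And the induced
  module consists of functions from \<open>N\<close> to \<open>W\<close>, so its type is not the
  type \<open>'u\<close> of \<open>Irr\<close>; an orbit map \<open>a \<mapsto> a x\<close> bounds
  the size of a simple module and lets it be copied into \<open>'u\<close>. Linking replaces the
  functors between the two module categories: it asks for maps of two variables only, it makes sense
  for modules in any types, and the way back from \<open>A\<close> to \<open>B\<close> is the same
  construction for the swapped context. Values of \<open>\<eta>\<close> in \<open>A/I\<close> are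
  handled through representatives \<open>e x y\<close> in \<open>A\<close>; on modules killed by
  \<open>I\<close> the choice is invisible. \<open>add_hom\<close> asks for compatibility with
  addition only: scalars of \<open>k\<close> act through the unit of the algebra, and maps out of
  \<open>tensor_lmodule\<close> can be treated without its group laws.\<close>

definition add_hom :: "('m, 'y) ring_scheme \<Rightarrow> ('n, 'z) ring_scheme \<Rightarrow> ('m \<Rightarrow> 'n) \<Rightarrow> bool" where
  "add_hom X Y f \<longleftrightarrow> f \<in> carrier X \<rightarrow> carrier Y \<and>
     (\<forall>x\<in>carrier X. \<forall>y\<in>carrier X. f (x \<oplus>\<^bsub>X\<^esub> y) = f x \<oplus>\<^bsub>Y\<^esub> f y)"

abbreviation add_subgroup :: "('m, 'y) ring_scheme \<Rightarrow> 'm set \<Rightarrow> bool" where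
  "add_subgroup X U \<equiv> subgroup U (add_monoid X)"

abbreviation add_span :: "('m, 'y) ring_scheme \<Rightarrow> 'm set \<Rightarrow> 'm set" where
  "add_span X S \<equiv> generate (add_monoid X) S"

lemma abelian_group_diff_zeroD:
  assumes "abelian_group G" "x \<in> carrier G" "y \<in> carrier G" "x \<ominus>\<^bsub>G\<^esub> y = \<zero>\<^bsub>G\<^esub>"
  shows "x = y"
proof -
  interpret abelian_group G by (rule assms(1))
  show ?thesis
    using minus_equality[of x "\<ominus>\<^bsub>G\<^esub> y"] assms by (simp add: a_minus_def)
qed

lemma add_homI:
  assumes "\<And>x. x \<in> carrier X \<Longrightarrow> f x \<in> carrier Y"
    and "\<And>x y. x \<in> carrier X \<Longrightarrow> y \<in> carrier X \<Longrightarrow> f (x \<oplus>\<^bsub>X\<^esub> y) = f x \<oplus>\<^bsub>Y\<^esub> f y"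
  shows "add_hom X Y f"
  using assms by (auto simp: add_hom_def)

lemma add_hom_closed: "add_hom X Y f \<Longrightarrow> x \<in> carrier X \<Longrightarrow> f x \<in> carrier Y"
  by (auto simp: add_hom_def)

lemma add_hom_add:
  "add_hom X Y f \<Longrightarrow> x \<in> carrier X \<Longrightarrow> y \<in> carrier X \<Longrightarrow> f (x \<oplus>\<^bsub>X\<^esub> y) = f x \<oplus>\<^bsub>Y\<^esub> f y"
  by (auto simp: add_hom_def)

context
  fixes X :: "('m, 'y) ring_scheme" and Y :: "('n, 'z) ring_scheme"
  assumes X: "abelian_group X" and Y: "abelian_group Y"
begin

interpretation X: abelian_group X by (rule X)
interpretation Y: abelian_group Y by (rule Y)

lemma add_hom_zero: "add_hom X Y f \<Longrightarrow> f \<zero>\<^bsub>X\<^esub> = \<zero>\<^bsub>Y\<^esub>"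
  by (metis X.zero_closed X.r_zero Y.add.l_cancel_one Y.r_zero add_hom_add add_hom_closed)

lemma add_hom_neg: "add_hom X Y f \<Longrightarrow> x \<in> carrier X \<Longrightarrow> f (\<ominus>\<^bsub>X\<^esub> x) = \<ominus>\<^bsub>Y\<^esub> f x"
  using add_hom_add[of X Y f "\<ominus>\<^bsub>X\<^esub> x" x] add_hom_zero[of f]
    Y.minus_equality[of "f (\<ominus>\<^bsub>X\<^esub> x)" "f x"] by (simp add: add_hom_closed X.l_neg)

lemma add_hom_diff:
  "add_hom X Y f \<Longrightarrow> x \<in> carrier X \<Longrightarrow> y \<in> carrier X \<Longrightarrow> f (x \<ominus>\<^bsub>X\<^esub> y) = f x \<ominus>\<^bsub>Y\<^esub> f y"
  by (simp add: a_minus_def add_hom_add add_hom_neg)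

lemma add_hom_finsum:
  assumes f: "add_hom X Y f" and S: "finite S" and g: "g \<in> S \<rightarrow> carrier X"
  shows "f (\<Oplus>\<^bsub>X\<^esub>i\<in>S. g i) = (\<Oplus>\<^bsub>Y\<^esub>i\<in>S. f (g i))"
  using S g
proof (induction S)
  case empty
  show ?case by (simp add: add_hom_zero[OF f])
next
  case (insert s S)
  have "(\<lambda>i. f (g i)) \<in> S \<rightarrow> carrier Y" "f (g s) \<in> carrier Y"
    using insert.prems by (auto intro!: add_hom_closed[OF f])
  then show ?case
    using insert by (simp add: X.finsum_insert Y.finsum_insert add_hom_add[OF f] Pi_iff)
qed

lemma add_hom_vimage_subgroup:
  assumes f: "add_hom X Y f" and H: "add_subgroup Y H"
  shows "add_subgroup X {x \<in> carrier X. f x \<in> H}"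
proof (rule X.add.subgroupI)
  show "{x \<in> carrier X. f x \<in> H} \<noteq> {}"
    using subgroup.one_closed[OF H] by (auto simp: add_hom_zero[OF f] intro!: exI[of _ "\<zero>\<^bsub>X\<^esub>"])
  show "\<ominus>\<^bsub>X\<^esub> a \<in> {x \<in> carrier X. f x \<in> H}" if "a \<in> {x \<in> carrier X. f x \<in> H}" for a
    using that subgroup.m_inv_closed[OF H, of "f a"]
    by (auto simp: add_hom_neg[OF f] a_inv_def[of Y])
  show "a \<oplus>\<^bsub>X\<^esub> b \<in> {x \<in> carrier X. f x \<in> H}"
    if "a \<in> {x \<in> carrier X. f x \<in> H}" "b \<in> {x \<in> carrier X. f x \<in> H}" for a b
    using that subgroup.m_closed[OF H, of "f a" "f b"] by (auto simp: add_hom_add[OF f])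
qed auto

lemma add_hom_image_subgroup:
  assumes f: "add_hom X Y f" and U: "add_subgroup X U"
  shows "add_subgroup Y (f ` U)"
proof (rule Y.add.subgroupI)
  have UX: "U \<subseteq> carrier X" using subgroup.subset[OF U] by simp
  show "f ` U \<subseteq> carrier Y" using UX add_hom_closed[OF f] by auto
  show "f ` U \<noteq> {}" using subgroup.one_closed[OF U] by auto
  show "\<ominus>\<^bsub>Y\<^esub> u \<in> f ` U" if "u \<in> f ` U" for u
    using that UX subgroup.m_inv_closed[OF U]
    by (auto simp: a_inv_def[of X] subset_iff simp flip: add_hom_neg[OF f])
  show "u \<oplus>\<^bsub>Y\<^esub> v \<in> f ` U" if "u \<in> f ` U" "v \<in> f ` U" for u v
    using that UX subgroup.m_closed[OF U] by (auto simp: subset_iff simp flip: add_hom_add[OF f])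
qed

text \<open>The preimage of \<open>H\<close> under \<open>f\<close> is a subgroup, so it contains
  the span of \<open>S\<close> as soon as it contains \<open>S\<close>. Most arguments below are
  instances: with \<open>H\<close> zero it yields vanishing, with \<open>H\<close> a span it yields
  stability.\<close>

lemma add_hom_span:
  assumes "add_hom X Y f" "S \<subseteq> carrier X" "add_subgroup Y H" "\<And>s. s \<in> S \<Longrightarrow> f s \<in> H"
    and "v \<in> add_span X S"
  shows "f v \<in> H"
  using X.add.generate_subgroup_incl[OF _ add_hom_vimage_subgroup[OF assms(1,3)], of S] assms
  by auto

lemma add_hom_eq_on_span:
  assumes f: "add_hom X Y f" and g: "add_hom X Y g" and S: "S \<subseteq> carrier X"
    and eq: "\<And>s. s \<in> S \<Longrightarrow> f s = g s" and v: "v \<in> add_span X S"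
  shows "f v = g v"
proof -
  have sub: "f x \<ominus>\<^bsub>Y\<^esub> g x \<in> carrier Y" if "x \<in> carrier X" for x
    using that f g by (auto simp: add_hom_closed)
  have h: "add_hom X Y (\<lambda>x. f x \<ominus>\<^bsub>Y\<^esub> g x)"
    using f g by (intro add_homI)
      (auto simp: add_hom_closed add_hom_add a_minus_def Y.minus_add Y.a_ac)
  have "f v \<ominus>\<^bsub>Y\<^esub> g v \<in> {\<zero>\<^bsub>Y\<^esub>}"
  proof (rule add_hom_span[OF h S _ _ v])
    show "add_subgroup Y {\<zero>\<^bsub>Y\<^esub>}"
      using Y.add.triv_subgroup by simp
    show "f s \<ominus>\<^bsub>Y\<^esub> g s \<in> {\<zero>\<^bsub>Y\<^esub>}" if "s \<in> S" for s
    proof -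
      have "g s \<in> carrier Y" using that S g by (auto intro: add_hom_closed)
      then show ?thesis using eq[OF that] by (simp add: a_minus_def Y.r_neg)
    qed
  qed
  moreover have "v \<in> carrier X"
    using v S X.add.generate_in_carrier[of S] by simp
  ultimately show ?thesis
    using f g abelian_group_diff_zeroD[OF Y, of "f v" "g v"] by (simp add: add_hom_closed)
qed

end

lemma add_hom_comp: "add_hom X Y f \<Longrightarrow> add_hom Y Z g \<Longrightarrow> add_hom X Z (\<lambda>x. g (f x))"
  by (auto simp: add_hom_def Pi_iff)

context abelian_group
begin

lemma add_span_subgroup: "S \<subseteq> carrier G \<Longrightarrow> add_subgroup G (add_span G S)"
  using add.generate_is_subgroup by simp

lemma add_span_incl: "S \<subseteq> U \<Longrightarrow> add_subgroup G U \<Longrightarrow> add_span G S \<subseteq> U"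
  by (rule add.generate_subgroup_incl)

lemma add_subgroupI:
  assumes "U \<subseteq> carrier G" "\<zero> \<in> U" "\<And>x. x \<in> U \<Longrightarrow> \<ominus> x \<in> U"
    and "\<And>x y. x \<in> U \<Longrightarrow> y \<in> U \<Longrightarrow> x \<oplus> y \<in> U"
  shows "add_subgroup G U"
  using assms by (intro add.subgroupI) (auto simp: a_inv_def)

lemma add_subgroupD:
  assumes "add_subgroup G U"
  shows "U \<subseteq> carrier G" "\<zero> \<in> U" "\<And>x. x \<in> U \<Longrightarrow> \<ominus> x \<in> U"
    and "\<And>x y. x \<in> U \<Longrightarrow> y \<in> U \<Longrightarrow> x \<oplus> y \<in> U"
    and "\<And>x y. x \<in> U \<Longrightarrow> y \<in> U \<Longrightarrow> x \<ominus> y \<in> U"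
proof -
  show "U \<subseteq> carrier G" using subgroup.subset[OF assms] by simp
  show "\<zero> \<in> U" using subgroup.one_closed[OF assms] by simp
  show neg: "\<ominus> x \<in> U" if "x \<in> U" for x
    using subgroup.m_inv_closed[OF assms that] by (simp add: a_inv_def)
  show add: "x \<oplus> y \<in> U" if "x \<in> U" "y \<in> U" for x y
    using subgroup.m_closed[OF assms that] by simp
  show "x \<ominus> y \<in> U" if "x \<in> U" "y \<in> U" for x y
    using that neg add by (simp add: a_minus_def)
qed

lemma add_subgroup_finsum:
  assumes U: "add_subgroup G U" and S: "finite S" and g: "\<And>i. i \<in> S \<Longrightarrow> g i \<in> U"
  shows "(\<Oplus>i\<in>S. g i) \<in> U"
  using S g
proof (induction S)
  case empty
  show ?case using add_subgroupD(2)[OF U] by simp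
next
  case (insert s S)
  have "g \<in> S \<rightarrow> carrier G" "g s \<in> carrier G"
    using insert.prems add_subgroupD(1)[OF U] by auto
  then show ?case
    using insert add_subgroupD(4)[OF U] by (simp add: finsum_insert)
qed

text \<open>One summand per index is enough because each \<open>C i\<close> is itself a subgroup:
  sums of this shape are closed under addition and negation. This supplies the homogeneous
  decompositions in \<open>vobjectI\<close> and the finite sums of homogeneous maps in
  \<open>H_carrier\<close>.\<close>

lemma add_span_UN:
  fixes D :: "'i set" and C :: "'i \<Rightarrow> 'a set"
  assumes C: "\<And>i. i \<in> D \<Longrightarrow> add_subgroup G (C i)" and v: "v \<in> add_span G (\<Union>i\<in>D. C i)"
  shows "\<exists>S g. finite S \<and> S \<subseteq> D \<and> (\<forall>i\<in>S. g i \<in> C i) \<and> v = (\<Oplus>i\<in>S. g i)"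
proof -
  have hc: "C i \<subseteq> carrier G" if "i \<in> D" for i
    using add_subgroupD(1)[OF C[OF that]] .
  define T where "T = {v \<in> carrier G. \<exists>S g. finite S \<and> S \<subseteq> D \<and> (\<forall>i\<in>S. g i \<in> C i) \<and>
      v = (\<Oplus>i\<in>S. g i)}"
  have "add_subgroup G T"
  proof (rule add_subgroupI)
    show "\<zero> \<in> T" by (auto simp: T_def intro!: exI[of _ "{}"])
    show "\<ominus> x \<in> T" if "x \<in> T" for x
    proof -
      obtain S g where S: "finite S" "S \<subseteq> D" and g: "\<forall>i\<in>S. g i \<in> C i"
        and x: "x = (\<Oplus>i\<in>S. g i)" and xc: "x \<in> carrier G"
        using \<open>x \<in> T\<close> by (auto simp: T_def)
      have neg: "add_hom G G (\<lambda>x. \<ominus> x)" by (intro add_homI) (auto simp: minus_add a_ac)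
      have "\<ominus> x = (\<Oplus>i\<in>S. \<ominus> g i)"
        unfolding x using S g hc by (intro add_hom_finsum[OF abelian_group_axioms abelian_group_axioms neg]) auto
      then show ?thesis
        using S g add_subgroupD(3)[OF C] a_inv_closed[OF xc]
        by (auto simp: T_def simp del: a_inv_closed intro!: exI[of _ S] exI[of _ "\<lambda>i. \<ominus> g i"])
    qed
    show "x \<oplus> y \<in> T" if "x \<in> T" "y \<in> T" for x y
    proof -
      obtain S g where S: "finite S" "S \<subseteq> D" and g: "\<forall>i\<in>S. g i \<in> C i"
        and x: "x = (\<Oplus>i\<in>S. g i)" and xc: "x \<in> carrier G"
        using \<open>x \<in> T\<close> by (auto simp: T_def)
      obtain S' g' where S': "finite S'" "S' \<subseteq> D" and g': "\<forall>i\<in>S'. g' i \<in> C i"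
        and y: "y = (\<Oplus>i\<in>S'. g' i)" and yc: "y \<in> carrier G"
        using \<open>y \<in> T\<close> by (auto simp: T_def)
      \<comment> \<open>\<open>ext\<close> pads a family with zeros, so that both sums run over
        \<open>S \<union> S'\<close> and can be added term by term.\<close>
      define ext where "ext = (\<lambda>S g (i :: 'i). if i \<in> S then g i else \<zero>)"
      have gc: "\<And>i. i \<in> S \<Longrightarrow> g i \<in> carrier G" "\<And>i. i \<in> S' \<Longrightarrow> g' i \<in> carrier G"
        using S S' g g' hc by blast+
      have "x = (\<Oplus>i\<in>S \<union> S'. ext S g i)" "y = (\<Oplus>i\<in>S \<union> S'. ext S' g' i)"
        unfolding x y using S S' gc
        by (auto intro!: add.finprod_mono_neutral_cong_left simp: ext_def)
      then have "x \<oplus> y = (\<Oplus>i\<in>S \<union> S'. ext S g i \<oplus> ext S' g' i)"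
        using S S' gc by (subst finsum_addf) (auto simp: ext_def)
      moreover have "ext S g i \<oplus> ext S' g' i \<in> C i" if "i \<in> S \<union> S'" for i
        using that S S' g g' add_subgroupD(2)[OF C]
        by (intro add_subgroupD(4)[OF C]) (auto simp: ext_def)
      ultimately show ?thesis
        using S S' a_closed[OF xc yc]
        by (auto simp: T_def simp del: a_closed intro!: exI[of _ "S \<union> S'"] exI[of _ "\<lambda>i. ext S g i \<oplus> ext S' g' i"])
    qed
  qed (auto simp: T_def)
  moreover have "(\<Union>i\<in>D. C i) \<subseteq> T"
  proof
    fix v assume "v \<in> (\<Union>i\<in>D. C i)"
    then obtain i where i: "i \<in> D" "v \<in> C i" by auto
    then have "v \<in> carrier G" using hc by blast
    then show "v \<in> T"
      using i by (auto simp: T_def finsum_insert intro!: exI[of _ "{i}"] exI[of _ "\<lambda>_. v"])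
  qed
  ultimately have "v \<in> T" using add_span_incl v by blast
  then show ?thesis unfolding T_def by blast
qed

end

section \<open>Homogeneous components\<close>

lemma dplus_degs [simp]: "i \<in> degs \<V> \<Longrightarrow> j \<in> degs \<V> \<Longrightarrow> dplus \<V> i j \<in> degs \<V>"
  by (cases \<V>) auto

lemma dplus_assoc: "dplus \<V> (dplus \<V> i j) l = dplus \<V> i (dplus \<V> j l)"
  by (cases \<V>) (auto simp: mod_simps algebra_simps)

text \<open>Since Z/2 is encoded by the representatives 0 and 1, cancellation holds on
  \<open>degs \<V>\<close> only: in the super case 0 and 2 have the same sum with any
  degree.\<close>

lemma dplus_cancel:
  "i \<in> degs \<V> \<Longrightarrow> j \<in> degs \<V> \<Longrightarrow> l \<in> degs \<V> \<Longrightarrow> dplus \<V> i j = dplus \<V> i l \<longleftrightarrow> j = l"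
  by (cases \<V>) auto

text \<open>The projection onto degree \<open>i\<close>; for elements of the carrier the function
  selected by \<open>THE\<close> exists and is unique by \<open>vobject\<close>. As an additive map
  it can be pushed through spans, unlike the existential form in \<open>subobject\<close>.\<close>

definition hpart :: "vcat \<Rightarrow> ('k, 'm, 'z) vobj_scheme \<Rightarrow> int \<Rightarrow> 'm \<Rightarrow> 'm" where
  "hpart \<V> X i v = (THE f. homog_decomp \<V> X v f) i"

definition homogeneous :: "vcat \<Rightarrow> ('k, 'm, 'z) vobj_scheme \<Rightarrow> 'm set" where
  "homogeneous \<V> X = (\<Union>i\<in>degs \<V>. hcomp X i)"

locale vspace = module k X for k :: "'k ring" and X :: "('k, 'm, 'z) vobj_scheme" (structure) +
  fixes \<V> :: vcat
  assumes vobject: "vobject \<V> k X"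
begin

lemma hcomp_submodule: "i \<in> degs \<V> \<Longrightarrow> submodule (hcomp X i) k X"
  using vobject by (auto simp: vobject_def)

lemma hcomp_subgroup: "i \<in> degs \<V> \<Longrightarrow> add_subgroup X (hcomp X i)"
  using hcomp_submodule submodule.axioms(1) by blast

lemma hcomp_carrier: "i \<in> degs \<V> \<Longrightarrow> x \<in> hcomp X i \<Longrightarrow> x \<in> carrier X"
  using M.add_subgroupD(1)[OF hcomp_subgroup] by blast

lemma homogeneous_carrier: "homogeneous \<V> X \<subseteq> carrier X"
  by (auto simp: homogeneous_def hcomp_carrier)

lemma homog_decomp_hpart:
  assumes "v \<in> carrier X"
  shows "homog_decomp \<V> X v (THE f. homog_decomp \<V> X v f)"
proof -
  have "\<exists>!f. homog_decomp \<V> X v f" using vobject assms unfolding vobject_def by blast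
  then show ?thesis by (rule theI')
qed

lemma hpart_hcomp: "v \<in> carrier X \<Longrightarrow> i \<in> degs \<V> \<Longrightarrow> hpart \<V> X i v \<in> hcomp X i"
  using homog_decomp_hpart[of v] by (auto simp: homog_decomp_def hpart_def PiE_iff)

lemma hpart_closed: "v \<in> carrier X \<Longrightarrow> i \<in> degs \<V> \<Longrightarrow> hpart \<V> X i v \<in> carrier X"
  using hpart_hcomp hcomp_carrier by blast

lemma finite_hpart: "v \<in> carrier X \<Longrightarrow> finite {i \<in> degs \<V>. hpart \<V> X i v \<noteq> \<zero>\<^bsub>X\<^esub>}"
  using homog_decomp_hpart[of v] by (auto simp: homog_decomp_def hpart_def)

lemma sum_hpart:
  "v \<in> carrier X \<Longrightarrow> v = (\<Oplus>\<^bsub>X\<^esub>i\<in>{i \<in> degs \<V>. hpart \<V> X i v \<noteq> \<zero>\<^bsub>X\<^esub>}. hpart \<V> X i v)"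
  using homog_decomp_hpart[of v] by (auto simp: homog_decomp_def hpart_def)

lemma carrier_eq_span: "carrier X = add_span X (homogeneous \<V> X)"
proof
  show "carrier X \<subseteq> add_span X (homogeneous \<V> X)"
  proof
    fix v assume v: "v \<in> carrier X"
    have "(\<Oplus>\<^bsub>X\<^esub>i\<in>{i \<in> degs \<V>. hpart \<V> X i v \<noteq> \<zero>\<^bsub>X\<^esub>}. hpart \<V> X i v) \<in> add_span X (homogeneous \<V> X)"
      using finite_hpart[OF v] v
      by (intro M.add_subgroup_finsum M.add_span_subgroup homogeneous_carrier generate.incl)
        (auto simp: homogeneous_def intro: hpart_hcomp)
    then show "v \<in> add_span X (homogeneous \<V> X)"
      using sum_hpart[OF v] by simp
  qed
  show "add_span X (homogeneous \<V> X) \<subseteq> carrier X"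
    using M.add.generate_incl[of "homogeneous \<V> X"] homogeneous_carrier by simp
qed

text \<open>Uniqueness of decompositions in usable form: a finite sum of homogeneous elements of
  distinct degrees, some of them possibly zero, already displays its components.\<close>

lemma hpart_eqI:
  assumes S: "finite S" "S \<subseteq> degs \<V>" and g: "\<And>i. i \<in> S \<Longrightarrow> g i \<in> hcomp X i"
    and v: "v = (\<Oplus>\<^bsub>X\<^esub>i\<in>S. g i)" and j: "j \<in> degs \<V>"
  shows "hpart \<V> X j v = (if j \<in> S then g j else \<zero>\<^bsub>X\<^esub>)"
proof -
  \<comment> \<open>\<open>homog_decomp\<close> wants a function on all of \<open>degs \<V>\<close>,
    summed over its support only. So \<open>g\<close> is padded with zeros, and its vanishing terms
    drop out of the sum.\<close>
  define f where "f = (\<lambda>i\<in>degs \<V>. if i \<in> S then g i else \<zero>\<^bsub>X\<^esub>)"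
  have gc: "g \<in> S \<rightarrow> carrier X"
    using g S hcomp_carrier by blast
  have vc: "v \<in> carrier X"
    using gc v by (simp add: M.finsum_closed)
  have f: "f \<in> (\<Pi>\<^sub>E i\<in>degs \<V>. hcomp X i)"
    using g M.add_subgroupD(2)[OF hcomp_subgroup] by (auto simp: f_def)
  have S': "{i \<in> degs \<V>. f i \<noteq> \<zero>\<^bsub>X\<^esub>} \<subseteq> S"
    by (auto simp: f_def split: if_splits)
  have "(\<Oplus>\<^bsub>X\<^esub>i\<in>{i \<in> degs \<V>. f i \<noteq> \<zero>\<^bsub>X\<^esub>}. f i) = (\<Oplus>\<^bsub>X\<^esub>i\<in>S. g i)"
    using S S' gc by (intro M.add.finprod_mono_neutral_cong_left) (auto simp: f_def)
  then have "homog_decomp \<V> X v f"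
    using f S' S finite_subset by (auto simp: homog_decomp_def v)
  then have "(THE f. homog_decomp \<V> X v f) = f"
    using vobject vc by (intro the1_equality) (auto simp: vobject_def)
  then show ?thesis
    using j by (simp add: hpart_def f_def)
qed

lemma hpart_homog:
  assumes "i \<in> degs \<V>" "j \<in> degs \<V>" "v \<in> hcomp X i"
  shows "hpart \<V> X j v = (if j = i then v else \<zero>\<^bsub>X\<^esub>)"
  using hpart_eqI[of "{i}" "\<lambda>_. v" v j] assms hcomp_carrier[of i v]
  by (simp add: M.finsum_insert)

lemma hpart_add_hom:
  assumes j: "j \<in> degs \<V>"
  shows "add_hom X X (hpart \<V> X j)"
proof (rule add_homI)
  fix x y assume x: "x \<in> carrier X" and y: "y \<in> carrier X"
  \<comment> \<open>The supports of \<open>x\<close> and \<open>y\<close> may differ and components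
    may cancel in \<open>x + y\<close>; the union of both supports covers all cases.\<close>
  define S where "S = {i \<in> degs \<V>. hpart \<V> X i x \<noteq> \<zero>\<^bsub>X\<^esub>} \<union> {i \<in> degs \<V>. hpart \<V> X i y \<noteq> \<zero>\<^bsub>X\<^esub>}"
  have S: "finite S" "S \<subseteq> degs \<V>"
    using finite_hpart x y by (auto simp: S_def)
  have ext: "z = (\<Oplus>\<^bsub>X\<^esub>i\<in>S. hpart \<V> X i z)"
    if "z \<in> carrier X" "{i \<in> degs \<V>. hpart \<V> X i z \<noteq> \<zero>\<^bsub>X\<^esub>} \<subseteq> S" for z
  proof -
    have "(\<Oplus>\<^bsub>X\<^esub>i\<in>{i \<in> degs \<V>. hpart \<V> X i z \<noteq> \<zero>\<^bsub>X\<^esub>}. hpart \<V> X i z) = (\<Oplus>\<^bsub>X\<^esub>i\<in>S. hpart \<V> X i z)"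
      using that S by (intro M.add.finprod_mono_neutral_cong_left) (auto simp: hpart_closed)
    then show ?thesis using sum_hpart[OF that(1)] by simp
  qed
  have "x \<oplus>\<^bsub>X\<^esub> y = (\<Oplus>\<^bsub>X\<^esub>i\<in>S. hpart \<V> X i x) \<oplus>\<^bsub>X\<^esub> (\<Oplus>\<^bsub>X\<^esub>i\<in>S. hpart \<V> X i y)"
    using ext[OF x] ext[OF y] by (auto simp: S_def)
  also have "\<dots> = (\<Oplus>\<^bsub>X\<^esub>i\<in>S. hpart \<V> X i x \<oplus>\<^bsub>X\<^esub> hpart \<V> X i y)"
    using S x y by (intro M.finsum_addf[symmetric]) (auto simp: hpart_closed)
  finally have "hpart \<V> X j (x \<oplus>\<^bsub>X\<^esub> y) =
      (if j \<in> S then hpart \<V> X j x \<oplus>\<^bsub>X\<^esub> hpart \<V> X j y else \<zero>\<^bsub>X\<^esub>)"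
    using S x y j
    by (intro hpart_eqI) (auto intro!: M.add_subgroupD(4)[OF hcomp_subgroup] hpart_hcomp)
  then show "hpart \<V> X j (x \<oplus>\<^bsub>X\<^esub> y) = hpart \<V> X j x \<oplus>\<^bsub>X\<^esub> hpart \<V> X j y"
    using j by (auto simp: S_def)
qed (use hpart_closed[OF _ j] in auto)

lemma nonzero_hpart:
  assumes "v \<in> carrier X" "v \<noteq> \<zero>\<^bsub>X\<^esub>"
  shows "\<exists>i\<in>degs \<V>. hpart \<V> X i v \<noteq> \<zero>\<^bsub>X\<^esub>"
proof (rule ccontr)
  assume "\<not> ?thesis"
  then have "{i \<in> degs \<V>. hpart \<V> X i v \<noteq> \<zero>\<^bsub>X\<^esub>} = {}" by auto
  then show False using sum_hpart[OF assms(1)] assms(2) by (simp only: M.finsum_empty)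
qed

lemma subobject_iff:
  "subobject \<V> k X U \<longleftrightarrow> submodule U k X \<and> (\<forall>u\<in>U. \<forall>i\<in>degs \<V>. hpart \<V> X i u \<in> U)"
proof (cases "submodule U k X")
  case True
  have "(\<exists>f. homog_decomp \<V> X u f \<and> (\<forall>i\<in>degs \<V>. f i \<in> U)) \<longleftrightarrow> (\<forall>i\<in>degs \<V>. hpart \<V> X i u \<in> U)"
    if "u \<in> U" for u
  proof -
    have u: "u \<in> carrier X" using submoduleE(1)[OF True] that by blast
    have "f = (THE f. homog_decomp \<V> X u f)" if "homog_decomp \<V> X u f" for f
      using vobject u that by (intro the1_equality[symmetric]) (auto simp: vobject_def)
    then show ?thesis
      using homog_decomp_hpart[OF u] unfolding hpart_def by blast
  qed
  then show ?thesis by (auto simp: subobject_def)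
qed (auto simp: subobject_def)

text \<open>A projection sends a homogeneous generator to itself or to zero, and additivity does the
  rest. This is the source of all graded submodules below.\<close>

lemma span_homogeneous_hpart:
  assumes S: "S \<subseteq> homogeneous \<V> X" and u: "u \<in> add_span X S" and i: "i \<in> degs \<V>"
  shows "hpart \<V> X i u \<in> add_span X S"
proof (rule add_hom_span[OF _ _ hpart_add_hom[OF i] _ _ _ u])
  show "add_subgroup X (add_span X S)" "S \<subseteq> carrier X"
    using S homogeneous_carrier by (auto intro!: M.add_span_subgroup)
  show "hpart \<V> X i s \<in> add_span X S" if s: "s \<in> S" for s
  proof -
    obtain j where "j \<in> degs \<V>" "s \<in> hcomp X j"
      using s S unfolding homogeneous_def by blast
    then show ?thesis
      using that i generate.one[of "add_monoid X" S]
      by (auto simp: hpart_homog intro: generate.incl)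
  qed
qed (rule M.abelian_group_axioms)+

end

lemma vspaceI: "vobject \<V> k X \<Longrightarrow> vspace k X \<V>"
  by (simp add: vobject_def vspace_def vspace_axioms_def)

text \<open>Uniqueness of decompositions is replaced by a condition on single elements: each
  non-zero homogeneous \<open>x\<close> is detected by an additive map \<open>q\<close> that kills
  all other degrees. If two decompositions of \<open>v\<close> differed in degree \<open>d\<close>,
  the map that detects the difference of these two parts would take the value \<open>q v\<close> on
  both of them, a contradiction.\<close>

lemma vobjectI:
  fixes X :: "('k, 'm, 'z) vobj_scheme" and G :: "('g, 'y) ring_scheme"
  assumes X: "module k X" and sub: "\<And>i. i \<in> degs \<V> \<Longrightarrow> submodule (hcomp X i) k X"
    and span: "carrier X \<subseteq> add_span X (homogeneous \<V> X)"
    and G: "abelian_group G"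
    and sep: "\<And>d x. d \<in> degs \<V> \<Longrightarrow> x \<in> hcomp X d \<Longrightarrow> x \<noteq> \<zero>\<^bsub>X\<^esub> \<Longrightarrow>
      \<exists>q. add_hom X G q \<and> q x \<noteq> \<zero>\<^bsub>G\<^esub> \<and> (\<forall>j\<in>degs \<V>. j \<noteq> d \<longrightarrow> (\<forall>z\<in>hcomp X j. q z = \<zero>\<^bsub>G\<^esub>))"
  shows "vobject \<V> k X"
proof -
  interpret X: module k X by (rule X)
  interpret G: abelian_group G by (rule G)
  note XX = X.M.abelian_group_axioms
  have sg: "add_subgroup X (hcomp X i)" if "i \<in> degs \<V>" for i
    using sub[OF that] submodule.axioms(1) by blast
  have hc: "hcomp X i \<subseteq> carrier X" if "i \<in> degs \<V>" for i
    using X.M.add_subgroupD(1)[OF sg[OF that]] .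
  \<comment> \<open>Applied to any decomposition of \<open>v\<close>, the map \<open>q\<close>
    leaves only the term of degree \<open>d\<close>.\<close>
  have q_decomp: "q v = q (f d)"
    if "homog_decomp \<V> X v f" and d: "d \<in> degs \<V>" and q: "add_hom X G q"
      and q0: "\<forall>j\<in>degs \<V>. j \<noteq> d \<longrightarrow> (\<forall>z\<in>hcomp X j. q z = \<zero>\<^bsub>G\<^esub>)" for v f d q
  proof -
    have f: "\<And>i. i \<in> degs \<V> \<Longrightarrow> f i \<in> hcomp X i"
      and fin: "finite {i \<in> degs \<V>. f i \<noteq> \<zero>\<^bsub>X\<^esub>}"
      and v: "v = (\<Oplus>\<^bsub>X\<^esub>i\<in>{i \<in> degs \<V>. f i \<noteq> \<zero>\<^bsub>X\<^esub>}. f i)"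
      using that(1) by (auto simp: homog_decomp_def)
    have fc: "f i \<in> carrier X" if "i \<in> degs \<V>" for i using f hc that by blast
    have "q v = (\<Oplus>\<^bsub>G\<^esub>i\<in>{i \<in> degs \<V>. f i \<noteq> \<zero>\<^bsub>X\<^esub>}. q (f i))"
      unfolding v by (rule add_hom_finsum[OF XX G q fin]) (auto simp: fc)
    also have "\<dots> = (\<Oplus>\<^bsub>G\<^esub>i\<in>{d}. q (f i))"
      by (rule G.add.finprod_mono_neutral_cong)
        (use q0 fin f d fc add_hom_closed[OF q] add_hom_zero[OF XX G q] in auto)
    also have "\<dots> = q (f d)"
      using fc[OF d] add_hom_closed[OF q] by (simp add: G.finsum_insert)
    finally show ?thesis .
  qed
  have uniq: "f = g" if f: "homog_decomp \<V> X v f" and g: "homog_decomp \<V> X v g" for v f g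
  proof (rule PiE_ext)
    show "f \<in> (\<Pi>\<^sub>E i\<in>degs \<V>. hcomp X i)" "g \<in> (\<Pi>\<^sub>E i\<in>degs \<V>. hcomp X i)"
      using f g by (auto simp: homog_decomp_def)
    then have fg: "\<And>i. i \<in> degs \<V> \<Longrightarrow> f i \<in> hcomp X i \<and> g i \<in> hcomp X i" by auto
    show "f d = g d" if d: "d \<in> degs \<V>" for d
    proof (rule ccontr)
      assume ne: "f d \<noteq> g d"
      have c: "f d \<in> carrier X" "g d \<in> carrier X" using fg[OF d] hc[OF d] by auto
      have "f d \<ominus>\<^bsub>X\<^esub> g d \<in> hcomp X d"
        using fg[OF d] X.M.add_subgroupD(5)[OF sg[OF d]] by blast
      moreover have "f d \<ominus>\<^bsub>X\<^esub> g d \<noteq> \<zero>\<^bsub>X\<^esub>" using ne c abelian_group_diff_zeroD[OF XX] by blast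
      ultimately obtain q where q: "add_hom X G q" "q (f d \<ominus>\<^bsub>X\<^esub> g d) \<noteq> \<zero>\<^bsub>G\<^esub>"
        "\<forall>j\<in>degs \<V>. j \<noteq> d \<longrightarrow> (\<forall>z\<in>hcomp X j. q z = \<zero>\<^bsub>G\<^esub>)"
        using sep[OF d] by blast
      have "q (f d) = q (g d)"
        using q_decomp[OF f d q(1,3)] q_decomp[OF g d q(1,3)] by simp
      then show False
        using q(2) c add_hom_closed[OF q(1)]
        by (simp add: add_hom_diff[OF XX G q(1)] a_minus_def[of G] G.r_neg)
    qed
  qed
  have T: "\<exists>S g. finite S \<and> S \<subseteq> degs \<V> \<and> (\<forall>i\<in>S. g i \<in> hcomp X i) \<and> v = (\<Oplus>\<^bsub>X\<^esub>i\<in>S. g i)"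
    if "v \<in> carrier X" for v
    using X.M.add_span_UN[where D = "degs \<V>" and C = "hcomp X", OF sg subsetD[OF span that, unfolded homogeneous_def]] .
  have ex: "\<exists>f. homog_decomp \<V> X v f" if vc: "v \<in> carrier X" for v
  proof -
    obtain S g where S: "finite S" "S \<subseteq> degs \<V>" and g: "\<forall>i\<in>S. g i \<in> hcomp X i"
      and v: "v = (\<Oplus>\<^bsub>X\<^esub>i\<in>S. g i)"
      using T[OF vc] by blast
    define f where "f = (\<lambda>i\<in>degs \<V>. if i \<in> S then g i else \<zero>\<^bsub>X\<^esub>)"
    have S': "{i \<in> degs \<V>. f i \<noteq> \<zero>\<^bsub>X\<^esub>} \<subseteq> S"
      by (auto simp: f_def split: if_splits)
    have gc: "\<And>i. i \<in> S \<Longrightarrow> g i \<in> carrier X" using S g hc by blast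
    have "(\<Oplus>\<^bsub>X\<^esub>i\<in>{i \<in> degs \<V>. f i \<noteq> \<zero>\<^bsub>X\<^esub>}. f i) = (\<Oplus>\<^bsub>X\<^esub>i\<in>S. g i)"
      using S S' gc by (intro X.M.add.finprod_mono_neutral_cong_left) (auto simp: f_def)
    then have "homog_decomp \<V> X v f"
      using g S' S finite_subset X.M.add_subgroupD(2)[OF sg] v
      by (auto simp: homog_decomp_def f_def)
    then show ?thesis by blast
  qed
  show ?thesis
    using X sub ex uniq by (auto simp: vobject_def)
qed

section \<open>Graded left modules\<close>

locale lmod = vspace k X \<V>
  for k :: "'k ring" and X :: "('k, 'a, 'm, 'x) lmodule_scheme" (structure) and \<V> +
  fixes A :: "('k, 'a, 'y) vobj_scheme"
  assumes valgebra: "valgebra \<V> k A" and left_module: "left_module \<V> k A X"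
begin

lemma A_ring: "ring A"
  using valgebra by (simp add: valgebra_def)

sublocale A: ring A by (rule A_ring)

sublocale A: vspace k A \<V>
  using valgebra by (intro vspaceI) (simp add: valgebra_def)

lemma act_closed [simp, intro]: "a \<in> carrier A \<Longrightarrow> x \<in> carrier X \<Longrightarrow> lact X a x \<in> carrier X"
  using left_module by (simp add: left_module_def)

lemma act_add_left:
  "a \<in> carrier A \<Longrightarrow> b \<in> carrier A \<Longrightarrow> x \<in> carrier X \<Longrightarrow>
   lact X (a \<oplus>\<^bsub>A\<^esub> b) x = lact X a x \<oplus>\<^bsub>X\<^esub> lact X b x"
  using left_module by (simp add: left_module_def)

lemma act_mult:
  "a \<in> carrier A \<Longrightarrow> b \<in> carrier A \<Longrightarrow> x \<in> carrier X \<Longrightarrow>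
   lact X (a \<otimes>\<^bsub>A\<^esub> b) x = lact X a (lact X b x)"
  using left_module by (simp add: left_module_def)

lemma act_add_right:
  "a \<in> carrier A \<Longrightarrow> x \<in> carrier X \<Longrightarrow> y \<in> carrier X \<Longrightarrow>
   lact X a (x \<oplus>\<^bsub>X\<^esub> y) = lact X a x \<oplus>\<^bsub>X\<^esub> lact X a y"
  using left_module by (simp add: left_module_def)

lemma act_smult:
  "c \<in> carrier k \<Longrightarrow> a \<in> carrier A \<Longrightarrow> x \<in> carrier X \<Longrightarrow>
   lact X (c \<odot>\<^bsub>A\<^esub> a) x = c \<odot>\<^bsub>X\<^esub> lact X a x"
  using left_module by (simp add: left_module_def)

lemma act_one [simp]: "x \<in> carrier X \<Longrightarrow> lact X \<one>\<^bsub>A\<^esub> x = x"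
  using left_module by (simp add: left_module_def)

lemma act_hcomp:
  "i \<in> degs \<V> \<Longrightarrow> j \<in> degs \<V> \<Longrightarrow> a \<in> hcomp A i \<Longrightarrow> x \<in> hcomp X j \<Longrightarrow>
   lact X a x \<in> hcomp X (dplus \<V> i j)"
  using left_module by (simp add: left_module_def)

lemma smult_eq_act: "c \<in> carrier k \<Longrightarrow> x \<in> carrier X \<Longrightarrow> c \<odot>\<^bsub>X\<^esub> x = lact X (c \<odot>\<^bsub>A\<^esub> \<one>\<^bsub>A\<^esub>) x"
  by (simp add: act_smult)

lemma act_left_hom: "x \<in> carrier X \<Longrightarrow> add_hom A X (\<lambda>a. lact X a x)"
  by (intro add_homI) (auto simp: act_add_left)

lemma act_right_hom: "a \<in> carrier A \<Longrightarrow> add_hom X X (lact X a)"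
  by (intro add_homI) (auto simp: act_add_right)

lemmas X_abelian = M.abelian_group_axioms
lemmas A_abelian = A.abelian_group_axioms

lemma act_zero_left [simp]: "x \<in> carrier X \<Longrightarrow> lact X \<zero>\<^bsub>A\<^esub> x = \<zero>\<^bsub>X\<^esub>"
  by (rule add_hom_zero[OF A_abelian X_abelian act_left_hom])

lemma act_zero_right [simp]: "a \<in> carrier A \<Longrightarrow> lact X a \<zero>\<^bsub>X\<^esub> = \<zero>\<^bsub>X\<^esub>"
  by (rule add_hom_zero[OF X_abelian X_abelian act_right_hom])

text \<open>Closure under \<open>k\<close> is left to the action of \<open>c 1\<close>, and
  gradedness is expressed by projections; \<open>lsub_iff\<close> identifies these sets with the
  submodules quantified over in \<open>simple_module\<close>.\<close>

definition lsub :: "'m set \<Rightarrow> bool" where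
  "lsub U \<longleftrightarrow> add_subgroup X U \<and> (\<forall>a\<in>carrier A. \<forall>u\<in>U. lact X a u \<in> U) \<and>
     (\<forall>i\<in>degs \<V>. \<forall>u\<in>U. hpart \<V> X i u \<in> U)"

lemma lsub_iff: "lsub U \<longleftrightarrow> subobject \<V> k X U \<and> (\<forall>a\<in>carrier A. \<forall>u\<in>U. lact X a u \<in> U)"
proof -
  have "submodule U k X" if U: "add_subgroup X U" "\<forall>a\<in>carrier A. \<forall>u\<in>U. lact X a u \<in> U"
    using U M.add_subgroupD[OF U(1)] A.smult_closed
    by (intro submoduleI) (auto simp: subset_iff smult_eq_act)
  then show ?thesis
    using submodule.axioms(1) by (auto simp: lsub_def subobject_iff)
qed

lemma lsub_carrier: "lsub U \<Longrightarrow> U \<subseteq> carrier X"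
  using M.add_subgroupD(1) by (auto simp: lsub_def)

lemma simple_module_iff:
  "simple_module \<V> k A X \<longleftrightarrow>
     carrier X \<noteq> {\<zero>\<^bsub>X\<^esub>} \<and> (\<forall>U. lsub U \<longrightarrow> U = {\<zero>\<^bsub>X\<^esub>} \<or> U = carrier X)"
  using left_module by (simp add: simple_module_def lsub_iff)

lemma lsub_spanI:
  assumes S: "S \<subseteq> homogeneous \<V> X"
    and act: "\<And>a s. a \<in> homogeneous \<V> A \<Longrightarrow> s \<in> S \<Longrightarrow> lact X a s \<in> add_span X S"
  shows "lsub (add_span X S)"
proof -
  have SX: "S \<subseteq> carrier X" using S homogeneous_carrier by blast
  note sg = M.add_span_subgroup[OF SX]
  \<comment> \<open>The claim extends in two stages: first from homogeneous \<open>a\<close> to all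
    of \<open>A\<close> with \<open>s\<close> a generator, then from generators to the whole
    span.\<close>
  have 1: "lact X a s \<in> add_span X S" if "a \<in> carrier A" "s \<in> S" for a s
  proof (rule add_hom_span[OF A_abelian X_abelian act_left_hom A.homogeneous_carrier sg])
    show "s \<in> carrier X" using that SX by auto
    show "a \<in> add_span A (homogeneous \<V> A)" using that A.carrier_eq_span by simp
  qed (use act that in auto)
  have "lact X a u \<in> add_span X S" if "a \<in> carrier A" "u \<in> add_span X S" for a u
    by (rule add_hom_span[OF X_abelian X_abelian act_right_hom SX sg _ that(2)])
      (use 1 that in auto)
  then show ?thesis
    using span_homogeneous_hpart[OF S] sg by (auto simp: lsub_def)
qed

end

lemma (in vspace) subobject_eq_span:
  assumes "subobject \<V> k X U"
  shows "U = add_span X (U \<inter> homogeneous \<V> X)"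
proof
  have U: "submodule U k X" "\<And>u i. u \<in> U \<Longrightarrow> i \<in> degs \<V> \<Longrightarrow> hpart \<V> X i u \<in> U"
    using assms by (auto simp: subobject_iff)
  have sg: "add_subgroup X U" using submodule.axioms(1)[OF U(1)] .
  show "add_span X (U \<inter> homogeneous \<V> X) \<subseteq> U"
    by (rule M.add_span_incl[OF _ sg]) auto
  show "U \<subseteq> add_span X (U \<inter> homogeneous \<V> X)"
  proof
    fix v assume v: "v \<in> U"
    then have vX: "v \<in> carrier X" using M.add_subgroupD(1)[OF sg] by blast
    have "(\<Oplus>\<^bsub>X\<^esub>i\<in>{i \<in> degs \<V>. hpart \<V> X i v \<noteq> \<zero>\<^bsub>X\<^esub>}. hpart \<V> X i v)
        \<in> add_span X (U \<inter> homogeneous \<V> X)"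
      using finite_hpart[OF vX] v vX U(2) homogeneous_carrier
      by (intro M.add_subgroup_finsum M.add_span_subgroup generate.incl)
        (auto simp: homogeneous_def intro: hpart_hcomp)
    then show "v \<in> add_span X (U \<inter> homogeneous \<V> X)"
      using sum_hpart[OF vX] by simp
  qed
qed

lemma lmodI: "valgebra \<V> k A \<Longrightarrow> left_module \<V> k A X \<Longrightarrow> lmod k X \<V> A"
  by (simp add: lmod_def lmod_axioms_def left_module_def vspaceI)

context lmod
begin

lemma ideal_act_zero_iff:
  assumes "I \<subseteq> carrier A"
  shows "ideal_act I X = {\<zero>\<^bsub>X\<^esub>} \<longleftrightarrow> (\<forall>a\<in>I. \<forall>x\<in>carrier X. lact X a x = \<zero>\<^bsub>X\<^esub>)"
proof
  assume "ideal_act I X = {\<zero>\<^bsub>X\<^esub>}"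
  then show "\<forall>a\<in>I. \<forall>x\<in>carrier X. lact X a x = \<zero>\<^bsub>X\<^esub>"
    unfolding ideal_act_def
    by (metis (mono_tags, lifting) generate.incl mem_Collect_eq singletonD)
next
  assume *: "\<forall>a\<in>I. \<forall>x\<in>carrier X. lact X a x = \<zero>\<^bsub>X\<^esub>"
  have "add_span X {lact X a v |a v. a \<in> I \<and> v \<in> carrier X} \<subseteq> {\<zero>\<^bsub>X\<^esub>}"
    by (rule M.add_span_incl) (use * M.add.triv_subgroup in auto)
  then show "ideal_act I X = {\<zero>\<^bsub>X\<^esub>}"
    using generate.one[of "add_monoid X"] by (auto simp: ideal_act_def)
qed

text \<open>Both \<open>I\<close> and \<open>X\<close> are spanned by homogeneous elements, so
  \<open>I X\<close> is spanned by products of homogeneous factors and therefore graded. For simple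
  \<open>X\<close> it follows that \<open>I X\<close> is zero or everything.\<close>

lemma ideal_act_lsub:
  assumes I: "videal \<V> k A I"
  shows "lsub (ideal_act I X)"
proof -
  interpret I: ideal I A using I by (simp add: videal_def)
  have IA: "I \<subseteq> carrier A" using I.a_subset .
  define S where "S = {lact X a v |a v. a \<in> I \<inter> homogeneous \<V> A \<and> v \<in> homogeneous \<V> X}"
  define T where "T = {lact X a v |a v. a \<in> I \<and> v \<in> carrier X}"
  have TX: "T \<subseteq> carrier X" using IA by (auto simp: T_def)
  have Sh: "S \<subseteq> homogeneous \<V> X"
    by (auto simp: S_def homogeneous_def) (metis act_hcomp dplus_degs)
  have SX: "S \<subseteq> carrier X" using Sh homogeneous_carrier by blast
  note sg = M.add_span_subgroup[OF SX]
  have 1: "lact X a v \<in> add_span X S" if "a \<in> I \<inter> homogeneous \<V> A" "v \<in> carrier X" for a v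
  proof (rule add_hom_span[OF X_abelian X_abelian act_right_hom homogeneous_carrier sg])
    show "a \<in> carrier A" using that IA by auto
    show "v \<in> add_span X (homogeneous \<V> X)" using that carrier_eq_span by simp
    show "lact X a s \<in> add_span X S" if "s \<in> homogeneous \<V> X" for s
      using that \<open>a \<in> I \<inter> homogeneous \<V> A\<close> by (intro generate.incl) (auto simp: S_def)
  qed
  have T: "lact X a v \<in> add_span X S" if "a \<in> I" "v \<in> carrier X" for a v
  proof (rule add_hom_span[OF A_abelian X_abelian act_left_hom _ sg])
    show "a \<in> add_span A (I \<inter> homogeneous \<V> A)"
      using A.subobject_eq_span[of I] that I by (simp add: videal_def)
    show "lact X a v \<in> add_span X S" if "a \<in> I \<inter> homogeneous \<V> A" for a
      using 1 that \<open>v \<in> carrier X\<close> by blast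
  qed (use that IA in auto)
  have "S \<subseteq> T" using homogeneous_carrier by (auto simp: S_def T_def)
  then have eq: "ideal_act I X = add_span X S"
    using T M.add.mono_generate[of S T] M.add_span_incl[of T, OF _ sg]
    by (auto simp: ideal_act_def T_def[symmetric]) (auto simp: T_def)
  show ?thesis
    unfolding eq
  proof (rule lsub_spanI[OF Sh])
    fix a s assume a: "a \<in> homogeneous \<V> A" and "s \<in> S"
    then obtain b v where s: "s = lact X b v" "b \<in> I" "v \<in> carrier X"
      using homogeneous_carrier by (auto simp: S_def)
    have "a \<in> carrier A" "b \<in> carrier A" using a A.homogeneous_carrier s IA by auto
    then have "lact X a s = lact X (a \<otimes>\<^bsub>A\<^esub> b) v" using s by (simp add: act_mult)
    then show "lact X a s \<in> add_span X S"
      using T s I.I_l_closed \<open>a \<in> carrier A\<close> by simp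
  qed
qed

lemma act_eq_of_coset_eq:
  assumes I: "ideal I A" and 0: "\<And>c. c \<in> I \<Longrightarrow> lact X c x = \<zero>\<^bsub>X\<^esub>"
    and "a \<in> carrier A" "b \<in> carrier A" "x \<in> carrier X" "I +>\<^bsub>A\<^esub> a = I +>\<^bsub>A\<^esub> b"
  shows "lact X a x = lact X b x"
proof -
  interpret I: ideal I A by (rule I)
  have "a \<in> I +>\<^bsub>A\<^esub> b" using assms I.a_rcos_self by blast
  then obtain c where c: "c \<in> I" "a = c \<oplus>\<^bsub>A\<^esub> b"
    by (auto simp: a_r_coset_def r_coset_def)
  then have "c \<in> carrier A" using I.a_subset by auto
  then show ?thesis using c assms by (simp add: act_add_left)
qed

text \<open>Any non-zero homogeneous \<open>x\<close> generates a graded submodule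
  \<open>A x\<close>. The purpose is a bound on size: a simple module is a quotient of
  \<open>A\<close> as a set and so fits into every type that \<open>A\<close> embeds into.\<close>

lemma simple_module_orbit:
  assumes simple: "simple_module \<V> k A X"
  shows "\<exists>x\<in>carrier X. carrier X = (\<lambda>a. lact X a x) ` carrier A"
proof -
  obtain v where v: "v \<in> carrier X" "v \<noteq> \<zero>\<^bsub>X\<^esub>"
    using simple by (auto simp: simple_module_iff)
  then obtain d where d: "d \<in> degs \<V>" and ne: "hpart \<V> X d v \<noteq> \<zero>\<^bsub>X\<^esub>"
    using nonzero_hpart by blast
  \<comment> \<open>A homogeneous component of \<open>v\<close> replaces \<open>v\<close>, since
    \<open>A v\<close> need not be graded for a general \<open>v\<close>.\<close>
  define x where "x = hpart \<V> X d v"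
  have x: "x \<in> hcomp X d" "x \<in> carrier X" "x \<noteq> \<zero>\<^bsub>X\<^esub>"
    using v d ne by (auto simp: x_def hpart_hcomp hpart_closed)
  define U where "U = (\<lambda>a. lact X a x) ` carrier A"
  define S where "S = (\<lambda>a. lact X a x) ` homogeneous \<V> A"
  have Sh: "S \<subseteq> homogeneous \<V> X"
    using x d by (auto simp: S_def homogeneous_def) (metis act_hcomp dplus_degs)
  have SX: "S \<subseteq> carrier X" using Sh homogeneous_carrier by blast
  have sgU: "add_subgroup X U"
    unfolding U_def using A.add.subgroup_self
    by (intro add_hom_image_subgroup[OF A_abelian X_abelian act_left_hom[OF x(2)]]) simp
  have "U \<subseteq> add_span X S"
  proof
    fix u assume "u \<in> U"
    then obtain a where a: "a \<in> carrier A" "u = lact X a x" by (auto simp: U_def)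
    have "lact X a x \<in> add_span X S"
      by (rule add_hom_span[OF A_abelian X_abelian act_left_hom A.homogeneous_carrier
            M.add_span_subgroup[OF SX]])
        (use a x A.carrier_eq_span in \<open>auto simp: S_def intro: generate.incl\<close>)
    then show "u \<in> add_span X S" using a by simp
  qed
  moreover have "add_span X S \<subseteq> U"
    by (rule M.add_span_incl[OF _ sgU]) (use A.homogeneous_carrier in \<open>auto simp: S_def U_def\<close>)
  ultimately have eq: "U = add_span X S" by blast
  have "lsub U"
    unfolding eq
  proof (rule lsub_spanI[OF Sh])
    fix a s assume "a \<in> homogeneous \<V> A" "s \<in> S"
    then obtain b where b: "a \<in> carrier A" "b \<in> carrier A" "s = lact X b x"
      using A.homogeneous_carrier by (auto simp: S_def)
    then have "lact X a s = lact X (a \<otimes>\<^bsub>A\<^esub> b) x" using x by (simp add: act_mult)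
    then show "lact X a s \<in> add_span X S"
      using b by (simp add: U_def flip: eq)
  qed
  moreover have "x \<in> U" using x by (auto simp: U_def intro!: image_eqI[of _ _ "\<one>\<^bsub>A\<^esub>"])
  ultimately have "U = carrier X"
    using simple x by (auto simp: simple_module_iff)
  then show ?thesis using x by (auto simp: U_def)
qed

end

section \<open>Isomorphisms\<close>

lemma lmod_iso_refl: "lmod_iso \<V> k A X X"
  by (auto simp: lmod_iso_def lmod_hom_def lmod_linear_def intro!: exI[of _ "\<lambda>x. x"] bij_betwI)

lemma lmod_iso_trans:
  assumes "lmod_iso \<V> k A X Y" "lmod_iso \<V> k A Y Z"
  shows "lmod_iso \<V> k A X Z"
proof -
  obtain f g where f: "lmod_hom \<V> k A X Y f" "bij_betw f (carrier X) (carrier Y)"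
    and g: "lmod_hom \<V> k A Y Z g" "bij_betw g (carrier Y) (carrier Z)"
    using assms by (auto simp: lmod_iso_def)
  have "lmod_hom \<V> k A X Z (g \<circ> f)"
    using f(1) g(1) by (auto simp: lmod_hom_def lmod_linear_def Pi_iff image_subset_iff)
  then show ?thesis
    using bij_betw_trans[OF f(2) g(2)] by (auto simp: lmod_iso_def)
qed

text \<open>Linearity over \<open>k\<close> is automatic, since \<open>c x = (c 1) x\<close>.\<close>

lemma lmod_homI:
  assumes "lmod k X \<V> A" "lmod k Y \<V> A" "add_hom X Y f"
    and act: "\<And>a x. a \<in> carrier A \<Longrightarrow> x \<in> carrier X \<Longrightarrow> f (lact X a x) = lact Y a (f x)"
    and "\<And>i x. i \<in> degs \<V> \<Longrightarrow> x \<in> hcomp X i \<Longrightarrow> f x \<in> hcomp Y i"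
  shows "lmod_hom \<V> k A X Y f"
proof -
  interpret X: lmod k X \<V> A by fact
  interpret Y: lmod k Y \<V> A by fact
  have "f (c \<odot>\<^bsub>X\<^esub> x) = c \<odot>\<^bsub>Y\<^esub> f x" if "c \<in> carrier k" "x \<in> carrier X" for c x
    using that add_hom_closed[OF assms(3)]
    by (simp add: X.smult_eq_act Y.smult_eq_act act X.A.smult_closed)
  then show ?thesis
    using assms by (auto simp: lmod_hom_def lmod_linear_def add_hom_def)
qed

lemma lmod_hom_add_hom: "lmod_hom \<V> k A X Y f \<Longrightarrow> add_hom X Y f"
  by (auto simp: lmod_hom_def lmod_linear_def add_hom_def)

lemma lmod_hom_act:
  "lmod_hom \<V> k A X Y f \<Longrightarrow> a \<in> carrier A \<Longrightarrow> x \<in> carrier X \<Longrightarrow> f (lact X a x) = lact Y a (f x)"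
  by (auto simp: lmod_hom_def lmod_linear_def)

lemma lmod_hom_hcomp:
  "lmod_hom \<V> k A X Y f \<Longrightarrow> i \<in> degs \<V> \<Longrightarrow> x \<in> hcomp X i \<Longrightarrow> f x \<in> hcomp Y i"
  by (auto simp: lmod_hom_def)

lemma add_hom_hpart:
  assumes "vspace k X \<V>" "vspace k Y \<V>" and f: "add_hom X Y f"
    and deg: "\<And>i x. i \<in> degs \<V> \<Longrightarrow> x \<in> hcomp X i \<Longrightarrow> f x \<in> hcomp Y i"
    and x: "x \<in> carrier X" and i: "i \<in> degs \<V>"
  shows "f (hpart \<V> X i x) = hpart \<V> Y i (f x)"
proof -
  interpret X: vspace k X \<V> by fact
  interpret Y: vspace k Y \<V> by fact
  note XX = X.M.abelian_group_axioms and YY = Y.M.abelian_group_axioms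
  show ?thesis
  proof (rule add_hom_eq_on_span[OF XX YY
        add_hom_comp[OF X.hpart_add_hom[OF i] f] add_hom_comp[OF f Y.hpart_add_hom[OF i]]
        X.homogeneous_carrier])
    show "x \<in> add_span X (homogeneous \<V> X)" using x X.carrier_eq_span by simp
    fix s assume "s \<in> homogeneous \<V> X"
    then obtain j where j: "j \<in> degs \<V>" "s \<in> hcomp X j" unfolding homogeneous_def by blast
    then show "f (hpart \<V> X i s) = hpart \<V> Y i (f s)"
      using X.hpart_homog[OF j(1) i j(2)] Y.hpart_homog[OF j(1) i deg[OF j]]
      by (simp add: add_hom_zero[OF XX YY f])
  qed
qed

lemma lmod_iso_inverse:
  assumes "lmod k X \<V> A" "lmod k Y \<V> A" and f: "lmod_hom \<V> k A X Y f"
    and bij: "bij_betw f (carrier X) (carrier Y)"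
  shows "\<exists>g. lmod_hom \<V> k A Y X g \<and> bij_betw g (carrier Y) (carrier X) \<and>
    (\<forall>x\<in>carrier X. g (f x) = x) \<and> (\<forall>y\<in>carrier Y. f (g y) = y)"
proof -
  interpret X: lmod k X \<V> A by fact
  interpret Y: lmod k Y \<V> A by fact
  note fa = lmod_hom_add_hom[OF f]
  define g where "g = inv_into (carrier X) f"
  have g: "g y \<in> carrier X" "f (g y) = y" if "y \<in> carrier Y" for y
    using that bij by (auto simp: g_def bij_betw_def f_inv_into_f inv_into_into)
  have gf: "g (f x) = x" if "x \<in> carrier X" for x
    using that bij by (simp add: g_def bij_betw_def)
  have inj: "x = x'" if "f x = f x'" "x \<in> carrier X" "x' \<in> carrier X" for x x'
    using gf that by metis
  have "lmod_hom \<V> k A Y X g"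
  proof (rule lmod_homI[OF assms(2,1)])
    show "add_hom Y X g"
      by (intro add_homI inj) (auto simp: g add_hom_add[OF fa])
    show "g (lact Y a x) = lact X a (g x)" if "a \<in> carrier A" "x \<in> carrier Y" for a x
      using that by (intro inj) (auto simp: g lmod_hom_act[OF f])
    fix i y assume i: "i \<in> degs \<V>" and y: "y \<in> hcomp Y i"
    have yY: "y \<in> carrier Y" using i y Y.hcomp_carrier by blast
    \<comment> \<open>By injectivity of \<open>f\<close> this makes \<open>g y\<close> its own
      component of degree \<open>i\<close>, which is how the inverse is seen to preserve
      degrees.\<close>
    have "f (hpart \<V> X i (g y)) = y"
      using add_hom_hpart[OF X.vspace_axioms Y.vspace_axioms fa lmod_hom_hcomp[OF f] g(1)[OF yY] i]
        Y.hpart_homog[OF i i y] g[OF yY] by simp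
    then have "g y = hpart \<V> X i (g y)"
      using gf X.hpart_closed[OF g(1)[OF yY] i] by metis
    then show "g y \<in> hcomp X i"
      using X.hpart_hcomp[OF g(1)[OF yY] i] by simp
  qed
  moreover have "bij_betw g (carrier Y) (carrier X)"
    using bij by (simp add: g_def bij_betw_inv_into)
  ultimately show ?thesis using g gf by blast
qed

lemma lmod_iso_sym:
  assumes "lmod k X \<V> A" "lmod k Y \<V> A" "lmod_iso \<V> k A X Y"
  shows "lmod_iso \<V> k A Y X"
  using lmod_iso_inverse[OF assms(1,2)] assms(3) unfolding lmod_iso_def by blast

text \<open>\<open>Y\<close> has its carrier in the type of the class members, hence belongs to its
  own class; this gives the direction from equal classes to isomorphic modules. Over a type that is
  too small, classes could be empty and therefore equal.\<close>

lemma iso_class_eq_iff: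
  fixes Y :: "('k, 'a, 'u) lmodule"
  assumes X: "lmod k X \<V> A" and Y: "lmod k Y \<V> A" "left_module \<V> k A Y"
  shows "iso_class \<V> k A X = (iso_class \<V> k A Y :: ('k, 'a, 'u) lmodule set) \<longleftrightarrow> lmod_iso \<V> k A X Y"
proof
  show "lmod_iso \<V> k A X Y" if "iso_class \<V> k A X = (iso_class \<V> k A Y :: ('k, 'a, 'u) lmodule set)"
  proof -
    have "Y \<in> iso_class \<V> k A Y"
      using Y lmod_iso_refl by (auto simp: iso_class_def)
    then show ?thesis using that by (auto simp: iso_class_def)
  qed
  show "iso_class \<V> k A X = (iso_class \<V> k A Y :: ('k, 'a, 'u) lmodule set)" if "lmod_iso \<V> k A X Y"
    using lmod_iso_trans[OF lmod_iso_sym[OF X Y(1) that]] lmod_iso_trans[OF that]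
    by (auto simp: iso_class_def)
qed

text \<open>This makes membership in a layer a property of the isomorphism class. Submodules of
  \<open>Y\<close> are pulled back along \<open>f\<close>, the spanning condition is pushed
  forward.\<close>

lemma simple_between_iso:
  assumes "lmod k X \<V> A" "lmod k Y \<V> A" "lmod_iso \<V> k A X Y" "simple_between \<V> k A J I X"
    and J: "J \<subseteq> carrier A" and I: "I \<subseteq> carrier A"
  shows "simple_between \<V> k A J I Y"
proof -
  interpret X: lmod k X \<V> A by fact
  interpret Y: lmod k Y \<V> A by fact
  note XX = X.X_abelian and YY = Y.X_abelian
  obtain f where f: "lmod_hom \<V> k A X Y f" and bij: "bij_betw f (carrier X) (carrier Y)"
    using assms by (auto simp: lmod_iso_def)
  note fa = lmod_hom_add_hom[OF f]
  have surj: "carrier Y = f ` carrier X" and inj: "inj_on f (carrier X)"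
    using bij by (auto simp: bij_betw_def)
  have f0: "f x = \<zero>\<^bsub>Y\<^esub> \<longleftrightarrow> x = \<zero>\<^bsub>X\<^esub>" if "x \<in> carrier X" for x
    using inj_onD[OF inj, of x "\<zero>\<^bsub>X\<^esub>"] that add_hom_zero[OF XX YY fa] by auto
  have ne: "carrier X \<noteq> {\<zero>\<^bsub>X\<^esub>}" and simp: "\<And>U. X.lsub U \<Longrightarrow> U = {\<zero>\<^bsub>X\<^esub>} \<or> U = carrier X"
    and JX: "\<forall>a\<in>J. \<forall>x\<in>carrier X. lact X a x = \<zero>\<^bsub>X\<^esub>" and IX: "ideal_act I X = carrier X"
    using assms(4) X.ideal_act_zero_iff[OF J] by (auto simp: simple_between_def X.simple_module_iff)
  have "carrier Y \<noteq> {\<zero>\<^bsub>Y\<^esub>}"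
  proof
    assume "carrier Y = {\<zero>\<^bsub>Y\<^esub>}"
    then have "x = \<zero>\<^bsub>X\<^esub>" if "x \<in> carrier X" for x
      using f0[OF that] that surj by auto
    then show False using ne by auto
  qed
  moreover have "U = {\<zero>\<^bsub>Y\<^esub>} \<or> U = carrier Y" if U: "Y.lsub U" for U
  proof -
    have UY: "U \<subseteq> carrier Y" using Y.lsub_carrier[OF U] .
    have "X.lsub {x \<in> carrier X. f x \<in> U}"
      using U add_hom_vimage_subgroup[OF XX YY fa, of U]
      by (auto simp: X.lsub_def Y.lsub_def lmod_hom_act[OF f] X.hpart_closed
          add_hom_hpart[OF X.vspace_axioms Y.vspace_axioms fa lmod_hom_hcomp[OF f]])
    then consider "{x \<in> carrier X. f x \<in> U} = {\<zero>\<^bsub>X\<^esub>}" | "{x \<in> carrier X. f x \<in> U} = carrier X"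
      using simp by blast
    then show ?thesis
    proof cases
      case 1
      have "u = \<zero>\<^bsub>Y\<^esub>" if "u \<in> U" for u
      proof -
        obtain x where "x \<in> carrier X" "u = f x" using \<open>u \<in> U\<close> UY surj by auto
        then show ?thesis using 1 \<open>u \<in> U\<close> f0[of x] by blast
      qed
      moreover have "\<zero>\<^bsub>Y\<^esub> \<in> U" using U Y.M.add_subgroupD(2) by (auto simp: Y.lsub_def)
      ultimately show ?thesis by blast
    next
      case 2
      then show ?thesis using UY surj by auto
    qed
  qed
  moreover have "\<forall>a\<in>J. \<forall>y\<in>carrier Y. lact Y a y = \<zero>\<^bsub>Y\<^esub>"
  proof (intro ballI)
    fix a y assume "a \<in> J" "y \<in> carrier Y"
    then obtain x where "x \<in> carrier X" "y = f x" "a \<in> carrier A" using surj J by auto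
    then show "lact Y a y = \<zero>\<^bsub>Y\<^esub>"
      using JX f0[of "lact X a x"] lmod_hom_act[OF f, of a x] \<open>a \<in> J\<close> by auto
  qed
  moreover have "ideal_act I Y = carrier Y"
  proof
    have TY: "{lact Y a v |a v. a \<in> I \<and> v \<in> carrier Y} \<subseteq> carrier Y" using I by auto
    then show "ideal_act I Y \<subseteq> carrier Y"
      using Y.M.add_subgroupD(1)[OF Y.M.add_span_subgroup] by (simp add: ideal_act_def)
    have "f x \<in> ideal_act I Y" if "x \<in> carrier X" for x
    proof (rule add_hom_span[OF XX YY fa])
      show "{lact X a v |a v. a \<in> I \<and> v \<in> carrier X} \<subseteq> carrier X" using I by auto
      show "add_subgroup Y (ideal_act I Y)"
        using Y.M.add_span_subgroup[OF TY] by (simp add: ideal_act_def)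
      show "x \<in> add_span X {lact X a v |a v. a \<in> I \<and> v \<in> carrier X}"
        using that IX by (simp add: ideal_act_def)
      show "f s \<in> ideal_act I Y" if "s \<in> {lact X a v |a v. a \<in> I \<and> v \<in> carrier X}" for s
      proof -
        obtain a v where "s = lact X a v" "a \<in> I" "v \<in> carrier X" using \<open>s \<in> _\<close> by auto
        moreover have "f v \<in> carrier Y" "a \<in> carrier A"
          using calculation I add_hom_closed[OF fa] by auto
        ultimately show ?thesis
          unfolding ideal_act_def by (intro generate.incl) (auto simp: lmod_hom_act[OF f])
      qed
    qed
    then show "carrier Y \<subseteq> ideal_act I Y" using surj by auto
  qed
  ultimately show ?thesis
    using Y.left_module by (simp add: simple_between_def Y.simple_module_iff Y.ideal_act_zero_iff[OF J])
qed

section \<open>Copying a module into another type\<close>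

definition transport :: "('m \<Rightarrow> 'u) \<Rightarrow> ('k, 'a, 'm, 'x) lmodule_scheme \<Rightarrow> ('k, 'a, 'u) lmodule" where
  "transport f X = (let g = inv_into (carrier X) f in
     \<lparr>carrier = f ` carrier X, mult = undefined, one = undefined, ring.zero = f \<zero>\<^bsub>X\<^esub>,
      add = (\<lambda>u v. f (g u \<oplus>\<^bsub>X\<^esub> g v)), smult = (\<lambda>c u. f (c \<odot>\<^bsub>X\<^esub> g u)),
      hcomp = (\<lambda>i. f ` hcomp X i), lact = (\<lambda>a u. f (lact X a (g u)))\<rparr>)"

lemma (in lmod) transport:
  assumes inj: "inj_on f (carrier X)"
  shows "left_module \<V> k A (transport f X)" "lmod_iso \<V> k A X (transport f X)"
proof -
  define Y where "Y = transport f X"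
  define g where "g = inv_into (carrier X) f"
  have gf [simp]: "g (f x) = x" if "x \<in> carrier X" for x
    using that inj by (simp add: g_def)
  have Y: "carrier Y = f ` carrier X" "\<zero>\<^bsub>Y\<^esub> = f \<zero>\<^bsub>X\<^esub>" "hcomp Y = (\<lambda>i. f ` hcomp X i)"
    by (auto simp: Y_def transport_def Let_def)
  have add: "f x \<oplus>\<^bsub>Y\<^esub> f y = f (x \<oplus>\<^bsub>X\<^esub> y)" if "x \<in> carrier X" "y \<in> carrier X" for x y
    using that by (auto simp: Y_def transport_def Let_def simp flip: g_def)
  have ops: "c \<odot>\<^bsub>Y\<^esub> f x = f (c \<odot>\<^bsub>X\<^esub> x)" "lact Y a (f x) = f (lact X a x)"
    if "x \<in> carrier X" for x c a
    using that by (auto simp: Y_def transport_def Let_def simp flip: g_def)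
  note ops = add ops
  have ab: "abelian_group Y"
  proof (rule abelian_groupI)
    fix u assume "u \<in> carrier Y"
    then obtain x where x: "x \<in> carrier X" "u = f x" by (auto simp: Y)
    then show "\<exists>v\<in>carrier Y. v \<oplus>\<^bsub>Y\<^esub> u = \<zero>\<^bsub>Y\<^esub>"
      by (auto simp: Y ops M.l_neg intro!: bexI[of _ "\<ominus>\<^bsub>X\<^esub> x"])
  qed (auto simp: Y ops M.a_ac)
  have f: "add_hom X Y f" and g: "add_hom Y X g"
    by (auto intro!: add_homI simp: Y ops)
  have mod: "module k Y"
    by (rule moduleI[OF R.is_cring ab])
      (auto simp: Y ops smult_l_distr smult_r_distr smult_assoc1)
  interpret Y: module k Y by (rule mod)
  have neg: "\<ominus>\<^bsub>Y\<^esub> f x = f (\<ominus>\<^bsub>X\<^esub> x)" if "x \<in> carrier X" for x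
    using add_hom_neg[OF X_abelian ab f that] by simp
  have "vobject \<V> k Y"
  proof (rule vobjectI[OF mod _ _ X_abelian])
    fix i assume i: "i \<in> degs \<V>"
    note sub = submoduleE[OF hcomp_submodule[OF i]]
    have sc: "x \<in> carrier X" if "x \<in> hcomp X i" for x using that sub by blast
    show "submodule (hcomp Y i) k Y"
      using M.add_subgroupD(2)[OF hcomp_subgroup[OF i]] sub(3-5)
      by (intro Y.submoduleI) (auto simp: Y ops neg sc)
  next
    have eq: "homogeneous \<V> Y = f ` homogeneous \<V> X" by (auto simp: homogeneous_def Y)
    have "f x \<in> add_span Y (homogeneous \<V> Y)" if "x \<in> carrier X" for x
    proof (rule add_hom_span[OF X_abelian ab f homogeneous_carrier])
      show "add_subgroup Y (add_span Y (homogeneous \<V> Y))"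
        by (rule Y.M.add_span_subgroup) (use homogeneous_carrier in \<open>auto simp: eq Y\<close>)
      show "x \<in> add_span X (homogeneous \<V> X)" using that carrier_eq_span by simp
      show "f s \<in> add_span Y (homogeneous \<V> Y)" if "s \<in> homogeneous \<V> X" for s
        using that by (auto simp: eq intro: generate.incl)
    qed
    then show "carrier Y \<subseteq> add_span Y (homogeneous \<V> Y)" by (auto simp: Y)
  next
    fix d u assume d: "d \<in> degs \<V>" and u: "u \<in> hcomp Y d" "u \<noteq> \<zero>\<^bsub>Y\<^esub>"
    then obtain x where x: "x \<in> hcomp X d" "u = f x" "x \<noteq> \<zero>\<^bsub>X\<^esub>" by (auto simp: Y)
    \<comment> \<open>The separating map required by \<open>vobjectI\<close> is the projection to
      degree \<open>d\<close> on \<open>X\<close>, read on \<open>Y\<close> through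
      \<open>g\<close>.\<close>
    have "hpart \<V> X d (g z) = \<zero>\<^bsub>X\<^esub>" if j: "j \<in> degs \<V>" "j \<noteq> d" "z \<in> hcomp Y j" for j z
      using that d hpart_homog[OF j(1) d] hcomp_carrier by (auto simp: Y)
    moreover have "hpart \<V> X d (g u) \<noteq> \<zero>\<^bsub>X\<^esub>"
      using x hpart_homog[OF d d x(1)] hcomp_carrier[OF d x(1)] by simp
    ultimately show "\<exists>q. add_hom Y X q \<and> q u \<noteq> \<zero>\<^bsub>X\<^esub> \<and>
        (\<forall>j\<in>degs \<V>. j \<noteq> d \<longrightarrow> (\<forall>z\<in>hcomp Y j. q z = \<zero>\<^bsub>X\<^esub>))"
      using add_hom_comp[OF g hpart_add_hom[OF d]]
      by (intro exI[of _ "\<lambda>z. hpart \<V> X d (g z)"]) blast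
  qed
  moreover have "lact X a (c \<odot>\<^bsub>X\<^esub> x) = c \<odot>\<^bsub>X\<^esub> lact X a x"
    if "a \<in> carrier A" "c \<in> carrier k" "x \<in> carrier X" for a c x
    using left_module that by (simp add: left_module_def)
  moreover have "lact Y a u \<in> hcomp Y (dplus \<V> i j)"
    if "i \<in> degs \<V>" "j \<in> degs \<V>" "a \<in> hcomp A i" "u \<in> hcomp Y j" for i j a u
    using that act_hcomp[OF that(1-3)] hcomp_carrier[OF that(2)] by (auto simp: Y ops)
  ultimately have lm: "left_module \<V> k A Y"
    by (auto simp: left_module_def Y ops act_add_left act_add_right act_mult act_smult)
  then show "left_module \<V> k A (transport f X)" by (simp add: Y_def)
  have "lmod_hom \<V> k A X Y f"
    by (rule lmod_homI[OF lmod_axioms lmodI[OF valgebra lm] f]) (auto simp: ops Y)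
  then show "lmod_iso \<V> k A X (transport f X)"
    using inj by (auto simp: lmod_iso_def Y_def[symmetric] bij_betw_def Y)
qed

lemma (in lmod) simple_module_transport:
  assumes "simple_module \<V> k A X" and e: "inj_on (e :: 'a \<Rightarrow> 'u) (carrier A)"
  shows "\<exists>Y :: ('k, 'a, 'u) lmodule. left_module \<V> k A Y \<and> lmod_iso \<V> k A X Y"
proof -
  obtain x where x: "x \<in> carrier X" "carrier X = (\<lambda>a. lact X a x) ` carrier A"
    using simple_module_orbit[OF assms(1)] by blast
  \<comment> \<open>Choosing a preimage under the orbit map embeds \<open>X\<close> into
    \<open>A\<close>, and \<open>e\<close> continues this into \<open>'u\<close>.\<close>
  have "inj_on (e \<circ> inv_into (carrier A) (\<lambda>a. lact X a x)) (carrier X)"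
    using e by (intro comp_inj_on inj_on_inv_into) (auto simp: x(2) intro: inj_on_subset inv_into_into)
  then show ?thesis using transport by blast
qed

section \<open>Pairings and linked modules\<close>

lemma biadditive_span:
  assumes ab: "abelian_group X" "abelian_group Y" "abelian_group Z"
    and f1: "\<And>y. y \<in> carrier Y \<Longrightarrow> add_hom X Z (\<lambda>x. f x y)"
    and f2: "\<And>x. x \<in> carrier X \<Longrightarrow> add_hom Y Z (f x)"
    and S: "S \<subseteq> carrier X" and T: "T \<subseteq> carrier Y" and H: "add_subgroup Z H"
    and f: "\<And>s t. s \<in> S \<Longrightarrow> t \<in> T \<Longrightarrow> f s t \<in> H"
    and x: "x \<in> add_span X S" and y: "y \<in> add_span Y T"
  shows "f x y \<in> H"
proof (rule add_hom_span[OF ab(1,3) f1 S H _ x])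
  show "y \<in> carrier Y"
    using abelian_group.add_subgroupD(1)[OF ab(2) abelian_group.add_span_subgroup[OF ab(2) T]] y
    by blast
  show "f s y \<in> H" if "s \<in> S" for s
    by (rule add_hom_span[OF ab(2,3) f2 T H _ y]) (use that S f in auto)
qed

text \<open>Cancellation in the grading group keeps distinct degrees distinct after a shift by
  \<open>d\<close>. The lemma is meant for \<open>\<tau> y\<close> with \<open>y\<close> homogeneous
  of degree \<open>d\<close>.\<close>

lemma shifted_hpart:
  assumes "vspace k X \<V>" "vspace k Y \<V>" and f: "add_hom X Y f" and d: "d \<in> degs \<V>"
    and deg: "\<And>i x. i \<in> degs \<V> \<Longrightarrow> x \<in> hcomp X i \<Longrightarrow> f x \<in> hcomp Y (dplus \<V> d i)"
    and x: "x \<in> carrier X" and i: "i \<in> degs \<V>"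
  shows "f (hpart \<V> X i x) = hpart \<V> Y (dplus \<V> d i) (f x)"
proof -
  interpret X: vspace k X \<V> by fact
  interpret Y: vspace k Y \<V> by fact
  note XX = X.M.abelian_group_axioms and YY = Y.M.abelian_group_axioms
  have di: "dplus \<V> d i \<in> degs \<V>" using d i by simp
  show ?thesis
  proof (rule add_hom_eq_on_span[OF XX YY
        add_hom_comp[OF X.hpart_add_hom[OF i] f] add_hom_comp[OF f Y.hpart_add_hom[OF di]]
        X.homogeneous_carrier])
    show "x \<in> add_span X (homogeneous \<V> X)" using x X.carrier_eq_span by simp
    fix s assume "s \<in> homogeneous \<V> X"
    then obtain j where j: "j \<in> degs \<V>" "s \<in> hcomp X j" unfolding homogeneous_def by blast
    then show "f (hpart \<V> X i s) = hpart \<V> Y (dplus \<V> d i) (f s)"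
      using X.hpart_homog[OF j(1) i j(2)] Y.hpart_homog[OF _ di deg[OF j]] d i
      by (simp add: add_hom_zero[OF XX YY f] dplus_cancel)
  qed
qed

text \<open>A map \<open>M \<otimes>\<^sub>B W \<rightarrow> X\<close> of \<open>A\<close>-modules, as a map of two variables.\<close>

definition pairing ::
  "vcat \<Rightarrow> ('k, 'a, 'x) vobj_scheme \<Rightarrow> ('k, 'b, 'y) vobj_scheme \<Rightarrow> ('k, 'a, 'b, 'm) bimodule \<Rightarrow>
   ('k, 'b, 'w) lmodule \<Rightarrow> ('k, 'a, 'v) lmodule \<Rightarrow> ('m \<Rightarrow> 'w \<Rightarrow> 'v) \<Rightarrow> bool" where
  "pairing \<V> A B M W X \<sigma> \<longleftrightarrow>
     (\<forall>w\<in>carrier W. add_hom M X (\<lambda>x. \<sigma> x w)) \<and> (\<forall>x\<in>carrier M. add_hom W X (\<sigma> x)) \<and>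
     (\<forall>a\<in>carrier A. \<forall>x\<in>carrier M. \<forall>w\<in>carrier W. \<sigma> (lact M a x) w = lact X a (\<sigma> x w)) \<and>
     (\<forall>b\<in>carrier B. \<forall>x\<in>carrier M. \<forall>w\<in>carrier W. \<sigma> (ract M x b) w = \<sigma> x (lact W b w)) \<and>
     (\<forall>i\<in>degs \<V>. \<forall>j\<in>degs \<V>. \<forall>x\<in>hcomp M i. \<forall>w\<in>hcomp W j. \<sigma> x w \<in> hcomp X (dplus \<V> i j))"

lemma pairingD:
  assumes "pairing \<V> A B M W X \<sigma>"
  shows "w \<in> carrier W \<Longrightarrow> add_hom M X (\<lambda>x. \<sigma> x w)"
    and "x \<in> carrier M \<Longrightarrow> add_hom W X (\<sigma> x)"
    and "x \<in> carrier M \<Longrightarrow> w \<in> carrier W \<Longrightarrow> \<sigma> x w \<in> carrier X"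
    and "a \<in> carrier A \<Longrightarrow> x \<in> carrier M \<Longrightarrow> w \<in> carrier W \<Longrightarrow> \<sigma> (lact M a x) w = lact X a (\<sigma> x w)"
    and "b \<in> carrier B \<Longrightarrow> x \<in> carrier M \<Longrightarrow> w \<in> carrier W \<Longrightarrow> \<sigma> (ract M x b) w = \<sigma> x (lact W b w)"
    and "i \<in> degs \<V> \<Longrightarrow> j \<in> degs \<V> \<Longrightarrow> x \<in> hcomp M i \<Longrightarrow> w \<in> hcomp W j \<Longrightarrow>
      \<sigma> x w \<in> hcomp X (dplus \<V> i j)"
  using assms by (auto simp: pairing_def intro: add_hom_closed)

text \<open>
  One half of a Morita context between \<open>A/I\<close> and \<open>B/J\<close>: \<open>M\<close> and \<open>N\<close> are regarded as bimodules
  over \<open>A\<close> and \<open>B\<close>, and \<open>e x y\<close> is a representative in \<open>A\<close> of \<open>\<eta>(x \<otimes> y)\<close>.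
\<close>

locale half_context =
  fixes \<V> :: vcat and k :: "'k ring" and A :: "('k, 'a) vobj" and B :: "('k, 'b) vobj"
    and I :: "'a set" and M :: "('k, 'a, 'b, 'm) bimodule" and N :: "('k, 'b, 'a, 'n) bimodule"
    and e :: "'m \<Rightarrow> 'n \<Rightarrow> 'a"
  assumes A: "valgebra \<V> k A" and B: "valgebra \<V> k B"
    and bimodM: "is_bimodule \<V> k A B M" and bimodN: "is_bimodule \<V> k B A N"
    and I: "ideal I A"
    and I_act: "\<And>a x. a \<in> I \<Longrightarrow> x \<in> carrier M \<Longrightarrow> lact M a x = \<zero>\<^bsub>M\<^esub>"
    and e_closed: "\<And>x y. x \<in> carrier M \<Longrightarrow> y \<in> carrier N \<Longrightarrow> e x y \<in> carrier A"
    and e_add_left: "\<And>x x' y. x \<in> carrier M \<Longrightarrow> x' \<in> carrier M \<Longrightarrow> y \<in> carrier N \<Longrightarrow>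
      I +>\<^bsub>A\<^esub> e (x \<oplus>\<^bsub>M\<^esub> x') y = I +>\<^bsub>A\<^esub> (e x y \<oplus>\<^bsub>A\<^esub> e x' y)"
    and e_add_right: "\<And>x y y'. x \<in> carrier M \<Longrightarrow> y \<in> carrier N \<Longrightarrow> y' \<in> carrier N \<Longrightarrow>
      I +>\<^bsub>A\<^esub> e x (y \<oplus>\<^bsub>N\<^esub> y') = I +>\<^bsub>A\<^esub> (e x y \<oplus>\<^bsub>A\<^esub> e x y')"
    and e_balanced: "\<And>x b y. x \<in> carrier M \<Longrightarrow> b \<in> carrier B \<Longrightarrow> y \<in> carrier N \<Longrightarrow>
      I +>\<^bsub>A\<^esub> e (ract M x b) y = I +>\<^bsub>A\<^esub> e x (lact N b y)"
    and e_left: "\<And>a x y. a \<in> carrier A \<Longrightarrow> x \<in> carrier M \<Longrightarrow> y \<in> carrier N \<Longrightarrow>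
      I +>\<^bsub>A\<^esub> e (lact M a x) y = I +>\<^bsub>A\<^esub> (a \<otimes>\<^bsub>A\<^esub> e x y)"
    and e_right: "\<And>a x y. a \<in> carrier A \<Longrightarrow> x \<in> carrier M \<Longrightarrow> y \<in> carrier N \<Longrightarrow>
      I +>\<^bsub>A\<^esub> e x (ract N y a) = I +>\<^bsub>A\<^esub> (e x y \<otimes>\<^bsub>A\<^esub> a)"
    and e_hcomp: "\<And>i j x y. i \<in> degs \<V> \<Longrightarrow> j \<in> degs \<V> \<Longrightarrow> x \<in> hcomp M i \<Longrightarrow> y \<in> hcomp N j \<Longrightarrow>
      \<exists>a\<in>hcomp A (dplus \<V> i j). I +>\<^bsub>A\<^esub> e x y = I +>\<^bsub>A\<^esub> a"
begin

sublocale M: lmod k M \<V> A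
  using bimodM A by (intro lmodI) (auto simp: is_bimodule_def)

sublocale N: lmod k N \<V> B
  using bimodN B by (intro lmodI) (auto simp: is_bimodule_def)

lemma ractM_closed: "x \<in> carrier M \<Longrightarrow> b \<in> carrier B \<Longrightarrow> ract M x b \<in> carrier M"
  using bimodM by (auto simp: is_bimodule_def right_module_def)

lemma ractN_closed: "y \<in> carrier N \<Longrightarrow> a \<in> carrier A \<Longrightarrow> ract N y a \<in> carrier N"
  using bimodN by (auto simp: is_bimodule_def right_module_def)

text \<open>\<open>I\<close> is included because \<open>e\<close> picks representatives modulo
  \<open>I\<close>. For a Morita context the result is the full preimage in \<open>A\<close> of the
  trace ideal of \<open>A/I\<close>; see \<open>mem_trace_iff\<close>.\<close>

definition trace :: "'a set" where
  "trace = add_span A (I \<union> {e x y |x y. x \<in> carrier M \<and> y \<in> carrier N})"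

lemma I_carrier: "I \<subseteq> carrier A"
proof -
  interpret ideal I A by (rule I)
  show ?thesis by (rule a_subset)
qed

lemma trace_carrier: "trace \<subseteq> carrier A"
proof -
  have "I \<union> {e x y |x y. x \<in> carrier M \<and> y \<in> carrier N} \<subseteq> carrier A"
    using e_closed I_carrier by auto
  then show ?thesis
    using M.A.add_subgroupD(1)[OF M.A.add_span_subgroup] by (simp add: trace_def)
qed

lemma e_trace: "x \<in> carrier M \<Longrightarrow> y \<in> carrier N \<Longrightarrow> e x y \<in> trace"
  unfolding trace_def by (rule generate.incl) auto

end

text \<open>Since \<open>I\<close> annihilates \<open>V\<close>, the element \<open>e x y\<close>
  acts on \<open>V\<close> independently of the representative, and the congruences of
  \<open>half_context\<close> become equalities.\<close>

locale half_context_module = half_context \<V> k A B I M N e + V: lmod k V \<V> A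
  for \<V> and k :: "'k ring" and A :: "('k, 'a) vobj" and B :: "('k, 'b) vobj" and I
    and M :: "('k, 'a, 'b, 'm) bimodule" and N :: "('k, 'b, 'a, 'n) bimodule" and e
    and V :: "('k, 'a, 'v) lmodule" +
  assumes V_I: "\<And>a v. a \<in> I \<Longrightarrow> v \<in> carrier V \<Longrightarrow> lact V a v = \<zero>\<^bsub>V\<^esub>"
begin

lemma coset_act: "a \<in> carrier A \<Longrightarrow> b \<in> carrier A \<Longrightarrow> v \<in> carrier V \<Longrightarrow> I +>\<^bsub>A\<^esub> a = I +>\<^bsub>A\<^esub> b \<Longrightarrow>
    lact V a v = lact V b v"
  by (rule V.act_eq_of_coset_eq[OF I V_I])

lemma act_e_left_hom:
  assumes "y \<in> carrier N" "v \<in> carrier V"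
  shows "add_hom M V (\<lambda>x. lact V (e x y) v)"
proof (rule add_homI)
  fix x x' assume x: "x \<in> carrier M" "x' \<in> carrier M"
  show "lact V (e (x \<oplus>\<^bsub>M\<^esub> x') y) v = lact V (e x y) v \<oplus>\<^bsub>V\<^esub> lact V (e x' y) v"
    using coset_act[OF _ _ assms(2) e_add_left[OF x assms(1)]] x assms e_closed
    by (simp add: V.act_add_left)
qed (use assms e_closed in auto)

lemma act_e_right_hom:
  assumes "x \<in> carrier M" "v \<in> carrier V"
  shows "add_hom N V (\<lambda>y. lact V (e x y) v)"
proof (rule add_homI)
  fix y y' assume y: "y \<in> carrier N" "y' \<in> carrier N"
  show "lact V (e x (y \<oplus>\<^bsub>N\<^esub> y')) v = lact V (e x y) v \<oplus>\<^bsub>V\<^esub> lact V (e x y') v"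
    using coset_act[OF _ _ assms(2) e_add_right[OF assms(1) y]] y assms e_closed
    by (simp add: V.act_add_left)
qed (use assms e_closed in auto)

lemma act_e_balanced:
  "x \<in> carrier M \<Longrightarrow> b \<in> carrier B \<Longrightarrow> y \<in> carrier N \<Longrightarrow> v \<in> carrier V \<Longrightarrow>
   lact V (e (ract M x b) y) v = lact V (e x (lact N b y)) v"
  by (rule coset_act[OF _ _ _ e_balanced]) (auto simp: e_closed ractM_closed)

lemma act_e_lact:
  "a \<in> carrier A \<Longrightarrow> x \<in> carrier M \<Longrightarrow> y \<in> carrier N \<Longrightarrow> v \<in> carrier V \<Longrightarrow>
   lact V (e (lact M a x) y) v = lact V a (lact V (e x y) v)"
  using coset_act[OF _ _ _ e_left[of a x y], of v] by (auto simp: e_closed V.act_mult)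

lemma act_e_ract:
  "a \<in> carrier A \<Longrightarrow> x \<in> carrier M \<Longrightarrow> y \<in> carrier N \<Longrightarrow> v \<in> carrier V \<Longrightarrow>
   lact V (e x (ract N y a)) v = lact V (e x y) (lact V a v)"
  using coset_act[OF _ _ _ e_right[of a x y], of v] by (auto simp: e_closed ractN_closed V.act_mult)

lemma act_e_hcomp:
  assumes "i \<in> degs \<V>" "j \<in> degs \<V>" "l \<in> degs \<V>" "x \<in> hcomp M i" "y \<in> hcomp N j" "v \<in> hcomp V l"
  shows "lact V (e x y) v \<in> hcomp V (dplus \<V> (dplus \<V> i j) l)"
proof -
  obtain a where a: "a \<in> hcomp A (dplus \<V> i j)" "I +>\<^bsub>A\<^esub> e x y = I +>\<^bsub>A\<^esub> a"
    using e_hcomp assms by blast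
  have "x \<in> carrier M" "y \<in> carrier N" "v \<in> carrier V" "a \<in> carrier A"
    using assms a M.hcomp_carrier N.hcomp_carrier V.hcomp_carrier M.A.hcomp_carrier dplus_degs by blast+
  then have "lact V (e x y) v = lact V a v"
    using a(2) e_closed by (intro coset_act) auto
  then show ?thesis using V.act_hcomp[OF _ assms(3) a(1) assms(6)] assms by simp
qed

text \<open>The part \<open>I\<close> of \<open>trace\<close> acts by zero, which leaves the values
  of \<open>e\<close>. In this form the action of the trace factors through a linked module.\<close>

lemma trace_act:
  "ideal_act trace V =
     add_span V {lact V (e x y) v |x y v. x \<in> carrier M \<and> y \<in> carrier N \<and> v \<in> carrier V}"
  (is "_ = add_span V ?S")
proof
  have S: "?S \<subseteq> carrier V" using e_closed by auto
  note sg = V.M.add_span_subgroup[OF S]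
  have "lact V a v \<in> add_span V ?S" if a: "a \<in> trace" and v: "v \<in> carrier V" for a v
  proof (rule add_hom_span[OF V.A_abelian V.X_abelian V.act_left_hom[OF v] _ sg _ a[unfolded trace_def]])
    fix s assume s: "s \<in> I \<union> {e x y |x y. x \<in> carrier M \<and> y \<in> carrier N}"
    show "lact V s v \<in> add_span V ?S"
    proof (cases "s \<in> I")
      case True
      then show ?thesis using V_I v generate.one[of "add_monoid V" ?S] by simp
    next
      case False
      then show ?thesis using s v by (intro generate.incl) auto
    qed
  qed (use I_carrier e_closed in auto)
  then show "ideal_act trace V \<subseteq> add_span V ?S"
    unfolding ideal_act_def by (intro V.M.add_span_incl[OF _ sg]) auto
  show "add_span V ?S \<subseteq> ideal_act trace V"
    unfolding ideal_act_def by (rule V.M.add.mono_generate) (use e_trace in blast)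
qed

end

text \<open>The two laws can be equalities in \<open>M\<close> and \<open>N\<close> rather than
  congruences, since on inflated bimodules \<open>A\<close> and \<open>B\<close> act through
  \<open>A/I\<close> and \<open>B/J\<close>, where representatives do not show.\<close>

locale morita_pair =
  AB: half_context \<V> k A B I M N e + BA: half_context \<V> k B A J N M r
  for \<V> k A B I J M N e r +
  assumes assoc_M: "\<And>x y x'. x \<in> carrier M \<Longrightarrow> y \<in> carrier N \<Longrightarrow> x' \<in> carrier M \<Longrightarrow>
      lact M (e x y) x' = ract M x (r y x')"
    and assoc_N: "\<And>y x y'. y \<in> carrier N \<Longrightarrow> x \<in> carrier M \<Longrightarrow> y' \<in> carrier N \<Longrightarrow>
      lact N (r y x) y' = ract N y (e x y')"
begin

lemma swap: "morita_pair \<V> k B A J I N M r e"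
  by (intro morita_pair.intro morita_pair_axioms.intro AB.half_context_axioms BA.half_context_axioms)
    (simp_all add: assoc_M assoc_N)

end

definition linked ::
  "vcat \<Rightarrow> ('k, 'a, 'x) vobj_scheme \<Rightarrow> ('k, 'b, 'y) vobj_scheme \<Rightarrow>
   ('k, 'a, 'b, 'm) bimodule \<Rightarrow> ('k, 'b, 'a, 'n) bimodule \<Rightarrow> ('m \<Rightarrow> 'n \<Rightarrow> 'a) \<Rightarrow> ('n \<Rightarrow> 'm \<Rightarrow> 'b) \<Rightarrow>
   ('k, 'a, 'v) lmodule \<Rightarrow> ('k, 'b, 'w) lmodule \<Rightarrow> ('m \<Rightarrow> 'w \<Rightarrow> 'v) \<Rightarrow> ('n \<Rightarrow> 'v \<Rightarrow> 'w) \<Rightarrow> bool" where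
  "linked \<V> A B M N e r V W \<sigma> \<tau> \<longleftrightarrow>
     pairing \<V> A B M W V \<sigma> \<and> pairing \<V> B A N V W \<tau> \<and>
     (\<forall>x\<in>carrier M. \<forall>y\<in>carrier N. \<forall>v\<in>carrier V. \<sigma> x (\<tau> y v) = lact V (e x y) v) \<and>
     (\<forall>y\<in>carrier N. \<forall>x\<in>carrier M. \<forall>w\<in>carrier W. \<tau> y (\<sigma> x w) = lact W (r y x) w)"

lemma linked_swap: "linked \<V> A B M N e r V W \<sigma> \<tau> \<Longrightarrow> linked \<V> B A N M r e W V \<tau> \<sigma>"
  by (simp add: linked_def)

lemma linkedD:
  assumes "linked \<V> A B M N e r V W \<sigma> \<tau>"
  shows "pairing \<V> A B M W V \<sigma>" "pairing \<V> B A N V W \<tau>"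
    and "x \<in> carrier M \<Longrightarrow> y \<in> carrier N \<Longrightarrow> v \<in> carrier V \<Longrightarrow> \<sigma> x (\<tau> y v) = lact V (e x y) v"
    and "y \<in> carrier N \<Longrightarrow> x \<in> carrier M \<Longrightarrow> w \<in> carrier W \<Longrightarrow> \<tau> y (\<sigma> x w) = lact W (r y x) w"
  using assms by (auto simp: linked_def)

locale linked_modules =
  morita_pair \<V> k A B I J M N e r + V: half_context_module \<V> k A B I M N e V +
  W: half_context_module \<V> k B A J N M r W
  for \<V> k A B I J M N e r V W +
  fixes \<sigma> \<tau>
  assumes link: "linked \<V> A B M N e r V W \<sigma> \<tau>"
begin

lemmas \<sigma> = pairingD[OF linkedD(1)[OF link]]
lemmas \<tau> = pairingD[OF linkedD(2)[OF link]]
lemmas \<sigma>\<tau> = linkedD(3)[OF link]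
lemmas \<tau>\<sigma> = linkedD(4)[OF link]

lemma swap_linked: "linked_modules \<V> k B A J I N M r e W V \<tau> \<sigma>"
  by (intro linked_modules.intro linked_modules_axioms.intro swap linked_swap[OF link]
      V.half_context_module_axioms W.half_context_module_axioms)


end

section \<open>Simplicity of linked modules\<close>

context linked_modules
begin

text \<open>Injectivity of the map from \<open>V\<close> to \<open>Hom(N, W)\<close> that
  corresponds to \<open>\<tau>\<close>.\<close>

definition separating :: bool where
  "separating \<longleftrightarrow> (\<forall>v\<in>carrier V. (\<forall>y\<in>carrier N. \<tau> y v = \<zero>\<^bsub>W\<^esub>) \<longrightarrow> v = \<zero>\<^bsub>V\<^esub>)"

text \<open>Surjectivity of \<open>\<sigma>\<close> as a map from \<open>M \<otimes> W\<close> to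
  \<open>V\<close>. Together with \<open>separating\<close> it makes \<open>V\<close> a copy of the
  image of \<open>M \<otimes> W\<close> in \<open>Hom(N, W)\<close>.\<close>

definition spanning :: bool where
  "spanning \<longleftrightarrow> carrier V = add_span V {\<sigma> x w |x w. x \<in> carrier M \<and> w \<in> carrier W}"

lemma \<tau>_hpart:
  assumes "d \<in> degs \<V>" "y \<in> hcomp N d" "v \<in> carrier V" "i \<in> degs \<V>"
  shows "\<tau> y (hpart \<V> V i v) = hpart \<V> W (dplus \<V> d i) (\<tau> y v)"
  by (rule shifted_hpart[OF V.V.vspace_axioms W.V.vspace_axioms \<tau>(2) assms(1) \<tau>(6) assms(3,4)])
    (use assms AB.N.hcomp_carrier in auto)

lemma \<tau>_zero_on_homogeneous:
  assumes v: "v \<in> carrier V" and 0: "\<And>d y. d \<in> degs \<V> \<Longrightarrow> y \<in> hcomp N d \<Longrightarrow> \<tau> y v = \<zero>\<^bsub>W\<^esub>"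
    and y: "y \<in> carrier N"
  shows "\<tau> y v = \<zero>\<^bsub>W\<^esub>"
proof -
  have "\<tau> y v \<in> {\<zero>\<^bsub>W\<^esub>}"
    by (rule add_hom_span[OF AB.N.X_abelian W.V.X_abelian \<tau>(1)[OF v] AB.N.homogeneous_carrier])
      (use 0 y AB.N.carrier_eq_span W.V.M.add.triv_subgroup in \<open>auto simp: homogeneous_def\<close>)
  then show ?thesis by simp
qed

text \<open>The kernel of the map from \<open>V\<close> to \<open>Hom(N, W)\<close>. Being a graded
  submodule, it is zero or all of \<open>V\<close> when \<open>V\<close> is simple.\<close>

lemma annihilator_lsub: "V.V.lsub {v \<in> carrier V. \<forall>y\<in>carrier N. \<tau> y v = \<zero>\<^bsub>W\<^esub>}" (is "V.V.lsub ?U")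
  unfolding V.V.lsub_def
proof (intro conjI ballI)
  show "add_subgroup V ?U"
    by (rule V.V.M.add_subgroupI)
      (auto simp: add_hom_zero[OF V.V.X_abelian W.V.X_abelian \<tau>(2)] add_hom_add[OF \<tau>(2)]
        add_hom_neg[OF V.V.X_abelian W.V.X_abelian \<tau>(2)])
  show "lact V a u \<in> ?U" if "a \<in> carrier A" "u \<in> ?U" for a u
    using that by (auto simp: AB.ractN_closed simp flip: \<tau>(5))
  show "hpart \<V> V i u \<in> ?U" if i: "i \<in> degs \<V>" and u: "u \<in> ?U" for i u
  proof -
    have uV: "u \<in> carrier V" using u by simp
    have "\<tau> y (hpart \<V> V i u) = \<zero>\<^bsub>W\<^esub>" if y: "y \<in> carrier N" for y
    \<comment> \<open>Only for homogeneous \<open>y\<close> does \<open>\<tau> y\<close> commute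
      with projections up to a shift; such \<open>y\<close> span \<open>N\<close>.\<close>
    proof (rule \<tau>_zero_on_homogeneous[OF V.V.hpart_closed[OF uV i] _ y])
      fix d y assume d: "d \<in> degs \<V>" and y: "y \<in> hcomp N d"
      have "\<tau> y u = \<zero>\<^bsub>W\<^esub>" using u AB.N.hcomp_carrier[OF d y] by simp
      then show "\<tau> y (hpart \<V> V i u) = \<zero>\<^bsub>W\<^esub>"
        using \<tau>_hpart[OF d y uV i] d i
          add_hom_zero[OF W.V.X_abelian W.V.X_abelian W.V.hpart_add_hom] by simp
    qed
    then show ?thesis using V.V.hpart_closed[OF uV i] by simp
  qed
qed

lemma \<sigma>_subset: "{\<sigma> x w |x w. x \<in> carrier M \<and> w \<in> carrier W} \<subseteq> carrier V"
  using \<sigma>(3) by auto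

text \<open>The trace acts on \<open>V\<close> as \<open>\<sigma>(x, \<tau>(y, v))\<close>. If
  \<open>\<tau>\<close> vanished on \<open>V\<close>, the trace would act by zero, although it
  generates \<open>V \<noteq> 0\<close>; so the kernel of \<open>\<tau>\<close> is zero. The same
  formula shows that values of \<open>\<sigma>\<close> span \<open>V\<close>.\<close>

lemma simple_separating_spanning:
  assumes "simple_between \<V> k A I AB.trace V"
  shows separating spanning
proof -
  have simple: "\<And>U. V.V.lsub U \<Longrightarrow> U = {\<zero>\<^bsub>V\<^esub>} \<or> U = carrier V" and ne: "carrier V \<noteq> {\<zero>\<^bsub>V\<^esub>}"
    and tr: "carrier V = add_span V {lact V (e x y) v |x y v. x \<in> carrier M \<and> y \<in> carrier N \<and> v \<in> carrier V}"
    using assms V.trace_act by (auto simp: simple_between_def V.V.simple_module_iff)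
  have ann: "{v \<in> carrier V. \<forall>y\<in>carrier N. \<tau> y v = \<zero>\<^bsub>W\<^esub>} = {\<zero>\<^bsub>V\<^esub>}"
  proof (rule ccontr)
    assume "\<not> ?thesis"
    then have all: "{v \<in> carrier V. \<forall>y\<in>carrier N. \<tau> y v = \<zero>\<^bsub>W\<^esub>} = carrier V"
      using simple[OF annihilator_lsub] by blast
    have "lact V (e x y) v = \<zero>\<^bsub>V\<^esub>" if "x \<in> carrier M" "y \<in> carrier N" "v \<in> carrier V" for x y v
    proof -
      have "\<tau> y v = \<zero>\<^bsub>W\<^esub>" using all that by blast
      then show ?thesis
        using \<sigma>\<tau>[OF that] add_hom_zero[OF W.V.X_abelian V.V.X_abelian \<sigma>(2)[OF that(1)]] by simp
    qed
    then have "add_span V {lact V (e x y) v |x y v. x \<in> carrier M \<and> y \<in> carrier N \<and> v \<in> carrier V}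
        \<subseteq> {\<zero>\<^bsub>V\<^esub>}"
      using V.V.M.add.triv_subgroup by (intro V.V.M.add_span_incl) auto
    then show False using ne tr V.V.M.zero_closed by blast
  qed
  show separating
    unfolding separating_def using ann by blast
  have "{lact V (e x y) v |x y v. x \<in> carrier M \<and> y \<in> carrier N \<and> v \<in> carrier V}
      \<subseteq> {\<sigma> x w |x w. x \<in> carrier M \<and> w \<in> carrier W}"
  proof clarify
    fix x y v assume *: "x \<in> carrier M" "y \<in> carrier N" "v \<in> carrier V"
    then show "\<exists>x' w. lact V (e x y) v = \<sigma> x' w \<and> x' \<in> carrier M \<and> w \<in> carrier W"
      using \<sigma>\<tau>[OF *] \<tau>(3)[OF *(2,3)] by metis
  qed
  then have "carrier V \<subseteq> add_span V {\<sigma> x w |x w. x \<in> carrier M \<and> w \<in> carrier W}"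
    using V.V.M.add.mono_generate tr by blast
  then show spanning
    unfolding spanning_def using V.V.M.add_subgroupD(1)[OF V.V.M.add_span_subgroup[OF \<sigma>_subset]] by blast
qed

text \<open>For a non-zero submodule \<open>U\<close> the span of \<open>\<tau>(N, U)\<close> is
  non-zero by \<open>separating\<close>, hence equal to \<open>W\<close>. Then \<open>V\<close>,
  spanned by \<open>\<sigma>(M, W)\<close>, lies in the span of
  \<open>\<sigma>(M, \<tau>(N, U)) = e(M, N) U\<close>, which is contained in
  \<open>U\<close>.\<close>

theorem simple_of_linked:
  assumes W: "simple_between \<V> k B J BA.trace W" and sep: separating and span: spanning
  shows "simple_between \<V> k A I AB.trace V"
proof -
  have simple: "\<And>U. W.V.lsub U \<Longrightarrow> U = {\<zero>\<^bsub>W\<^esub>} \<or> U = carrier W" and ne: "carrier W \<noteq> {\<zero>\<^bsub>W\<^esub>}"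
    and trW: "carrier W = add_span W {lact W (r y x) w |y x w. y \<in> carrier N \<and> x \<in> carrier M \<and> w \<in> carrier W}"
    using W W.trace_act by (auto simp: simple_between_def W.V.simple_module_iff)
  \<comment> \<open>By \<open>\<tau>\<sigma>\<close> the trace acts on \<open>W\<close> through
    \<open>V\<close>, so \<open>V = 0\<close> would force \<open>W = 0\<close>.\<close>
  have "carrier V \<noteq> {\<zero>\<^bsub>V\<^esub>}"
  proof
    assume 0: "carrier V = {\<zero>\<^bsub>V\<^esub>}"
    have "lact W (r y x) w = \<zero>\<^bsub>W\<^esub>" if "y \<in> carrier N" "x \<in> carrier M" "w \<in> carrier W" for x y w
    proof -
      have "\<sigma> x w = \<zero>\<^bsub>V\<^esub>" using \<sigma>(3)[OF that(2,3)] 0 by simp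
      then show ?thesis
        using \<tau>\<sigma>[OF that] add_hom_zero[OF V.V.X_abelian W.V.X_abelian \<tau>(2)[OF that(1)]] by simp
    qed
    then have "add_span W {lact W (r y x) w |y x w. y \<in> carrier N \<and> x \<in> carrier M \<and> w \<in> carrier W}
        \<subseteq> {\<zero>\<^bsub>W\<^esub>}"
      using W.V.M.add.triv_subgroup by (intro W.V.M.add_span_incl) auto
    then show False using ne trW W.V.M.zero_closed by blast
  qed
  moreover have "U = {\<zero>\<^bsub>V\<^esub>} \<or> U = carrier V" if U: "V.V.lsub U" for U
  proof (cases "U = {\<zero>\<^bsub>V\<^esub>}")
    case False
    have sgU: "add_subgroup V U" and UV: "U \<subseteq> carrier V" and actU: "\<And>a u. a \<in> carrier A \<Longrightarrow> u \<in> U \<Longrightarrow> lact V a u \<in> U"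
      using U V.V.lsub_carrier[OF U] by (auto simp: V.V.lsub_def)
    have "U \<noteq> {}" using V.V.M.add_subgroupD(2)[OF sgU] by auto
    then obtain u where u: "u \<in> U" "u \<noteq> \<zero>\<^bsub>V\<^esub>" using False by blast
    then obtain y0 where y0: "y0 \<in> carrier N" "\<tau> y0 u \<noteq> \<zero>\<^bsub>W\<^esub>"
      using sep UV by (auto simp: separating_def)
    \<comment> \<open>Homogeneous \<open>u\<close> and, in \<open>S\<close>, homogeneous
      \<open>y\<close> are used to make the span of \<open>S\<close> a graded submodule of
      \<open>W\<close>.\<close>
    define Uh where "Uh = U \<inter> homogeneous \<V> V"
    have Uspan: "U = add_span V Uh"
      using V.V.subobject_eq_span[of U] U V.V.lsub_iff by (simp add: Uh_def)
    define S where "S = {\<tau> y u |y u. y \<in> homogeneous \<V> N \<and> u \<in> Uh}"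
    have Sh: "S \<subseteq> homogeneous \<V> W"
    proof
      fix s assume "s \<in> S"
      then obtain y u i j where "s = \<tau> y u" "i \<in> degs \<V>" "y \<in> hcomp N i" "j \<in> degs \<V>" "u \<in> hcomp V j"
        by (auto simp: S_def Uh_def homogeneous_def)
      then show "s \<in> homogeneous \<V> W"
        unfolding homogeneous_def using \<tau>(6) by (intro UN_I[of "dplus \<V> i j"]) auto
    qed
    have SW: "S \<subseteq> carrier W" using Sh W.V.homogeneous_carrier by blast
    have UhV: "Uh \<subseteq> carrier V" using UV by (auto simp: Uh_def)
    have TS: "\<tau> y u \<in> add_span W S" if "y \<in> carrier N" "u \<in> U" for y u
      by (rule biadditive_span[OF AB.N.X_abelian V.V.X_abelian W.V.X_abelian \<tau>(1) \<tau>(2)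
            AB.N.homogeneous_carrier UhV W.V.M.add_span_subgroup[OF SW]])
        (use that AB.N.carrier_eq_span Uspan in \<open>auto simp: S_def intro: generate.incl\<close>)
    have "W.V.lsub (add_span W S)"
    proof (rule W.V.lsub_spanI[OF Sh])
      fix b s assume b: "b \<in> homogeneous \<V> B" and "s \<in> S"
      then obtain y u where s: "s = \<tau> y u" "y \<in> homogeneous \<V> N" "u \<in> Uh" by (auto simp: S_def)
      have *: "b \<in> carrier B" "y \<in> carrier N" "u \<in> carrier V"
        using b s AB.N.homogeneous_carrier UhV AB.N.A.homogeneous_carrier by auto
      then have "lact W b s = \<tau> (lact N b y) u" using s \<tau>(4) by simp
      then show "lact W b s \<in> add_span W S"
        using TS * s by (simp add: Uh_def)
    qed
    moreover have "\<tau> y0 u \<in> add_span W S" using TS y0 u by simp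
    ultimately have T: "carrier W = add_span W S" using simple y0 by blast
    have "\<sigma> x w \<in> U" if x: "x \<in> carrier M" and w: "w \<in> carrier W" for x w
    proof (rule add_hom_span[OF W.V.X_abelian V.V.X_abelian \<sigma>(2)[OF x] SW sgU])
      show "w \<in> add_span W S" using w T by simp
      fix s assume "s \<in> S"
      then obtain y u where s: "s = \<tau> y u" "y \<in> homogeneous \<V> N" "u \<in> Uh" by (auto simp: S_def)
      then have *: "y \<in> carrier N" "u \<in> carrier V" "u \<in> U"
        using AB.N.homogeneous_carrier UhV by (auto simp: Uh_def)
      then show "\<sigma> x s \<in> U"
        using s x by (simp add: \<sigma>\<tau> actU AB.e_closed)
    qed
    then have "add_span V {\<sigma> x w |x w. x \<in> carrier M \<and> w \<in> carrier W} \<subseteq> U"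
      by (intro V.V.M.add_span_incl[OF _ sgU]) auto
    then show ?thesis using span UV by (auto simp: spanning_def)
  qed simp
  \<comment> \<open>\<open>W\<close> is spanned by elements \<open>r(y, x') w'\<close>, and
    \<open>\<sigma> x\<close> turns such an element into \<open>e(x, y)\<close> applied to
    \<open>\<sigma>(x', w')\<close>.\<close>
  moreover have "ideal_act AB.trace V = carrier V"
  proof
    have sgT: "add_subgroup V (ideal_act AB.trace V)"
      unfolding ideal_act_def using AB.trace_carrier by (intro V.V.M.add_span_subgroup) auto
    then show "ideal_act AB.trace V \<subseteq> carrier V" using V.V.M.add_subgroupD(1) by blast
    have "\<sigma> x w \<in> ideal_act AB.trace V" if x: "x \<in> carrier M" and w: "w \<in> carrier W" for x w
    proof (rule add_hom_span[OF W.V.X_abelian V.V.X_abelian \<sigma>(2)[OF x] _ sgT])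
      show "w \<in> add_span W {lact W (r y x) w |y x w. y \<in> carrier N \<and> x \<in> carrier M \<and> w \<in> carrier W}"
        using w trW by simp
      show "{lact W (r y x) w |y x w. y \<in> carrier N \<and> x \<in> carrier M \<and> w \<in> carrier W} \<subseteq> carrier W"
        using BA.e_closed by auto
      fix s assume "s \<in> {lact W (r y x) w |y x w. y \<in> carrier N \<and> x \<in> carrier M \<and> w \<in> carrier W}"
      then obtain y x' w' where s: "s = lact W (r y x') w'" "y \<in> carrier N" "x' \<in> carrier M" "w' \<in> carrier W"
        by auto
      then have "\<sigma> x s = lact V (e x y) (\<sigma> x' w')"
        using x \<sigma>(3) by (simp flip: \<tau>\<sigma> \<sigma>\<tau>)
      then show "\<sigma> x s \<in> ideal_act AB.trace V"
        using s AB.e_trace[OF x s(2)] \<sigma>(3)[OF s(3,4)] unfolding ideal_act_def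
        by (intro generate.incl) blast
    qed
    then have "add_span V {\<sigma> x w |x w. x \<in> carrier M \<and> w \<in> carrier W} \<subseteq> ideal_act AB.trace V"
      by (intro V.V.M.add_span_incl[OF _ sgT]) auto
    then show "carrier V \<subseteq> ideal_act AB.trace V" using span by (simp add: spanning_def)
  qed
  moreover have "ideal_act I V = {\<zero>\<^bsub>V\<^esub>}"
    using V.V.ideal_act_zero_iff[OF AB.I_carrier] V.V_I by simp
  ultimately show ?thesis
    using V.V.left_module by (simp add: simple_between_def V.V.simple_module_iff)
qed

end

section \<open>Uniqueness of the module linked to a given one\<close>

locale two_linked_modules =
  L1: linked_modules \<V> k A B I J M N e r V W \<sigma> \<tau> +
  L2: linked_modules \<V> k A B I J M N e r V' W \<sigma>' \<tau>'
  for \<V> k A B I J M N e r V W \<sigma> \<tau> V' \<sigma>' \<tau>'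
begin

lemma swap_two: "two_linked_modules \<V> k A B I J M N e r V' W \<sigma>' \<tau>' V \<sigma> \<tau>"
  by (intro two_linked_modules.intro L1.linked_modules_axioms L2.linked_modules_axioms)

text \<open>A partner of \<open>\<sigma>(x, w)\<close> is \<open>\<sigma>'(x, w)\<close>, because
  \<open>\<tau> y\<close> and \<open>\<tau>' y\<close> send them to the same
  \<open>r(y, x) w\<close>. Elements with a partner form a subgroup, so \<open>spanning\<close>
  extends this to all of \<open>V\<close>.\<close>

lemma partner_exists:
  assumes span: L1.spanning and v: "v \<in> carrier V"
  shows "\<exists>v'\<in>carrier V'. \<forall>y\<in>carrier N. \<tau>' y v' = \<tau> y v"
proof -
  define U where "U = {v \<in> carrier V. \<exists>v'\<in>carrier V'. \<forall>y\<in>carrier N. \<tau>' y v' = \<tau> y v}"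
  note VW = L1.V.V.X_abelian L1.W.V.X_abelian and VW' = L2.V.V.X_abelian L1.W.V.X_abelian
  have "add_subgroup V U"
  proof (rule L1.V.V.M.add_subgroupI)
    show "U \<subseteq> carrier V" by (auto simp: U_def)
    show "\<zero>\<^bsub>V\<^esub> \<in> U"
      by (auto simp: U_def add_hom_zero[OF VW L1.\<tau>(2)] add_hom_zero[OF VW' L2.\<tau>(2)]
          intro!: bexI[of _ "\<zero>\<^bsub>V'\<^esub>"])
    show "\<ominus>\<^bsub>V\<^esub> u \<in> U" if "u \<in> U" for u
    proof -
      obtain u' where "u \<in> carrier V" "u' \<in> carrier V'" "\<forall>y\<in>carrier N. \<tau>' y u' = \<tau> y u"
        using \<open>u \<in> U\<close> by (auto simp: U_def)
      then show ?thesis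
        by (auto simp: U_def add_hom_neg[OF VW L1.\<tau>(2)] add_hom_neg[OF VW' L2.\<tau>(2)]
            intro!: bexI[of _ "\<ominus>\<^bsub>V'\<^esub> u'"])
    qed
    show "u \<oplus>\<^bsub>V\<^esub> w \<in> U" if "u \<in> U" "w \<in> U" for u w
    proof -
      obtain u' where "u \<in> carrier V" "u' \<in> carrier V'" "\<forall>y\<in>carrier N. \<tau>' y u' = \<tau> y u"
        using \<open>u \<in> U\<close> by (auto simp: U_def)
      moreover obtain w' where "w \<in> carrier V" "w' \<in> carrier V'" "\<forall>y\<in>carrier N. \<tau>' y w' = \<tau> y w"
        using \<open>w \<in> U\<close> by (auto simp: U_def)
      ultimately show ?thesis
        by (auto simp: U_def add_hom_add[OF L1.\<tau>(2)] add_hom_add[OF L2.\<tau>(2)]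
            intro!: bexI[of _ "u' \<oplus>\<^bsub>V'\<^esub> w'"])
    qed
  qed
  moreover have "{\<sigma> x w |x w. x \<in> carrier M \<and> w \<in> carrier W} \<subseteq> U"
    using L1.\<sigma>(3) L2.\<sigma>(3) by (auto simp: U_def L1.\<tau>\<sigma> L2.\<tau>\<sigma> intro!: bexI[of _ "\<sigma>' _ _"])
  ultimately have "carrier V \<subseteq> U"
    using span L1.V.V.M.add_span_incl unfolding L1.spanning_def by blast
  then show ?thesis using v by (auto simp: U_def)
qed

lemma partner_unique:
  assumes sep: L2.separating and "u \<in> carrier V'" "v \<in> carrier V'"
    and eq: "\<And>y. y \<in> carrier N \<Longrightarrow> \<tau>' y u = \<tau>' y v"
  shows "u = v"
proof (rule abelian_group_diff_zeroD[OF L2.V.V.X_abelian assms(2,3)])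
  have "\<tau>' y (u \<ominus>\<^bsub>V'\<^esub> v) = \<zero>\<^bsub>W\<^esub>" if "y \<in> carrier N" for y
    using assms that L2.\<tau>(3)[OF that]
    by (simp add: add_hom_diff[OF L2.V.V.X_abelian L1.W.V.X_abelian L2.\<tau>(2)] a_minus_def[of W]
        L1.W.V.M.r_neg)
  then show "u \<ominus>\<^bsub>V'\<^esub> v = \<zero>\<^bsub>V'\<^esub>"
    using sep assms by (simp add: L2.separating_def)
qed

text \<open>Separation embeds both modules into \<open>Hom(N, W)\<close>, and by spanning both have
  the same image there, the span of the maps \<open>y \<mapsto> r(y, x) w\<close>. The map
  \<open>\<phi>\<close> compares the two embeddings.\<close>

theorem iso_of_linked:
  assumes span: L1.spanning L2.spanning and sep: L1.separating L2.separating
  shows "lmod_iso \<V> k A V V'"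
proof -
  interpret S: two_linked_modules \<V> k A B I J M N e r V' W \<sigma>' \<tau>' V \<sigma> \<tau> by (rule swap_two)
  define \<phi> where "\<phi> v = (SOME v'. v' \<in> carrier V' \<and> (\<forall>y\<in>carrier N. \<tau>' y v' = \<tau> y v))" for v
  have \<phi>: "\<phi> v \<in> carrier V'" "\<And>y. y \<in> carrier N \<Longrightarrow> \<tau>' y (\<phi> v) = \<tau> y v" if "v \<in> carrier V" for v
  proof -
    have "\<exists>v'. v' \<in> carrier V' \<and> (\<forall>y\<in>carrier N. \<tau>' y v' = \<tau> y v)"
      using partner_exists[OF span(1) that] by blast
    from someI_ex[OF this] show "\<phi> v \<in> carrier V'" "\<And>y. y \<in> carrier N \<Longrightarrow> \<tau>' y (\<phi> v) = \<tau> y v"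
      by (auto simp: \<phi>_def)
  qed
  note VW = L1.V.V.X_abelian L1.W.V.X_abelian and VW' = L2.V.V.X_abelian L1.W.V.X_abelian
  have "lmod_hom \<V> k A V V' \<phi>"
  proof (rule lmod_homI[OF L1.V.V.lmod_axioms L2.V.V.lmod_axioms])
    show "add_hom V V' \<phi>"
      by (intro add_homI partner_unique[OF sep(2)])
        (auto simp: \<phi> add_hom_add[OF L1.\<tau>(2)] add_hom_add[OF L2.\<tau>(2)])
    show "\<phi> (lact V a v) = lact V' a (\<phi> v)" if "a \<in> carrier A" "v \<in> carrier V" for a v
      using that
      by (intro partner_unique[OF sep(2)])
        (auto simp: \<phi> L1.AB.ractN_closed simp flip: L1.\<tau>(5) L2.\<tau>(5))
    fix j v assume j: "j \<in> degs \<V>" and v: "v \<in> hcomp V j"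
    have vV: "v \<in> carrier V" using L1.V.V.hcomp_carrier[OF j v] .
    \<comment> \<open>If \<open>\<phi> v\<close> equals its part of degree \<open>j\<close>, it is
      homogeneous. For \<open>y\<close> of degree \<open>i\<close> the common value
      \<open>\<tau>(y, v)\<close> has degree \<open>i + j\<close>, so \<open>\<tau>' y\<close> does
      not distinguish the two.\<close>
    have "\<phi> v = hpart \<V> V' j (\<phi> v)"
    proof (rule partner_unique[OF sep(2) \<phi>(1)[OF vV] L2.V.V.hpart_closed[OF \<phi>(1)[OF vV] j]])
      have hom: "\<tau>' y (\<phi> v \<ominus>\<^bsub>V'\<^esub> hpart \<V> V' j (\<phi> v)) = \<zero>\<^bsub>W\<^esub>"
        if i: "i \<in> degs \<V>" and y: "y \<in> hcomp N i" for i y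
      proof -
        have yN: "y \<in> carrier N" using L1.AB.N.hcomp_carrier[OF i y] .
        have "\<tau>' y (hpart \<V> V' j (\<phi> v)) = hpart \<V> W (dplus \<V> i j) (\<tau> y v)"
          using L2.\<tau>_hpart[OF i y \<phi>(1)[OF vV] j] \<phi>(2)[OF vV yN] by simp
        also have "\<dots> = \<tau> y v"
          using L1.W.V.hpart_homog[OF _ _ L1.\<tau>(6)[OF i j y v]] i j by simp
        finally show ?thesis
          using \<phi>[OF vV] yN j L2.V.V.hpart_closed[OF \<phi>(1)[OF vV] j] L1.\<tau>(3)[OF yN vV]
          by (simp add: add_hom_diff[OF VW' L2.\<tau>(2)] a_minus_def[of W] L1.W.V.M.r_neg)
      qed
      fix y assume y: "y \<in> carrier N"
      have c: "\<phi> v \<ominus>\<^bsub>V'\<^esub> hpart \<V> V' j (\<phi> v) \<in> carrier V'"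
        using \<phi>(1)[OF vV] L2.V.V.hpart_closed[OF \<phi>(1)[OF vV] j] by simp
      have "\<tau>' y (\<phi> v \<ominus>\<^bsub>V'\<^esub> hpart \<V> V' j (\<phi> v)) = \<zero>\<^bsub>W\<^esub>"
        by (rule L2.\<tau>_zero_on_homogeneous[OF c hom y])
      then show "\<tau>' y (\<phi> v) = \<tau>' y (hpart \<V> V' j (\<phi> v))"
        using \<phi>(1)[OF vV] L2.V.V.hpart_closed[OF \<phi>(1)[OF vV] j] L2.\<tau>(3)[OF y]
          abelian_group_diff_zeroD[OF L1.W.V.X_abelian]
        by (simp add: add_hom_diff[OF VW' L2.\<tau>(2)[OF y]])
    qed
    then show "\<phi> v \<in> hcomp V' j"
      using L2.V.V.hpart_hcomp[OF \<phi>(1)[OF vV] j] by simp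
  qed
  moreover have "bij_betw \<phi> (carrier V) (carrier V')"
    unfolding bij_betw_def
  proof
    show "inj_on \<phi> (carrier V)"
    proof (rule inj_onI)
      fix u v assume uv: "u \<in> carrier V" "v \<in> carrier V" "\<phi> u = \<phi> v"
      then have "\<tau> y u = \<tau> y v" if "y \<in> carrier N" for y
        using \<phi>(2)[OF uv(1) that] \<phi>(2)[OF uv(2) that] by simp
      then show "u = v" by (rule S.partner_unique[OF sep(1) uv(1,2)])
    qed
    show "\<phi> ` carrier V = carrier V'"
    proof
      show "\<phi> ` carrier V \<subseteq> carrier V'" using \<phi> by auto
      show "carrier V' \<subseteq> \<phi> ` carrier V"
      proof
        fix v' assume v': "v' \<in> carrier V'"
        obtain v where v: "v \<in> carrier V" "\<forall>y\<in>carrier N. \<tau> y v = \<tau>' y v'"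
          using S.partner_exists[OF span(2) v'] by blast
        have "v' = \<phi> v"
          by (rule partner_unique[OF sep(2) v' \<phi>(1)[OF v(1)]]) (simp add: \<phi>(2)[OF v(1)] v(2))
        then show "v' \<in> \<phi> ` carrier V" using v by blast
      qed
    qed
  qed
  ultimately show ?thesis by (auto simp: lmod_iso_def)
qed

end

lemma iso_of_linked_simple:
  assumes "linked_modules \<V> k A B I J M N e r V W \<sigma> \<tau>"
    and "linked_modules \<V> k A B I J M N e r V' W \<sigma>' \<tau>'"
    and "simple_between \<V> k A I (half_context.trace A I M N e) V"
    and "simple_between \<V> k A I (half_context.trace A I M N e) V'"
  shows "lmod_iso \<V> k A V V'"
proof -
  interpret two_linked_modules \<V> k A B I J M N e r V W \<sigma> \<tau> V' \<sigma>' \<tau>'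
    using assms by (intro two_linked_modules.intro)
  show ?thesis
    by (intro iso_of_linked L1.simple_separating_spanning L2.simple_separating_spanning assms)
qed

text \<open>\<open>iso_of_linked\<close> compares modules linked to literally the same
  \<open>W\<close>. To reach that situation, a link is moved along an isomorphism by composing
  \<open>\<tau>\<close> with it and \<open>\<sigma>\<close> with its inverse.\<close>

lemma linked_modules_iso:
  assumes "linked_modules \<V> k A B I J M N e r V W \<sigma> \<tau>"
    and W': "half_context_module \<V> k B A J N M r W'" and iso: "lmod_iso \<V> k B W W'"
  shows "\<exists>\<sigma>' \<tau>'. linked_modules \<V> k A B I J M N e r V W' \<sigma>' \<tau>'"
proof -
  interpret linked_modules \<V> k A B I J M N e r V W \<sigma> \<tau> by fact
  interpret W': half_context_module \<V> k B A J N M r W' by fact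
  obtain f where f: "lmod_hom \<V> k B W W' f" and bij: "bij_betw f (carrier W) (carrier W')"
    using iso by (auto simp: lmod_iso_def)
  obtain f' where f': "lmod_hom \<V> k B W' W f'" and f'_inv: "\<And>w. w \<in> carrier W \<Longrightarrow> f' (f w) = w"
    "\<And>w. w \<in> carrier W' \<Longrightarrow> f (f' w) = w"
    using lmod_iso_inverse[OF W.V.lmod_axioms W'.V.lmod_axioms f bij] by blast
  have fc: "f w \<in> carrier W'" if "w \<in> carrier W" for w
    using add_hom_closed[OF lmod_hom_add_hom[OF f] that] .
  have f'c: "f' w \<in> carrier W" if "w \<in> carrier W'" for w
    using add_hom_closed[OF lmod_hom_add_hom[OF f'] that] .
  have "linked \<V> A B M N e r V W' (\<lambda>x w. \<sigma> x (f' w)) (\<lambda>y v. f (\<tau> y v))"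
    unfolding linked_def
  proof (intro conjI ballI)
    show "pairing \<V> A B M W' V (\<lambda>x w. \<sigma> x (f' w))"
      unfolding pairing_def
      using \<sigma> f'c lmod_hom_act[OF f'] lmod_hom_hcomp[OF f']
        add_hom_comp[OF lmod_hom_add_hom[OF f'] \<sigma>(2)]
      by simp
    show "pairing \<V> B A N V W' (\<lambda>y v. f (\<tau> y v))"
      unfolding pairing_def
      using \<tau> fc lmod_hom_act[OF f] lmod_hom_hcomp[OF f]
        add_hom_comp[OF \<tau>(1) lmod_hom_add_hom[OF f]] add_hom_comp[OF \<tau>(2) lmod_hom_add_hom[OF f]]
      by simp
    show "\<sigma> x (f' (f (\<tau> y v))) = lact V (e x y) v"
      if "x \<in> carrier M" "y \<in> carrier N" "v \<in> carrier V" for x y v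
      using that by (simp add: f'_inv \<tau>(3) \<sigma>\<tau>)
    show "f (\<tau> y (\<sigma> x (f' w))) = lact W' (r y x) w"
      if "y \<in> carrier N" "x \<in> carrier M" "w \<in> carrier W'" for y x w
      using that by (simp add: f'_inv f'c \<tau>\<sigma> lmod_hom_act[OF f] BA.e_closed)
  qed
  then have "linked_modules \<V> k A B I J M N e r V W' (\<lambda>x w. \<sigma> x (f' w)) (\<lambda>y v. f (\<tau> y v))"
    by (intro linked_modules.intro linked_modules_axioms.intro morita_pair_axioms
        V.half_context_module_axioms W')
  then show ?thesis by blast
qed

section \<open>Tensor products\<close>

locale tensor =
  fixes B :: "('k, 'b, 'x) vobj_scheme" and M :: "('k, 'a, 'b, 'm, 'y) bimodule_scheme"
    and N :: "('k, 'b, 'n, 'z) lmodule_scheme"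
  assumes abM: "abelian_group M" and abN: "abelian_group N"
    and ract_closed: "\<And>x b. x \<in> carrier M \<Longrightarrow> b \<in> carrier B \<Longrightarrow> ract M x b \<in> carrier M"
    and lact_closed: "\<And>b y. b \<in> carrier B \<Longrightarrow> y \<in> carrier N \<Longrightarrow> lact N b y \<in> carrier N"
begin

interpretation M: abelian_group M by (rule abM)
interpretation N: abelian_group N by (rule abN)

abbreviation "ker \<equiv> tensor_ker B M N"
abbreviation "pairs \<equiv> carrier M \<times> carrier N"

definition cls :: "('m \<times> 'n \<Rightarrow>\<^sub>0 int) \<Rightarrow> ('m \<times> 'n \<Rightarrow>\<^sub>0 int) set" where
  "cls p = ker #>\<^bsub>tensor_free M N\<^esub> p"

lemma group_free: "group (tensor_free M N)"
  by (simp add: tensor_free_def)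

lemma carrier_free: "carrier (tensor_free M N) = {p. Poly_Mapping.keys p \<subseteq> pairs}"
  by (auto simp: tensor_free_def)

lemma mult_free [simp]: "p \<otimes>\<^bsub>tensor_free M N\<^esub> q = p + q"
  by (simp add: tensor_free_def)

lemma one_free [simp]: "\<one>\<^bsub>tensor_free M N\<^esub> = 0"
  by (simp add: tensor_free_def)

lemma keys_diff_subset: "Poly_Mapping.keys p \<subseteq> S \<Longrightarrow> Poly_Mapping.keys q \<subseteq> S \<Longrightarrow> Poly_Mapping.keys (p - q) \<subseteq> S"
  for p q :: "'c \<Rightarrow>\<^sub>0 int"
  using keys_diff[of p q] by auto

lemma keys_add_subset: "Poly_Mapping.keys p \<subseteq> S \<Longrightarrow> Poly_Mapping.keys q \<subseteq> S \<Longrightarrow> Poly_Mapping.keys (p + q) \<subseteq> S"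
  for p q :: "'c \<Rightarrow>\<^sub>0 int"
  using keys_add[of p q] by auto

lemma tensor_rels_cases:
  assumes "r \<in> tensor_rels B M N"
  obtains (left) x x' y where "r = frag_of (x \<oplus>\<^bsub>M\<^esub> x', y) - frag_of (x, y) - frag_of (x', y)"
      "x \<in> carrier M" "x' \<in> carrier M" "y \<in> carrier N"
  | (right) x y y' where "r = frag_of (x, y \<oplus>\<^bsub>N\<^esub> y') - frag_of (x, y) - frag_of (x, y')"
      "x \<in> carrier M" "y \<in> carrier N" "y' \<in> carrier N"
  | (balanced) x b y where "r = frag_of (ract M x b, y) - frag_of (x, lact N b y)"
      "x \<in> carrier M" "b \<in> carrier B" "y \<in> carrier N"
  using assms unfolding tensor_rels_def by blast

lemma rels_free: "tensor_rels B M N \<subseteq> carrier (tensor_free M N)"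
proof
  fix r assume "r \<in> tensor_rels B M N"
  then show "r \<in> carrier (tensor_free M N)"
    by (cases rule: tensor_rels_cases)
      (simp_all add: carrier_free keys_diff_subset ract_closed lact_closed)
qed

lemma ker_subgroup: "subgroup ker (tensor_free M N)"
  unfolding tensor_ker_def using group.generate_is_subgroup[OF group_free rels_free] .

lemma ker_keys: "p \<in> ker \<Longrightarrow> Poly_Mapping.keys p \<subseteq> pairs"
  using subgroup.subset[OF ker_subgroup] carrier_free by blast

lemma ker_zero [simp]: "0 \<in> ker"
  using subgroup.one_closed[OF ker_subgroup] by simp

lemma ker_add: "p \<in> ker \<Longrightarrow> q \<in> ker \<Longrightarrow> p + q \<in> ker"
  using subgroup.m_closed[OF ker_subgroup, of p q] by simp

lemma ker_uminus: "p \<in> ker \<Longrightarrow> - p \<in> ker"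
  using subgroup.m_inv_closed[OF ker_subgroup, of p] ker_keys by (simp add: tensor_free_def)

lemma ker_diff: "p \<in> ker \<Longrightarrow> q \<in> ker \<Longrightarrow> p - q \<in> ker"
  using ker_add[of p "- q"] ker_uminus[of q] by simp

lemma rels_ker: "p \<in> tensor_rels B M N \<Longrightarrow> p \<in> ker"
  unfolding tensor_ker_def by (rule generate.incl)

lemma ker_left:
  "x \<in> carrier M \<Longrightarrow> x' \<in> carrier M \<Longrightarrow> y \<in> carrier N \<Longrightarrow>
   frag_of (x \<oplus>\<^bsub>M\<^esub> x', y) - frag_of (x, y) - frag_of (x', y) \<in> ker"
  by (intro rels_ker) (auto simp: tensor_rels_def)

lemma ker_right:
  "x \<in> carrier M \<Longrightarrow> y \<in> carrier N \<Longrightarrow> y' \<in> carrier N \<Longrightarrow>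
   frag_of (x, y \<oplus>\<^bsub>N\<^esub> y') - frag_of (x, y) - frag_of (x, y') \<in> ker"
  by (intro rels_ker) (auto simp: tensor_rels_def)

lemma ker_balanced:
  "x \<in> carrier M \<Longrightarrow> b \<in> carrier B \<Longrightarrow> y \<in> carrier N \<Longrightarrow>
   frag_of (ract M x b, y) - frag_of (x, lact N b y) \<in> ker"
  by (intro rels_ker) (auto simp: tensor_rels_def)

text \<open>Cosets become congruences modulo \<open>ker\<close>, which turns statements about
  tensors into arithmetic of formal sums.\<close>

lemma mem_cls: "q \<in> cls p \<longleftrightarrow> q - p \<in> ker"
proof
  show "q - p \<in> ker" if "q \<in> cls p" using that by (auto simp: cls_def r_coset_def)
  show "q \<in> cls p" if "q - p \<in> ker"
    unfolding cls_def r_coset_def using that by (auto intro!: bexI[of _ "q - p"])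
qed

lemma cls_eq: "cls p = cls q \<longleftrightarrow> p - q \<in> ker"
proof
  show "p - q \<in> ker" if "cls p = cls q"
    using that mem_cls[of p p] by (simp flip: mem_cls)
  show "cls p = cls q" if pq: "p - q \<in> ker"
  proof (intro subset_antisym subsetI)
    show "r \<in> cls q" if "r \<in> cls p" for r
      using that ker_add[OF _ pq, of "r - p"] by (simp add: mem_cls)
    show "r \<in> cls p" if "r \<in> cls q" for r
      using that ker_diff[OF _ pq, of "r - q"] by (simp add: mem_cls)
  qed
qed

lemma cls_add: "cls p <#>\<^bsub>tensor_free M N\<^esub> cls q = cls (p + q)"
proof (intro subset_antisym subsetI)
  show "r \<in> cls (p + q)" if "r \<in> cls p <#>\<^bsub>tensor_free M N\<^esub> cls q" for r
  proof -
    obtain a b where "a - p \<in> ker" "b - q \<in> ker" "r = a + b"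
      using \<open>r \<in> cls p <#>\<^bsub>tensor_free M N\<^esub> cls q\<close> by (auto simp: set_mult_def mem_cls)
    then show ?thesis using ker_add[of "a - p" "b - q"] by (simp add: mem_cls algebra_simps)
  qed
  show "r \<in> cls p <#>\<^bsub>tensor_free M N\<^esub> cls q" if "r \<in> cls (p + q)" for r
  proof -
    have "p \<in> cls p" "r - p \<in> cls q" using that by (simp_all add: mem_cls algebra_simps)
    then show ?thesis by (force simp: set_mult_def)
  qed
qed

lemma tensor_lmodule_simps:
  "carrier (tensor_lmodule \<V> B M N) = cls ` {p. Poly_Mapping.keys p \<subseteq> pairs}"
  "add (tensor_lmodule \<V> B M N) (cls p) (cls q) = cls (p + q)"
  by (auto simp: tensor_lmodule_def Let_def FactGroup_def RCOSETS_def carrier_free cls_add)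
    (auto simp: cls_def)

lemma pure_tensor_cls: "pure_tensor B M N x y = cls (frag_of (x, y))"
  by (simp add: pure_tensor_def cls_def)

lemma pure_tensor_closed:
  "x \<in> carrier M \<Longrightarrow> y \<in> carrier N \<Longrightarrow> pure_tensor B M N x y \<in> carrier (tensor_lmodule \<V> B M N)"
  by (simp add: pure_tensor_cls tensor_lmodule_simps)

lemma pure_tensor_add_left:
  assumes "x \<in> carrier M" "x' \<in> carrier M" "y \<in> carrier N"
  shows "pure_tensor B M N (x \<oplus>\<^bsub>M\<^esub> x') y =
    add (tensor_lmodule \<V> B M N) (pure_tensor B M N x y) (pure_tensor B M N x' y)"
  using ker_left[OF assms]
  by (simp add: pure_tensor_cls tensor_lmodule_simps cls_eq algebra_simps)

lemma pure_tensor_add_right: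
  assumes "x \<in> carrier M" "y \<in> carrier N" "y' \<in> carrier N"
  shows "pure_tensor B M N x (y \<oplus>\<^bsub>N\<^esub> y') =
    add (tensor_lmodule \<V> B M N) (pure_tensor B M N x y) (pure_tensor B M N x y')"
  using ker_right[OF assms]
  by (simp add: pure_tensor_cls tensor_lmodule_simps cls_eq algebra_simps)

lemma pure_tensor_balanced:
  assumes "x \<in> carrier M" "b \<in> carrier B" "y \<in> carrier N"
  shows "pure_tensor B M N (ract M x b) y = pure_tensor B M N x (lact N b y)"
  using ker_balanced[OF assms] by (simp add: pure_tensor_cls cls_eq)

lemma pure_tensor_hcomp:
  assumes "i \<in> degs \<V>" "j \<in> degs \<V>" "x \<in> hcomp M i" "y \<in> hcomp N j"
  shows "pure_tensor B M N x y \<in> hcomp (tensor_lmodule \<V> B M N) (dplus \<V> i j)"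
  using assms by (auto simp: tensor_lmodule_def Let_def intro!: generate.incl)

text \<open>\<open>tensor_map\<close> is a union of cosets over all representatives. If
  \<open>h\<close> sends the relations into \<open>ker\<close>, all these cosets agree and the union
  is a single coset.\<close>

lemma tensor_map_cls:
  assumes h: "\<And>r. r \<in> tensor_rels B M N \<Longrightarrow> frag_extend (\<lambda>s. frag_of (h s)) r \<in> ker"
  shows "tensor_map B M N h (cls p) = cls (frag_extend (\<lambda>s. frag_of (h s)) p)"
proof -
  have K: "frag_extend (\<lambda>s. frag_of (h s)) r \<in> ker" if "r \<in> ker" for r
    using that unfolding tensor_ker_def
  proof (induction rule: generate.induct)
    case (inv r)
    then have "r \<in> carrier (tensor_free M N)" using rels_free by auto
    then have "inv\<^bsub>tensor_free M N\<^esub> r = - r" by (simp add: carrier_free tensor_free_def)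
    then show ?case
      using ker_uminus[OF h[OF inv]] by (simp add: frag_extend_minus tensor_ker_def)
  next
    case (eng r s)
    then show ?case using ker_add by (simp add: frag_extend_add tensor_ker_def)
  qed (use h in \<open>auto simp: generate.one[of "tensor_free M N", simplified] tensor_ker_def\<close>)
  have "cls (frag_extend (\<lambda>s. frag_of (h s)) q) = cls (frag_extend (\<lambda>s. frag_of (h s)) p)"
    if "q \<in> cls p" for q
    using K[of "q - p"] that by (simp add: mem_cls cls_eq frag_extend_diff)
  moreover have "p \<in> cls p" by (simp add: mem_cls)
  ultimately show ?thesis unfolding tensor_map_def cls_def[symmetric] by blast
qed

lemma tensor_map_pure:
  assumes "\<And>r. r \<in> tensor_rels B M N \<Longrightarrow> frag_extend (\<lambda>s. frag_of (h s)) r \<in> ker"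
  shows "tensor_map B M N h (pure_tensor B M N x y) = cls (frag_of (h (x, y)))"
  by (simp add: pure_tensor_cls tensor_map_cls[OF assms])

lemma tensor_map_left:
  assumes f: "add_hom M M f"
    and bal: "\<And>x b. x \<in> carrier M \<Longrightarrow> b \<in> carrier B \<Longrightarrow> f (ract M x b) = ract M (f x) b"
  shows "tensor_map B M N (\<lambda>(x, y). (f x, y)) (pure_tensor B M N x y) = pure_tensor B M N (f x) y"
proof (subst tensor_map_pure)
  fix r assume "r \<in> tensor_rels B M N"
  then show "frag_extend (\<lambda>s. frag_of (case s of (x, y) \<Rightarrow> (f x, y))) r \<in> ker"
    using bal add_hom_add[OF f] add_hom_closed[OF f]
    by (cases rule: tensor_rels_cases)
      (simp_all add: frag_extend_diff ker_left ker_right ker_balanced)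
qed (simp add: pure_tensor_cls)

lemma tensor_map_right:
  assumes f: "add_hom N N f"
    and bal: "\<And>y b. y \<in> carrier N \<Longrightarrow> b \<in> carrier B \<Longrightarrow> f (lact N b y) = lact N b (f y)"
  shows "tensor_map B M N (\<lambda>(x, y). (x, f y)) (pure_tensor B M N x y) = pure_tensor B M N x (f y)"
proof (subst tensor_map_pure)
  fix r assume "r \<in> tensor_rels B M N"
  then show "frag_extend (\<lambda>s. frag_of (case s of (x, y) \<Rightarrow> (x, f y))) r \<in> ker"
    using bal add_hom_add[OF f] add_hom_closed[OF f]
    by (cases rule: tensor_rels_cases)
      (simp_all add: frag_extend_diff ker_left ker_right ker_balanced)
qed (simp add: pure_tensor_cls)

text \<open>The underlying induction on formal sums goes through differences, whereas
  \<open>tensor_lmodule\<close> is used only with its addition. The case \<open>diff\<close>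
  therefore expresses subtraction by addition: \<open>X\<close> is \<open>X + Y\<close> minus
  \<open>Y\<close>.\<close>

lemma tensor_induct [consumes 1, case_names zero diff pure]:
  assumes X: "X \<in> carrier (tensor_lmodule \<V> B M N)" and "P (cls 0)"
    and diff: "\<And>X Y. X \<in> carrier (tensor_lmodule \<V> B M N) \<Longrightarrow> Y \<in> carrier (tensor_lmodule \<V> B M N) \<Longrightarrow>
      P (add (tensor_lmodule \<V> B M N) X Y) \<Longrightarrow> P Y \<Longrightarrow> P X"
    and pure: "\<And>x y. x \<in> carrier M \<Longrightarrow> y \<in> carrier N \<Longrightarrow> P (pure_tensor B M N x y)"
  shows "P X"
proof -
  obtain p where p: "Poly_Mapping.keys p \<subseteq> pairs" "X = cls p"
    using X by (auto simp: tensor_lmodule_simps)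
  have "P (cls p)"
  proof (rule free_Abelian_group_induct[OF p(1)])
    fix p q :: "'m \<times> 'n \<Rightarrow>\<^sub>0 int"
    assume pq: "Poly_Mapping.keys p \<subseteq> pairs" "Poly_Mapping.keys q \<subseteq> pairs" "P (cls p)" "P (cls q)"
    then have "cls (p - q) \<in> carrier (tensor_lmodule \<V> B M N)" "cls q \<in> carrier (tensor_lmodule \<V> B M N)"
      using keys_diff_subset[OF pq(1,2)] by (auto simp: tensor_lmodule_simps)
    then show "P (cls (p - q))"
      by (rule diff) (use pq in \<open>simp_all add: tensor_lmodule_simps\<close>)
  qed (use assms in \<open>auto simp: pure_tensor_cls\<close>)
  then show ?thesis using p by simp
qed

lemma hom_zero:
  assumes "abelian_group Z" "add_hom (tensor_lmodule \<V> B M N) Z f"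
  shows "f (cls 0) = \<zero>\<^bsub>Z\<^esub>"
proof -
  interpret Z: abelian_group Z by fact
  have "cls 0 \<in> carrier (tensor_lmodule \<V> B M N)" by (auto simp: tensor_lmodule_simps)
  then show ?thesis
    using add_hom_add[OF assms(2), of "cls 0" "cls 0"] add_hom_closed[OF assms(2), of "cls 0"]
    by (simp add: tensor_lmodule_simps)
qed

text \<open>This removes the tensor product from two places: the trace ideals become spans of the
  values of \<open>\<eta>\<close> and \<open>\<rho>\<close> on pure tensors, and the module induced
  by the context becomes a span of explicit functions.\<close>

lemma hom_span:
  assumes Z: "abelian_group Z" and f: "add_hom (tensor_lmodule \<V> B M N) Z f"
  shows "f ` carrier (tensor_lmodule \<V> B M N) =
    add_span Z {f (pure_tensor B M N x y) |x y. x \<in> carrier M \<and> y \<in> carrier N}" (is "?L = add_span Z ?S")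
proof
  interpret Z: abelian_group Z by fact
  have S: "?S \<subseteq> carrier Z" using add_hom_closed[OF f pure_tensor_closed] by auto
  note sg = Z.add_span_subgroup[OF S]
  have "f X \<in> add_span Z ?S" if "X \<in> carrier (tensor_lmodule \<V> B M N)" for X
    using that
  proof (induction X rule: tensor_induct)
    case zero
    show ?case using hom_zero[OF Z f] Z.add_subgroupD(2)[OF sg] by simp
  next
    case (diff X Y)
    have "f X = (f X \<oplus>\<^bsub>Z\<^esub> f Y) \<ominus>\<^bsub>Z\<^esub> f Y"
      using diff(1,2) add_hom_closed[OF f] by (simp add: a_minus_def Z.a_assoc Z.r_neg)
    then show ?case
      using diff add_hom_add[OF f] Z.add_subgroupD(5)[OF sg, of "f X \<oplus>\<^bsub>Z\<^esub> f Y" "f Y"] by simp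
  next
    case (pure x y)
    then show ?case by (intro generate.incl) auto
  qed
  then show "?L \<subseteq> add_span Z ?S" by auto
  have "add_subgroup Z ?L"
  proof (rule Z.add_subgroupI)
    show "?L \<subseteq> carrier Z" using add_hom_closed[OF f] by auto
    show "\<zero>\<^bsub>Z\<^esub> \<in> ?L"
      using hom_zero[OF Z f] by (intro image_eqI[of _ _ "cls 0"]) (auto simp: tensor_lmodule_simps)
    show "\<ominus>\<^bsub>Z\<^esub> u \<in> ?L" if "u \<in> ?L" for u
    proof -
      obtain p where p: "Poly_Mapping.keys p \<subseteq> pairs" "u = f (cls p)"
        using \<open>u \<in> ?L\<close> by (auto simp: tensor_lmodule_simps)
      have c: "cls (- p) \<in> carrier (tensor_lmodule \<V> B M N)" "cls p \<in> carrier (tensor_lmodule \<V> B M N)"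
        using p by (auto simp: tensor_lmodule_simps intro!: image_eqI[of _ _ "- p"])
      have "f (cls (- p)) \<oplus>\<^bsub>Z\<^esub> u = \<zero>\<^bsub>Z\<^esub>"
        using add_hom_add[OF f c] p hom_zero[OF Z f] by (simp add: tensor_lmodule_simps)
      then have "\<ominus>\<^bsub>Z\<^esub> u = f (cls (- p))"
        using c p add_hom_closed[OF f] by (intro Z.minus_equality) auto
      then show ?thesis using c by auto
    qed
    show "u \<oplus>\<^bsub>Z\<^esub> v \<in> ?L" if "u \<in> ?L" "v \<in> ?L" for u v
    proof -
      obtain p where p: "Poly_Mapping.keys p \<subseteq> pairs" "u = f (cls p)"
        using \<open>u \<in> ?L\<close> by (auto simp: tensor_lmodule_simps)
      obtain q where q: "Poly_Mapping.keys q \<subseteq> pairs" "v = f (cls q)"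
        using \<open>v \<in> ?L\<close> by (auto simp: tensor_lmodule_simps)
      have "u \<oplus>\<^bsub>Z\<^esub> v = f (cls (p + q))"
        using add_hom_add[OF f, of "cls p" "cls q"] p q by (simp add: tensor_lmodule_simps)
      then show ?thesis
        using keys_add_subset[OF p(1) q(1)] by (auto simp: tensor_lmodule_simps)
    qed
  qed
  then show "add_span Z ?S \<subseteq> ?L"
    by (rule Z.add_span_incl[rotated]) (use pure_tensor_closed in auto)
qed

section \<open>Maps induced by balanced biadditive maps\<close>

context
  fixes Z :: "('g, 'v) ring_scheme" and g :: "'m \<times> 'n \<Rightarrow> 'g"
  assumes Z: "abelian_group Z"
    and g_left: "\<And>y. y \<in> carrier N \<Longrightarrow> add_hom M Z (\<lambda>x. g (x, y))"
    and g_right: "\<And>x. x \<in> carrier M \<Longrightarrow> add_hom N Z (\<lambda>y. g (x, y))"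
    and g_bal: "\<And>x b y. x \<in> carrier M \<Longrightarrow> b \<in> carrier B \<Longrightarrow> y \<in> carrier N \<Longrightarrow>
      g (ract M x b, y) = g (x, lact N b y)"
begin

interpretation Z: abelian_group Z by (rule Z)

text \<open>The expression that \<open>tensor_lift\<close> evaluates on one representative of a
  class.\<close>

definition free_lift :: "('m \<times> 'n \<Rightarrow>\<^sub>0 int) \<Rightarrow> 'g" where
  "free_lift p = (\<Oplus>\<^bsub>Z\<^esub>s\<in>Poly_Mapping.keys p. [Poly_Mapping.lookup p s] \<cdot>\<^bsub>Z\<^esub> g s)"

lemma g_closed: "s \<in> pairs \<Longrightarrow> g s \<in> carrier Z"
  using add_hom_closed[OF g_left] by auto

text \<open>Terms with coefficient zero vanish, so the sum may run over any larger finite set of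
  pairs; this gives two formal sums a common index set.\<close>

lemma free_lift_superset:
  assumes "finite S" "Poly_Mapping.keys p \<subseteq> S" "S \<subseteq> pairs"
  shows "free_lift p = (\<Oplus>\<^bsub>Z\<^esub>s\<in>S. [Poly_Mapping.lookup p s] \<cdot>\<^bsub>Z\<^esub> g s)"
proof -
  have "[(0 :: int)] \<cdot>\<^bsub>Z\<^esub> z = \<zero>\<^bsub>Z\<^esub>" for z by (simp add: add_pow_def)
  then show ?thesis
    unfolding free_lift_def using assms g_closed
    by (intro Z.add.finprod_mono_neutral_cong_left) (auto simp: in_keys_iff)
qed

lemma free_lift_closed: "Poly_Mapping.keys p \<subseteq> pairs \<Longrightarrow> free_lift p \<in> carrier Z"
  unfolding free_lift_def using g_closed by (intro Z.finsum_closed) auto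

lemma free_lift_add:
  assumes "Poly_Mapping.keys p \<subseteq> pairs" "Poly_Mapping.keys q \<subseteq> pairs"
  shows "free_lift (p + q) = free_lift p \<oplus>\<^bsub>Z\<^esub> free_lift q"
proof -
  let ?S = "Poly_Mapping.keys p \<union> Poly_Mapping.keys q"
  have S: "finite ?S" "?S \<subseteq> pairs" using assms by auto
  have "free_lift (p + q) = (\<Oplus>\<^bsub>Z\<^esub>s\<in>?S. [Poly_Mapping.lookup (p + q) s] \<cdot>\<^bsub>Z\<^esub> g s)"
    by (rule free_lift_superset[OF S(1) keys_add S(2)])
  also have "\<dots> = (\<Oplus>\<^bsub>Z\<^esub>s\<in>?S. [Poly_Mapping.lookup p s] \<cdot>\<^bsub>Z\<^esub> g s \<oplus>\<^bsub>Z\<^esub> [Poly_Mapping.lookup q s] \<cdot>\<^bsub>Z\<^esub> g s)"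
  proof (rule Z.finsum_cong')
    show "[Poly_Mapping.lookup (p + q) s] \<cdot>\<^bsub>Z\<^esub> g s =
        [Poly_Mapping.lookup p s] \<cdot>\<^bsub>Z\<^esub> g s \<oplus>\<^bsub>Z\<^esub> [Poly_Mapping.lookup q s] \<cdot>\<^bsub>Z\<^esub> g s" if "s \<in> ?S" for s
      using Z.add.int_pow_mult[OF g_closed, of s] that S by (auto simp: lookup_add)
  qed (use S g_closed in auto)
  also have "\<dots> = free_lift p \<oplus>\<^bsub>Z\<^esub> free_lift q"
    using S g_closed free_lift_superset[OF S(1) _ S(2)] by (subst Z.finsum_addf) auto
  finally show ?thesis .
qed

lemma free_lift_of: "s \<in> pairs \<Longrightarrow> free_lift (frag_of s) = g s"
  using g_closed[of s] by (simp add: free_lift_def Z.finsum_insert Z.add.int_pow_1)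

lemma free_lift_zero: "free_lift 0 = \<zero>\<^bsub>Z\<^esub>"
  by (simp add: free_lift_def)

lemma free_lift_diff:
  assumes "Poly_Mapping.keys p \<subseteq> pairs" "Poly_Mapping.keys q \<subseteq> pairs"
  shows "free_lift (p - q) = free_lift p \<ominus>\<^bsub>Z\<^esub> free_lift q"
proof -
  have "free_lift p = free_lift (p - q) \<oplus>\<^bsub>Z\<^esub> free_lift q"
    using free_lift_add[OF keys_diff_subset[OF assms] assms(2)] by simp
  then show ?thesis
    using free_lift_closed[OF keys_diff_subset[OF assms]] free_lift_closed[OF assms(2)]
    by (simp add: a_minus_def Z.a_assoc Z.r_neg)
qed

lemma free_lift_rels: "r \<in> tensor_rels B M N \<Longrightarrow> free_lift r = \<zero>\<^bsub>Z\<^esub>"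
proof -
  have sub: "u \<oplus>\<^bsub>Z\<^esub> v \<ominus>\<^bsub>Z\<^esub> u \<ominus>\<^bsub>Z\<^esub> v = \<zero>\<^bsub>Z\<^esub>" "u \<ominus>\<^bsub>Z\<^esub> u = \<zero>\<^bsub>Z\<^esub>"
    if "u \<in> carrier Z" "v \<in> carrier Z" for u v
    using that by (simp_all add: a_minus_def Z.r_neg) (metis Z.a_assoc Z.a_comm Z.a_inv_closed Z.a_closed Z.r_neg Z.r_zero)
  assume "r \<in> tensor_rels B M N"
  then show ?thesis
  proof (cases rule: tensor_rels_cases)
    case (left x x' y)
    then show ?thesis
      using add_hom_add[OF g_left[of y], of x x'] g_closed[of "(x, y)"] g_closed[of "(x', y)"]
      by (simp add: free_lift_diff keys_diff_subset free_lift_of sub)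
  next
    case (right x y y')
    then show ?thesis
      using add_hom_add[OF g_right[of x], of y y'] g_closed[of "(x, y)"] g_closed[of "(x, y')"]
      by (simp add: free_lift_diff keys_diff_subset free_lift_of sub)
  next
    case (balanced x b y)
    then show ?thesis
      using g_bal[of x b y] g_closed[of "(x, lact N b y)"]
      by (simp add: free_lift_diff free_lift_of ract_closed lact_closed sub)
  qed
qed

lemma free_lift_ker:
  assumes "p \<in> ker"
  shows "free_lift p = \<zero>\<^bsub>Z\<^esub>"
  using assms unfolding tensor_ker_def
proof (induction rule: generate.induct)
  case (inv r)
  then have r: "Poly_Mapping.keys r \<subseteq> pairs" using rels_free carrier_free by auto
  then have "inv\<^bsub>tensor_free M N\<^esub> r = 0 - r" by (simp add: tensor_free_def)
  then show ?case
    using free_lift_diff[of 0 r] r free_lift_rels[OF inv] by (simp add: free_lift_zero a_minus_def)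
next
  case (eng p q)
  then show ?case
    using ker_keys[of p] ker_keys[of q] free_lift_add by (simp add: tensor_ker_def)
qed (auto simp: free_lift_zero free_lift_rels)

text \<open>\<open>the_elem\<close> in \<open>tensor_lift\<close> is meaningful only if all
  representatives give one value. They do, because the lift vanishes on \<open>ker\<close>.\<close>

lemma tensor_lift_cls:
  assumes p: "Poly_Mapping.keys p \<subseteq> pairs"
  shows "tensor_lift Z g (cls p) = free_lift p"
proof -
  have "free_lift q = free_lift p" if q: "q \<in> cls p" for q
  proof -
    have k: "q - p \<in> ker" using q by (simp add: mem_cls)
    have "free_lift ((q - p) + p) = free_lift (q - p) \<oplus>\<^bsub>Z\<^esub> free_lift p"
      by (rule free_lift_add[OF ker_keys[OF k] p])
    then show ?thesis using free_lift_ker[OF k] free_lift_closed[OF p] by simp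
  qed
  moreover have "p \<in> cls p" by (simp add: mem_cls)
  ultimately have "free_lift ` cls p = {free_lift p}" by blast
  then show ?thesis by (simp add: tensor_lift_def free_lift_def[abs_def])
qed

lemma tensor_lift_add_hom: "add_hom (tensor_lmodule \<V> B M N) Z (tensor_lift Z g)"
  by (intro add_homI)
    (auto simp: tensor_lmodule_simps tensor_lift_cls free_lift_closed free_lift_add keys_add_subset)

lemma tensor_lift_pure:
  "x \<in> carrier M \<Longrightarrow> y \<in> carrier N \<Longrightarrow> tensor_lift Z g (pure_tensor B M N x y) = g (x, y)"
  by (simp add: pure_tensor_cls tensor_lift_cls free_lift_of)

end

end

section \<open>Quotient algebras and Morita contexts\<close>

text \<open>\<open>quot_algebra\<close> copies the fields of a quotient ring into a record of
  another type, so the group laws have to be carried over field by field.\<close>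

lemma abelian_group_cong:
  assumes "carrier X = carrier Y" "\<zero>\<^bsub>X\<^esub> = \<zero>\<^bsub>Y\<^esub>" "add X = add Y" "abelian_group X"
  shows "abelian_group Y"
proof -
  interpret X: abelian_group X by fact
  show ?thesis
  proof (rule abelian_groupI)
    show "\<exists>y\<in>carrier Y. y \<oplus>\<^bsub>Y\<^esub> x = \<zero>\<^bsub>Y\<^esub>" if "x \<in> carrier Y" for x
        using that X.l_neg[of x] X.a_inv_closed[of x] unfolding assms(1-3)[symmetric] by blast
  qed (simp_all add: X.a_ac flip: assms(1-3))
qed

locale algebra_ideal = A: ring A + I: ideal I A
  for A :: "('k, 'a) vobj" and I :: "'a set" and \<V> and k :: "'k ring" +
  assumes valgebra: "valgebra \<V> k A"
begin

sublocale AV: vspace k A \<V>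
  using valgebra by (intro vspaceI) (simp add: valgebra_def)

abbreviation "Q \<equiv> quot_algebra A I"
abbreviation "cs \<equiv> (+>\<^bsub>A\<^esub>) I"

lemma quot_abelian: "abelian_group Q"
proof -
  interpret Q: ring "A Quot I" by (rule I.quotient_is_ring)
  show ?thesis
    by (rule abelian_group_cong[OF _ _ _ Q.is_abelian_group]) (simp_all add: quot_algebra_def)
qed

lemma I_carrier: "I \<subseteq> carrier A" by (rule I.a_subset)

lemma coset_eq_iff: "a \<in> carrier A \<Longrightarrow> b \<in> carrier A \<Longrightarrow> cs a = cs b \<longleftrightarrow> (\<exists>i\<in>I. a = i \<oplus>\<^bsub>A\<^esub> b)"
proof
  assume ab: "a \<in> carrier A" "b \<in> carrier A"
  show "\<exists>i\<in>I. a = i \<oplus>\<^bsub>A\<^esub> b" if "cs a = cs b"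
    using I.a_rcos_self[OF ab(1)] that by (auto simp: a_r_coset_def r_coset_def)
  show "cs a = cs b" if "\<exists>i\<in>I. a = i \<oplus>\<^bsub>A\<^esub> b"
  proof -
    have "a \<in> cs b" using that by (auto simp: a_r_coset_def r_coset_def)
    then show ?thesis
      using A.a_repr_independence[OF _ ab(2) I.a_subgroup] by simp
  qed
qed

lemma quot_carrier: "carrier Q = cs ` carrier A"
  by (auto simp: quot_algebra_def FactRing_simps)

lemma coset_closed [simp]: "a \<in> carrier A \<Longrightarrow> cs a \<in> carrier Q"
  by (simp add: quot_carrier)

lemma coset_add: "a \<in> carrier A \<Longrightarrow> b \<in> carrier A \<Longrightarrow> cs (a \<oplus>\<^bsub>A\<^esub> b) = cs a \<oplus>\<^bsub>Q\<^esub> cs b"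
  by (simp add: quot_algebra_def FactRing_def I.a_rcos_sum)

lemma coset_mult: "a \<in> carrier A \<Longrightarrow> b \<in> carrier A \<Longrightarrow> cs (a \<otimes>\<^bsub>A\<^esub> b) = cs a \<otimes>\<^bsub>Q\<^esub> cs b"
  by (simp add: quot_algebra_def FactRing_def I.rcoset_mult_add)

lemma coset_one: "cs \<one>\<^bsub>A\<^esub> = \<one>\<^bsub>Q\<^esub>"
  by (simp add: quot_algebra_def FactRing_def)

lemma coset_zero: "a \<in> I \<Longrightarrow> cs a = \<zero>\<^bsub>Q\<^esub>"
  using I.a_rcos_const by (simp add: quot_algebra_def FactRing_def)

lemma coset_add_hom: "add_hom A Q cs"
  by (intro add_homI) (auto simp: coset_add)

text \<open>The identity \<open>c i = (c 1) i\<close> reduces stability under \<open>k\<close> to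
  the ideal property.\<close>

lemma I_smult: "c \<in> carrier k \<Longrightarrow> i \<in> I \<Longrightarrow> c \<odot>\<^bsub>A\<^esub> i \<in> I"
proof -
  assume c: "c \<in> carrier k" and i: "i \<in> I"
  then have "i \<in> carrier A" using I_carrier by auto
  then have "(c \<odot>\<^bsub>A\<^esub> \<one>\<^bsub>A\<^esub>) \<otimes>\<^bsub>A\<^esub> i = c \<odot>\<^bsub>A\<^esub> i"
    using valgebra c by (simp add: valgebra_def)
  then show ?thesis
    using I.I_l_closed[OF i AV.smult_closed[OF c A.one_closed]] by simp
qed

lemma coset_smult:
  assumes c: "c \<in> carrier k" and a: "a \<in> carrier A"
  shows "cs (c \<odot>\<^bsub>A\<^esub> a) = c \<odot>\<^bsub>Q\<^esub> cs a"
proof -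
  \<comment> \<open>Scalar multiplication on the quotient is a union over representatives; all
    cosets in this union coincide because \<open>c\<close> keeps \<open>I\<close> stable.\<close>
  have "cs (c \<odot>\<^bsub>A\<^esub> x) = cs (c \<odot>\<^bsub>A\<^esub> a)" if x: "x \<in> cs a" for x
  proof -
    obtain i where i: "i \<in> I" "x = i \<oplus>\<^bsub>A\<^esub> a" using x by (auto simp: a_r_coset_def r_coset_def)
    then have iA: "i \<in> carrier A" using I_carrier by auto
    then have "c \<odot>\<^bsub>A\<^esub> x = c \<odot>\<^bsub>A\<^esub> i \<oplus>\<^bsub>A\<^esub> c \<odot>\<^bsub>A\<^esub> a"
      using i a c by (simp add: AV.smult_r_distr)
    then show ?thesis
      using coset_eq_iff[of "c \<odot>\<^bsub>A\<^esub> x" "c \<odot>\<^bsub>A\<^esub> a"] I_smult[OF c i(1)] c a iA i by auto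
  qed
  then have "(\<Union>x\<in>cs a. cs (c \<odot>\<^bsub>A\<^esub> x)) = cs (c \<odot>\<^bsub>A\<^esub> a)"
    using I.a_rcos_self[OF a] by blast
  then show ?thesis by (simp add: quot_algebra_def)
qed

lemma quot_hcomp: "hcomp Q i = cs ` hcomp A i"
  by (simp add: quot_algebra_def)

lemma coset_hcomp: "a \<in> hcomp A i \<Longrightarrow> cs a \<in> hcomp Q i"
  by (simp add: quot_hcomp)

end

lemma algebra_idealI: "valgebra \<V> k A \<Longrightarrow> ideal I A \<Longrightarrow> algebra_ideal A I \<V> k"
  by (simp add: algebra_ideal_def algebra_ideal_axioms_def valgebra_def)

lemma vobject_cong:
  assumes "carrier X = carrier Y" "\<zero>\<^bsub>X\<^esub> = \<zero>\<^bsub>Y\<^esub>" "add X = add Y" "smult X = smult Y" "hcomp X = hcomp Y"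
    and "vobject \<V> k X"
  shows "vobject \<V> k Y"
proof -
  have fs: "finsum X f S = finsum Y f S" for f and S :: "int set"
    using assms by (simp add: finsum_def finprod_def)
  have "abelian_group X" using assms(6) by (simp add: vobject_def module_def)
  note ab = abelian_group_cong[OF assms(1-3) this]
  have "module k X" using assms(6) by (simp add: vobject_def)
  then have "module k Y"
    using ab assms(1-4) by (simp add: module_def module_axioms_def)
  moreover have "submodule U k Y \<longleftrightarrow> submodule U k X" for U
    using assms by (simp add: submodule_def submodule_axioms_def subgroup_def m_inv_def)
  moreover have "homog_decomp \<V> Y v f \<longleftrightarrow> homog_decomp \<V> X v f" for v f
    using assms(2,5) by (simp add: homog_decomp_def fs)
  ultimately show ?thesis
    using assms(1,5,6) by (simp add: vobject_def)
qed

lemma inflate_simps [simp]: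
  "carrier (inflate A I B J M) = carrier M" "\<zero>\<^bsub>inflate A I B J M\<^esub> = \<zero>\<^bsub>M\<^esub>"
  "add (inflate A I B J M) = add M" "smult (inflate A I B J M) = smult M"
  "hcomp (inflate A I B J M) = hcomp M"
  "lact (inflate A I B J M) = (\<lambda>a. lact M (I +>\<^bsub>A\<^esub> a))"
  "ract (inflate A I B J M) = (\<lambda>x b. ract M x (J +>\<^bsub>B\<^esub> b))"
  by (simp_all add: inflate_def)

lemma inflate_bimodule:
  assumes "algebra_ideal A I \<V> k" "algebra_ideal B J \<V> k"
    and M: "is_bimodule \<V> k (quot_algebra A I) (quot_algebra B J) M"
  shows "is_bimodule \<V> k A B (inflate A I B J M)"
proof -
  interpret AI: algebra_ideal A I \<V> k by fact
  interpret BJ: algebra_ideal B J \<V> k by fact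
  have L: "left_module \<V> k AI.Q M" and R: "right_module \<V> k BJ.Q M"
    and LR: "\<And>a x b. a \<in> carrier A \<Longrightarrow> x \<in> carrier M \<Longrightarrow> b \<in> carrier B \<Longrightarrow>
      ract M (lact M (AI.cs a) x) (BJ.cs b) = lact M (AI.cs a) (ract M x (BJ.cs b))"
    using M by (auto simp: is_bimodule_def)
  have vob: "vobject \<V> k (inflate A I B J M)"
    by (rule vobject_cong[of M]) (use L in \<open>auto simp: left_module_def\<close>)
  have "left_module \<V> k A (inflate A I B J M)"
    using L vob unfolding left_module_def
    by (simp add: AI.coset_add AI.coset_mult AI.coset_one AI.coset_smult AI.coset_hcomp)
  moreover have "right_module \<V> k B (inflate A I B J M)"
    using R vob unfolding right_module_def
    by (simp add: BJ.coset_add BJ.coset_mult BJ.coset_one BJ.coset_smult BJ.coset_hcomp)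
  ultimately show ?thesis using LR by (simp add: is_bimodule_def)
qed

lemma tensor_bimodule_simps [simp]:
  "carrier (tensor_bimodule \<V> B M N) = carrier (tensor_lmodule \<V> B M N)"
  "add (tensor_bimodule \<V> B M N) = add (tensor_lmodule \<V> B M N)"
  "hcomp (tensor_bimodule \<V> B M N) = hcomp (tensor_lmodule \<V> B M N)"
  "lact (tensor_bimodule \<V> B M N) a = tensor_map B M N (\<lambda>(x, y). (lact M a x, y))"
  "ract (tensor_bimodule \<V> B M N) X c = tensor_map B M N (\<lambda>(x, y). (x, ract N y c)) X"
  by (simp_all add: tensor_bimodule_def tensor_lmodule_def Let_def lmodule.defs bimodule.defs)

lemma regular_bimodule_simps [simp]:
  "carrier (regular_bimodule A) = carrier A" "add (regular_bimodule A) = add A"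
  "hcomp (regular_bimodule A) = hcomp A" "lact (regular_bimodule A) = mult A"
  "ract (regular_bimodule A) = mult A"
  by (simp_all add: regular_bimodule_def)

lemma bimodule_tensor:
  assumes "is_bimodule \<V> k A B M" "left_module \<V> k B N"
  shows "tensor B M N"
  using assms
  by (auto simp: tensor_def is_bimodule_def left_module_def right_module_def vobject_def module_def)

text \<open>The map \<open>\<eta>\<close> of a Morita context is recorded by representatives of the residue classes \<open>\<eta>(x \<otimes> y)\<close>.\<close>

definition repr ::
  "('k, 'a) vobj \<Rightarrow> 'a set \<Rightarrow> ('k, 'b set) vobj \<Rightarrow> ('k, 'a set, 'b set, 'm) bimodule \<Rightarrow>
   ('k, 'b set, 'a set, 'n) bimodule \<Rightarrow> (('m \<times> 'n \<Rightarrow>\<^sub>0 int) set \<Rightarrow> 'a set) \<Rightarrow> 'm \<Rightarrow> 'n \<Rightarrow> 'a" where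
  "repr A I Q M N \<eta> x y = (SOME a. a \<in> carrier A \<and> I +>\<^bsub>A\<^esub> a = \<eta> (pure_tensor Q M N x y))"

text \<open>One map is treated at a time, so that the locale serves \<open>\<eta>\<close> and, with
  the roles of \<open>A\<close> and \<open>B\<close> exchanged, \<open>\<rho>\<close>. The
  associativity laws connecting them enter in \<open>context_data\<close>.\<close>

locale half_context_data = AI: algebra_ideal A I \<V> k + BJ: algebra_ideal B J \<V> k
  for A :: "('k, 'a) vobj" and I and B :: "('k, 'b) vobj" and J and \<V> and k :: "'k ring" +
  fixes M :: "('k, 'a set, 'b set, 'm) bimodule" and N :: "('k, 'b set, 'a set, 'n) bimodule"
    and \<eta> :: "('m \<times> 'n \<Rightarrow>\<^sub>0 int) set \<Rightarrow> 'a set"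
  assumes M: "is_bimodule \<V> k AI.Q BJ.Q M" and N: "is_bimodule \<V> k BJ.Q AI.Q N"
    and \<eta>: "bimod_hom \<V> k AI.Q AI.Q (tensor_bimodule \<V> BJ.Q M N) (regular_bimodule AI.Q) \<eta>"
begin

sublocale T: tensor BJ.Q M N
  using M N by (intro bimodule_tensor) (auto simp: is_bimodule_def)

abbreviation "pure \<equiv> pure_tensor BJ.Q M N"
abbreviation "e \<equiv> repr A I BJ.Q M N \<eta>"

lemma \<eta>_add_hom: "add_hom (tensor_lmodule \<V> BJ.Q M N) AI.Q \<eta>"
  using \<eta> by (auto simp: bimod_hom_def lmod_hom_def lmod_linear_def add_hom_def)

lemma e:
  assumes "x \<in> carrier M" "y \<in> carrier N"
  shows "e x y \<in> carrier A" "AI.cs (e x y) = \<eta> (pure x y)"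
proof -
  have "\<eta> (pure x y) \<in> carrier AI.Q"
    using add_hom_closed[OF \<eta>_add_hom T.pure_tensor_closed[OF assms]] .
  then have "\<exists>a. a \<in> carrier A \<and> AI.cs a = \<eta> (pure x y)" unfolding AI.quot_carrier by auto
  from someI_ex[OF this] show "e x y \<in> carrier A" "AI.cs (e x y) = \<eta> (pure x y)"
    by (auto simp: repr_def)
qed

lemma lactM_hom: "q \<in> carrier AI.Q \<Longrightarrow> add_hom M M (lact M q)"
  using M by (intro add_homI) (auto simp: is_bimodule_def left_module_def)

lemma ractN_hom: "q \<in> carrier AI.Q \<Longrightarrow> add_hom N N (\<lambda>y. ract N y q)"
  using N by (intro add_homI) (auto simp: is_bimodule_def right_module_def)

lemma \<eta>_left:
  assumes "q \<in> carrier AI.Q" "x \<in> carrier M" "y \<in> carrier N"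
  shows "\<eta> (pure (lact M q x) y) = q \<otimes>\<^bsub>AI.Q\<^esub> \<eta> (pure x y)"
proof -
  have "tensor_map BJ.Q M N (\<lambda>(x, y). (lact M q x, y)) (pure x y) = pure (lact M q x) y"
    by (rule T.tensor_map_left[OF lactM_hom]) (use assms M in \<open>auto simp: is_bimodule_def\<close>)
  then show ?thesis
    using lmod_hom_act[of \<V> k AI.Q "tensor_bimodule \<V> BJ.Q M N" "regular_bimodule AI.Q" \<eta> q "pure x y"]
      \<eta> assms T.pure_tensor_closed[OF assms(2,3), of \<V>] by (simp add: bimod_hom_def)
qed

lemma \<eta>_right:
  assumes "q \<in> carrier AI.Q" "x \<in> carrier M" "y \<in> carrier N"
  shows "\<eta> (pure x (ract N y q)) = \<eta> (pure x y) \<otimes>\<^bsub>AI.Q\<^esub> q"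
proof -
  have "tensor_map BJ.Q M N (\<lambda>(x, y). (x, ract N y q)) (pure x y) = pure x (ract N y q)"
    by (rule T.tensor_map_right[OF ractN_hom]) (use assms N in \<open>auto simp: is_bimodule_def\<close>)
  moreover have "\<eta> (ract (tensor_bimodule \<V> BJ.Q M N) (pure x y) q) =
      ract (regular_bimodule AI.Q) (\<eta> (pure x y)) q"
    using \<eta> assms(1) T.pure_tensor_closed[OF assms(2,3), of \<V>]
    unfolding bimod_hom_def tensor_bimodule_simps(1) by blast
  ultimately show ?thesis by simp
qed

lemma \<eta>_hcomp:
  assumes "i \<in> degs \<V>" "j \<in> degs \<V>" "x \<in> hcomp M i" "y \<in> hcomp N j"
  shows "\<eta> (pure x y) \<in> hcomp AI.Q (dplus \<V> i j)"
  using \<eta> T.pure_tensor_hcomp[OF assms] dplus_degs[OF assms(1,2)]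
  by (auto simp: bimod_hom_def lmod_hom_def)

lemma M_add_closed: "x \<in> carrier M \<Longrightarrow> x' \<in> carrier M \<Longrightarrow> x \<oplus>\<^bsub>M\<^esub> x' \<in> carrier M"
  using abelian_monoid.a_closed[OF abelian_group.axioms(1)[OF T.abM]] by blast

lemma N_add_closed: "x \<in> carrier N \<Longrightarrow> x' \<in> carrier N \<Longrightarrow> x \<oplus>\<^bsub>N\<^esub> x' \<in> carrier N"
  using abelian_monoid.a_closed[OF abelian_group.axioms(1)[OF T.abN]] by blast

lemma acts_closed:
  "q \<in> carrier AI.Q \<Longrightarrow> x \<in> carrier M \<Longrightarrow> lact M q x \<in> carrier M"
  "q \<in> carrier AI.Q \<Longrightarrow> y \<in> carrier N \<Longrightarrow> ract N y q \<in> carrier N"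
  using add_hom_closed[OF lactM_hom] add_hom_closed[OF ractN_hom] by blast+

lemma half_context: "half_context \<V> k A B I (inflate A I B J M) (inflate B J A I N) e"
proof (rule half_context.intro)
  show "valgebra \<V> k A" "valgebra \<V> k B" "ideal I A"
    by (fact AI.valgebra BJ.valgebra AI.I.ideal_axioms)+
  show "is_bimodule \<V> k A B (inflate A I B J M)" "is_bimodule \<V> k B A (inflate B J A I N)"
    by (rule inflate_bimodule[OF AI.algebra_ideal_axioms BJ.algebra_ideal_axioms M]
        inflate_bimodule[OF BJ.algebra_ideal_axioms AI.algebra_ideal_axioms N])+
  show "lact (inflate A I B J M) a x = \<zero>\<^bsub>inflate A I B J M\<^esub>"
    if a: "a \<in> I" and x: "x \<in> carrier (inflate A I B J M)" for a x
  proof -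
    interpret M: abelian_group M by (rule T.abM)
    have aA: "a \<in> carrier A" using a AI.I_carrier by auto
    \<comment> \<open>The class of \<open>a\<close> equals its own double, so
      \<open>z + z = z\<close> for its value \<open>z\<close> on \<open>x\<close>, and hence
      \<open>z\<close> is zero.\<close>
    have "lact M (AI.cs a \<oplus>\<^bsub>AI.Q\<^esub> AI.cs a) x = lact M (AI.cs a) x \<oplus>\<^bsub>M\<^esub> lact M (AI.cs a) x"
      using M x aA by (simp add: is_bimodule_def left_module_def)
    moreover have "AI.cs a \<oplus>\<^bsub>AI.Q\<^esub> AI.cs a = AI.cs a"
      using AI.coset_zero[of a] AI.coset_zero[of "a \<oplus>\<^bsub>A\<^esub> a"] AI.coset_add[OF aA aA] a by simp
    moreover have "lact M (AI.cs a) x \<in> carrier M"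
      using acts_closed x aA by simp
    ultimately show ?thesis by simp
  qed
  show "\<exists>a\<in>hcomp A (dplus \<V> i j). AI.cs (e x y) = AI.cs a"
    if "i \<in> degs \<V>" "j \<in> degs \<V>" "x \<in> hcomp (inflate A I B J M) i" "y \<in> hcomp (inflate B J A I N) j"
    for i j x y
  proof -
    have "x \<in> carrier M" "y \<in> carrier N"
      using that M N by (auto simp: is_bimodule_def left_module_def intro: vspace.hcomp_carrier[OF vspaceI])
    then show ?thesis
      using \<eta>_hcomp[of i j x y] that by (auto simp: e AI.quot_hcomp)
  qed
qed (simp_all add: e AI.coset_add AI.coset_mult \<eta>_left \<eta>_right acts_closed T.pure_tensor_balanced
    T.ract_closed T.lact_closed M_add_closed N_add_closed
    T.pure_tensor_add_left[where \<V> = \<V>] T.pure_tensor_add_right[where \<V> = \<V>]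
    add_hom_add[OF \<eta>_add_hom] T.pure_tensor_closed)

end

context half_context_data
begin

interpretation H: half_context \<V> k A B I "inflate A I B J M" "inflate B J A I N" e
  by (rule half_context)

text \<open>The image of \<open>trace\<close> in \<open>A/I\<close> is the span of the values of
  \<open>\<eta>\<close> on pure tensors, that is, the image of \<open>\<eta>\<close>. A subgroup
  that contains \<open>I\<close> is the full preimage of its image.\<close>

lemma mem_trace_iff:
  "a \<in> carrier A \<Longrightarrow> a \<in> H.trace \<longleftrightarrow> AI.cs a \<in> \<eta> ` carrier (tensor_lmodule \<V> BJ.Q M N)"
proof -
  assume a: "a \<in> carrier A"
  interpret Q: abelian_group AI.Q by (rule AI.quot_abelian)
  define S where "S = {\<eta> (pure x y) |x y. x \<in> carrier M \<and> y \<in> carrier N}"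
  have SQ: "S \<subseteq> carrier AI.Q"
    using add_hom_closed[OF \<eta>_add_hom T.pure_tensor_closed] by (auto simp: S_def)
  have im: "\<eta> ` carrier (tensor_lmodule \<V> BJ.Q M N) = add_span AI.Q S"
    using T.hom_span[OF AI.quot_abelian \<eta>_add_hom] by (simp add: S_def)
  have gen: "I \<union> {e x y |x y. x \<in> carrier M \<and> y \<in> carrier N} \<subseteq> carrier A"
    using e AI.I_carrier by auto
  have tr: "H.trace = add_span A (I \<union> {e x y |x y. x \<in> carrier M \<and> y \<in> carrier N})"
    by (simp add: H.trace_def)
  have sgtr: "add_subgroup A H.trace"
    unfolding tr by (rule AI.A.add_span_subgroup[OF gen])
  have Itr: "I \<subseteq> H.trace" unfolding tr by (auto intro: generate.incl)
  have "AI.cs a \<in> add_span AI.Q S" if "a \<in> H.trace"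
  proof (rule add_hom_span[OF AI.A.abelian_group_axioms AI.quot_abelian AI.coset_add_hom gen
        Q.add_span_subgroup[OF SQ] _ that[unfolded tr]])
    fix s assume s: "s \<in> I \<union> {e x y |x y. x \<in> carrier M \<and> y \<in> carrier N}"
    show "AI.cs s \<in> add_span AI.Q S"
    proof (cases "s \<in> I")
      case True
      then show ?thesis
        using Q.add_subgroupD(2)[OF Q.add_span_subgroup[OF SQ]] by (simp add: AI.coset_zero)
    next
      case False
      then obtain x y where "s = e x y" "x \<in> carrier M" "y \<in> carrier N" using s by auto
      then have "AI.cs s \<in> S" using e by (auto simp: S_def)
      then show ?thesis by (rule generate.incl)
    qed
  qed
  moreover have "a \<in> H.trace" if aS: "AI.cs a \<in> add_span AI.Q S"
  proof -
    have "add_subgroup AI.Q (AI.cs ` H.trace)"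
      by (rule add_hom_image_subgroup[OF AI.A.abelian_group_axioms AI.quot_abelian AI.coset_add_hom sgtr])
    moreover have "S \<subseteq> AI.cs ` H.trace"
    proof
      fix s assume "s \<in> S"
      then obtain x y where "s = \<eta> (pure x y)" "x \<in> carrier M" "y \<in> carrier N" by (auto simp: S_def)
      then show "s \<in> AI.cs ` H.trace"
        using H.e_trace[of x y] e(2)[of x y] by (auto intro!: image_eqI[of _ _ "e x y"])
    qed
    ultimately have "AI.cs a \<in> AI.cs ` H.trace"
      using aS Q.add_span_incl by blast
    then obtain t where t: "t \<in> H.trace" "AI.cs a = AI.cs t" by auto
    then obtain i where "i \<in> I" "a = i \<oplus>\<^bsub>A\<^esub> t"
      using AI.coset_eq_iff[OF a, of t] H.trace_carrier by auto
    then show ?thesis using t Itr AI.A.add_subgroupD(4)[OF sgtr] by blast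
  qed
  ultimately show ?thesis unfolding im by blast
qed

end

locale context_data = algebra_ideal A I \<V> k + BJ: algebra_ideal B J \<V> k
  for A :: "('k, 'a) vobj" and I and B :: "('k, 'b) vobj" and J and \<V> and k :: "'k ring" +
  fixes C :: "('k, 'a set, 'b set, 'm, 'n) morita"
  assumes C: "morita_context \<V> k (quot_algebra A I) (quot_algebra B J) C"
begin

sublocale AB: half_context_data A I B J \<V> k "mor_M C" "mor_N C" "mor_eta C"
  using C by unfold_locales (auto simp: morita_context_def Let_def)

sublocale BA: half_context_data B J A I \<V> k "mor_N C" "mor_M C" "mor_rho C"
  using C by unfold_locales (auto simp: morita_context_def Let_def)

sublocale morita_pair \<V> k A B I J "inflate A I B J (mor_M C)" "inflate B J A I (mor_N C)" AB.e BA.e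
  using C
  by (intro morita_pair.intro morita_pair_axioms.intro AB.half_context BA.half_context)
    (simp_all add: AB.e BA.e morita_context_def Let_def)

end

section \<open>The module induced by a Morita context\<close>

text \<open>
  The bimodules are kept in the form \<^term>\<open>inflate A I B J M\<close> from here on, since the facts
  about half contexts are stated in this form and would no longer match after simplification.
\<close>

declare inflate_simps [simp del]

lemma abelian_group_subgroup:
  assumes "abelian_group E" "add_subgroup E (carrier X)" "\<zero>\<^bsub>X\<^esub> = \<zero>\<^bsub>E\<^esub>" "add X = add E"
  shows "abelian_group X"
proof -
  interpret E: abelian_group E by fact
  note U = E.add_subgroupD[OF assms(2)]
  show ?thesis
  proof (rule abelian_groupI)
    show "\<exists>y\<in>carrier X. y \<oplus>\<^bsub>X\<^esub> x = \<zero>\<^bsub>X\<^esub>" if "x \<in> carrier X" for x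
      using that U(1) U(3)[OF that] E.l_neg[of x] unfolding assms(3,4) by blast
  qed (use U in \<open>auto simp: assms(3,4) subset_iff E.a_ac\<close>)
qed

text \<open>As the inclusion of \<open>X\<close> in \<open>H\<close> is additive, the span formed
  inside \<open>X\<close> is also a subgroup of \<open>H\<close>.\<close>

lemma add_span_subset:
  assumes "abelian_group H" "abelian_group X" and id: "add_hom X H (\<lambda>x. x)" and S: "S \<subseteq> carrier X"
  shows "add_span H S \<subseteq> add_span X S"
proof -
  interpret H: abelian_group H by fact
  interpret X: abelian_group X by fact
  have "add_subgroup H (add_span X S)"
    using add_hom_image_subgroup[OF assms(2,1) id X.add_span_subgroup[OF S]] by simp
  then show ?thesis by (rule H.add_span_incl[rotated]) (auto intro: generate.incl)
qed

locale induced_module = context_data A I B J \<V> k C +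
  W: half_context_module \<V> k B A J "inflate B J A I (mor_N C)" "inflate A I B J (mor_M C)" BA.e W
  for A :: "('k, 'a) vobj" and I and B :: "('k, 'b) vobj" and J and \<V> and k :: "'k ring"
    and C :: "('k, 'a set, 'b set, 'm, 'n) morita" and W :: "('k, 'b, 'w) lmodule"
begin

abbreviation "M \<equiv> inflate A I B J (mor_M C)"
abbreviation "N \<equiv> inflate B J A I (mor_N C)"
abbreviation "H \<equiv> hom_lmodule \<V> k B N W"

text \<open>The image of the pure tensor of \<open>x\<close> and \<open>w\<close> in
  \<open>Hom(N, W)\<close>, written with the representative \<open>BA.e y x\<close>.\<close>

definition s :: "'m \<Rightarrow> 'w \<Rightarrow> 'n \<Rightarrow> 'w" where
  "s x w = (\<lambda>y\<in>carrier N. lact W (BA.e y x) w)"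

text \<open>All functions from \<open>N\<close> to \<open>W\<close> with pointwise operations. In
  this ambient group no linearity has to be checked, and \<open>Hom(N, W)\<close>, its homogeneous
  parts and the image module are subgroups of it.\<close>

definition E :: "('k, 'a, 'n \<Rightarrow> 'w) lmodule" where
  "E = H\<lparr>carrier := carrier N \<rightarrow>\<^sub>E carrier W\<rparr>"

lemma N_right:
  assumes "y \<in> carrier N" "a \<in> carrier A"
  shows "ract N y a \<in> carrier N"
    and "a' \<in> carrier A \<Longrightarrow> ract N y (a \<oplus>\<^bsub>A\<^esub> a') = ract N y a \<oplus>\<^bsub>N\<^esub> ract N y a'"
    and "a' \<in> carrier A \<Longrightarrow> ract N y (a \<otimes>\<^bsub>A\<^esub> a') = ract N (ract N y a) a'"
    and "y' \<in> carrier N \<Longrightarrow> ract N (y \<oplus>\<^bsub>N\<^esub> y') a = ract N y a \<oplus>\<^bsub>N\<^esub> ract N y' a"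
    and "c \<in> carrier k \<Longrightarrow> ract N y (c \<odot>\<^bsub>A\<^esub> a) = c \<odot>\<^bsub>N\<^esub> ract N y a"
    and "c \<in> carrier k \<Longrightarrow> ract N (c \<odot>\<^bsub>N\<^esub> y) a = c \<odot>\<^bsub>N\<^esub> ract N y a"
    and "b \<in> carrier B \<Longrightarrow> ract N (lact N b y) a = lact N b (ract N y a)"
  using AB.bimodN assms unfolding is_bimodule_def right_module_def by blast+

lemma N_right_one: "y \<in> carrier N \<Longrightarrow> ract N y \<one>\<^bsub>A\<^esub> = y"
  using AB.bimodN unfolding is_bimodule_def right_module_def by blast

lemma N_right_hcomp:
  "i \<in> degs \<V> \<Longrightarrow> j \<in> degs \<V> \<Longrightarrow> y \<in> hcomp N i \<Longrightarrow> a \<in> hcomp A j \<Longrightarrow> ract N y a \<in> hcomp N (dplus \<V> i j)"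
  using AB.bimodN unfolding is_bimodule_def right_module_def by blast

lemma E_ops:
  "\<zero>\<^bsub>E\<^esub> = (\<lambda>y\<in>carrier N. \<zero>\<^bsub>W\<^esub>)" "add E = (\<lambda>f g. \<lambda>y\<in>carrier N. f y \<oplus>\<^bsub>W\<^esub> g y)"
  "carrier E = carrier N \<rightarrow>\<^sub>E carrier W"
  by (auto simp: E_def hom_lmodule_def)

lemma H_ops:
  "\<zero>\<^bsub>H\<^esub> = (\<lambda>y\<in>carrier N. \<zero>\<^bsub>W\<^esub>)" "add H = (\<lambda>f g. \<lambda>y\<in>carrier N. f y \<oplus>\<^bsub>W\<^esub> g y)"
  by (auto simp: hom_lmodule_def)

lemma E_abelian: "abelian_group E"
proof (rule abelian_groupI)
  show "\<exists>g\<in>carrier E. g \<oplus>\<^bsub>E\<^esub> f = \<zero>\<^bsub>E\<^esub>" if "f \<in> carrier E" for f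
    using that by (intro bexI[of _ "\<lambda>y\<in>carrier N. \<ominus>\<^bsub>W\<^esub> f y"])
      (auto simp: E_ops PiE_iff fun_eq_iff W.V.M.l_neg restrict_def extensional_def)
qed (auto simp: E_ops PiE_iff fun_eq_iff W.V.M.a_ac restrict_def extensional_def)

interpretation E: abelian_group E by (rule E_abelian)

lemma E_neg: "f \<in> carrier E \<Longrightarrow> \<ominus>\<^bsub>E\<^esub> f = (\<lambda>y\<in>carrier N. \<ominus>\<^bsub>W\<^esub> f y)"
  by (rule E.minus_equality)
    (auto simp: E_ops PiE_iff fun_eq_iff W.V.M.l_neg restrict_def extensional_def)

text \<open>Linearity over \<open>k\<close> follows from linearity over \<open>B\<close>, applied to
  \<open>c 1\<close>.\<close>

lemma hom_degree_iff:
  "f \<in> hom_degree \<V> k B N W d \<longleftrightarrow> f \<in> carrier E \<and> add_hom N W f \<and>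
     (\<forall>b\<in>carrier B. \<forall>y\<in>carrier N. f (lact N b y) = lact W b (f y)) \<and>
     (\<forall>i\<in>degs \<V>. \<forall>y\<in>hcomp N i. f y \<in> hcomp W (dplus \<V> i d))"
  (is "_ \<longleftrightarrow> _ \<and> ?add \<and> ?lin \<and> ?deg")
proof -
  have "f (c \<odot>\<^bsub>N\<^esub> y) = c \<odot>\<^bsub>W\<^esub> f y"
    if "f \<in> carrier E" ?lin "c \<in> carrier k" "y \<in> carrier N" for c y
  proof -
    have "f y \<in> carrier W" using that by (auto simp: E_ops)
    moreover have "f (lact N (c \<odot>\<^bsub>B\<^esub> \<one>\<^bsub>B\<^esub>) y) = lact W (c \<odot>\<^bsub>B\<^esub> \<one>\<^bsub>B\<^esub>) (f y)"
      using that by simp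
    ultimately show ?thesis
      using that by (simp only: W.V.smult_eq_act AB.N.smult_eq_act)
  qed
  then show ?thesis
    by (auto simp: hom_degree_def lmod_linear_def add_hom_def E_ops PiE_iff Pi_iff image_subset_iff)
qed


lemma hom_degree_subgroup: "add_subgroup E (hom_degree \<V> k B N W d)" if d: "d \<in> degs \<V>"
proof (rule E.add_subgroupI)
  show "hom_degree \<V> k B N W d \<subseteq> carrier E" by (auto simp: hom_degree_iff)
  have W0: "\<zero>\<^bsub>W\<^esub> \<in> hcomp W (dplus \<V> i d)" if "i \<in> degs \<V>" for i
    using W.V.M.add_subgroupD(2)[OF W.V.hcomp_subgroup[of "dplus \<V> i d"]] that d by simp
  show "\<zero>\<^bsub>E\<^esub> \<in> hom_degree \<V> k B N W d"
    using W0 AB.N.hcomp_carrier by (auto simp: hom_degree_iff E_ops add_hom_def)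
  fix f assume f: "f \<in> hom_degree \<V> k B N W d"
  have fE: "f \<in> carrier E" "\<And>y. y \<in> carrier N \<Longrightarrow> f y \<in> carrier W"
    using f by (auto simp: hom_degree_iff E_ops)
  show "\<ominus>\<^bsub>E\<^esub> f \<in> hom_degree \<V> k B N W d"
    using f fE AB.N.hcomp_carrier W.V.M.add_subgroupD(3)[OF W.V.hcomp_subgroup[OF dplus_degs[OF _ d]]]
    by (auto simp: hom_degree_iff E_neg add_hom_def E_ops(3) W.V.M.minus_add W.V.M.a_comm
        add_hom_neg[OF W.V.X_abelian W.V.X_abelian W.V.act_right_hom])
  fix g assume g: "g \<in> hom_degree \<V> k B N W d"
  have gE: "g \<in> carrier E" "\<And>y. y \<in> carrier N \<Longrightarrow> g y \<in> carrier W"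
    using g by (auto simp: hom_degree_iff E_ops)
  show "f \<oplus>\<^bsub>E\<^esub> g \<in> hom_degree \<V> k B N W d"
    using f g fE gE AB.N.hcomp_carrier W.V.M.add_subgroupD(4)[OF W.V.hcomp_subgroup[OF dplus_degs[OF _ d]]]
    by (auto simp: hom_degree_iff add_hom_def E_ops W.V.M.a_ac W.V.act_add_right)
qed

lemma eval_hom: "y \<in> carrier N \<Longrightarrow> add_hom E W (\<lambda>f. f y)"
  by (auto simp: add_hom_def E_ops)

text \<open>The pointwise finite sums in \<open>hom_lmodule\<close> are sums in \<open>E\<close>,
  since evaluation at \<open>y\<close> is additive. Thus \<open>Hom(N, W)\<close> is the sum of its
  homogeneous parts inside \<open>E\<close>.\<close>

lemma H_carrier: "carrier H = add_span E (\<Union>d\<in>degs \<V>. hom_degree \<V> k B N W d)"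
proof (intro subset_antisym subsetI)
  have hE: "hom_degree \<V> k B N W d \<subseteq> carrier E" for d by (auto simp: hom_degree_iff)
  have eval_sum: "(\<Oplus>\<^bsub>E\<^esub>d\<in>S. g d) y = (\<Oplus>\<^bsub>W\<^esub>d\<in>S. g d y)"
    if "finite S" "\<forall>d\<in>S. g d \<in> hom_degree \<V> k B N W d" "y \<in> carrier N" for S g y
    using add_hom_finsum[OF E_abelian W.V.X_abelian eval_hom[OF that(3)] that(1), of g] that(2) hE by auto
  fix f
  show "f \<in> add_span E (\<Union>d\<in>degs \<V>. hom_degree \<V> k B N W d)" if "f \<in> carrier H"
  proof -
    obtain S g where f: "f \<in> extensional (carrier N)" and S: "finite S" "S \<subseteq> degs \<V>"
      and g: "\<forall>d\<in>S. g d \<in> hom_degree \<V> k B N W d"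
      and eq: "\<forall>y\<in>carrier N. f y = (\<Oplus>\<^bsub>W\<^esub>d\<in>S. g d y)"
      using \<open>f \<in> carrier H\<close> unfolding hom_lmodule_def by auto
    have gs: "(\<Oplus>\<^bsub>E\<^esub>d\<in>S. g d) \<in> add_span E (\<Union>d\<in>degs \<V>. hom_degree \<V> k B N W d)"
      using S g hE by (intro E.add_subgroup_finsum E.add_span_subgroup) (auto intro!: generate.incl)
    have "(\<Oplus>\<^bsub>E\<^esub>d\<in>S. g d) \<in> carrier E" using g hE by (intro E.finsum_closed) auto
    then have "f = (\<Oplus>\<^bsub>E\<^esub>d\<in>S. g d)"
      using f eq eval_sum[OF S(1) g] by (intro extensionalityI[of _ "carrier N"]) (auto simp: E_ops PiE_iff)
    then show ?thesis using gs by simp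
  qed
  show "f \<in> carrier H" if f: "f \<in> add_span E (\<Union>d\<in>degs \<V>. hom_degree \<V> k B N W d)"
  proof -
    obtain S g where S: "finite S" "S \<subseteq> degs \<V>" "\<forall>d\<in>S. g d \<in> hom_degree \<V> k B N W d"
      and eq: "f = (\<Oplus>\<^bsub>E\<^esub>d\<in>S. g d)"
      using E.add_span_UN[OF hom_degree_subgroup f] by blast
    have "f \<in> carrier E" using S hE unfolding eq by (intro E.finsum_closed) auto
    then show ?thesis
      using S eval_sum[OF S(1,3)] by (auto simp: hom_lmodule_def E_ops PiE_iff eq)
  qed
qed

lemma H_subgroup: "add_subgroup E (carrier H)"
  unfolding H_carrier by (rule E.add_span_subgroup) (auto simp: hom_degree_iff)

lemma H_abelian: "abelian_group H"
  by (rule abelian_group_subgroup[OF E_abelian H_subgroup]) (simp_all add: E_ops H_ops)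

text \<open>Linear maps form a subgroup of \<open>E\<close> that contains every homogeneous map,
  hence also their span.\<close>

lemma H_linear:
  assumes "f \<in> carrier H"
  shows "f \<in> carrier E" "add_hom N W f"
    and "\<And>b y. b \<in> carrier B \<Longrightarrow> y \<in> carrier N \<Longrightarrow> f (lact N b y) = lact W b (f y)"
proof -
  let ?L = "{f \<in> carrier E. add_hom N W f \<and>
    (\<forall>b\<in>carrier B. \<forall>y\<in>carrier N. f (lact N b y) = lact W b (f y))}"
  have "add_subgroup E ?L"
  proof (rule E.add_subgroupI)
    show "\<zero>\<^bsub>E\<^esub> \<in> ?L" by (auto simp: E_ops add_hom_def)
    show "\<ominus>\<^bsub>E\<^esub> f \<in> ?L" if "f \<in> ?L" for f
    proof -
      have "\<And>y. y \<in> carrier N \<Longrightarrow> f y \<in> carrier W" using that by (auto simp: E_ops)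
      then show ?thesis
        using that by (auto simp: E_neg add_hom_def E_ops(3) W.V.M.minus_add W.V.M.a_comm
            add_hom_neg[OF W.V.X_abelian W.V.X_abelian W.V.act_right_hom])
    qed
    show "f \<oplus>\<^bsub>E\<^esub> g \<in> ?L" if "f \<in> ?L" "g \<in> ?L" for f g
    proof -
      have "\<And>y. y \<in> carrier N \<Longrightarrow> f y \<in> carrier W" "\<And>y. y \<in> carrier N \<Longrightarrow> g y \<in> carrier W"
        using that by (auto simp: E_ops)
      then show ?thesis
        using that by (auto simp: add_hom_def E_ops W.V.M.a_ac W.V.act_add_right)
    qed
  qed auto
  then have "carrier H \<subseteq> ?L"
    unfolding H_carrier by (rule E.add_span_incl[rotated]) (auto simp: hom_degree_iff)
  then show "f \<in> carrier E" "add_hom N W f"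
    "\<And>b y. b \<in> carrier B \<Longrightarrow> y \<in> carrier N \<Longrightarrow> f (lact N b y) = lact W b (f y)"
    using assms by auto
qed

lemma s_closed_E: "x \<in> carrier M \<Longrightarrow> w \<in> carrier W \<Longrightarrow> s x w \<in> carrier E"
  by (auto simp: s_def E_ops BA.e_closed)

lemma s_hom_left: "w \<in> carrier W \<Longrightarrow> add_hom M E (\<lambda>x. s x w)"
  using add_hom_add[OF W.act_e_right_hom]
  by (intro add_homI s_closed_E) (auto simp: s_def E_ops(2) fun_eq_iff restrict_def)

lemma s_hom_right: "x \<in> carrier M \<Longrightarrow> add_hom W E (s x)"
  by (intro add_homI s_closed_E) (auto simp: s_def E_ops(2) fun_eq_iff restrict_def W.V.act_add_right BA.e_closed)

text \<open>For \<open>y\<close> of degree \<open>l\<close> the value \<open>r(y, x) w\<close> has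
  degree \<open>l + i + j\<close>, in the order of the three symbols; nothing is interchanged, so no
  sign arises.\<close>

lemma s_hcomp:
  assumes i: "i \<in> degs \<V>" and j: "j \<in> degs \<V>" and x: "x \<in> hcomp M i" and w: "w \<in> hcomp W j"
  shows "s x w \<in> hom_degree \<V> k B N W (dplus \<V> i j)"
proof -
  have xM: "x \<in> carrier M" and wW: "w \<in> carrier W"
    using AB.M.hcomp_carrier[OF i x] W.V.hcomp_carrier[OF j w] by auto
  have "add_hom N W (s x w)"
    using add_hom_add[OF W.act_e_left_hom[OF xM wW]] xM wW
    by (intro add_homI) (auto simp: s_def BA.e_closed)
  moreover have "s x w y \<in> hcomp W (dplus \<V> l (dplus \<V> i j))" if "l \<in> degs \<V>" "y \<in> hcomp N l" for l y
    using W.act_e_hcomp[OF that(1) i j that(2) x w] AB.N.hcomp_carrier[OF that]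
    by (simp add: s_def dplus_assoc)
  ultimately show ?thesis
    using s_closed_E[OF xM wW] xM wW
    by (auto simp: hom_degree_iff s_def W.act_e_lact)
qed

lemma s_span:
  assumes "x \<in> carrier M" "w \<in> carrier W" and U: "add_subgroup E U"
    and hom: "\<And>i j x w. i \<in> degs \<V> \<Longrightarrow> j \<in> degs \<V> \<Longrightarrow> x \<in> hcomp M i \<Longrightarrow> w \<in> hcomp W j \<Longrightarrow> s x w \<in> U"
  shows "s x w \<in> U"
proof (rule biadditive_span[OF AB.M.X_abelian W.V.X_abelian E_abelian s_hom_left s_hom_right
      AB.M.homogeneous_carrier W.V.homogeneous_carrier U])
  show "x \<in> add_span M (homogeneous \<V> M)" using assms AB.M.carrier_eq_span by simp
  show "w \<in> add_span W (homogeneous \<V> W)" using assms W.V.carrier_eq_span by simp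
  show "s x w \<in> U" if "x \<in> homogeneous \<V> M" "w \<in> homogeneous \<V> W" for x w
    using that hom unfolding homogeneous_def by blast
qed

lemma s_closed_H: "x \<in> carrier M \<Longrightarrow> w \<in> carrier W \<Longrightarrow> s x w \<in> carrier H"
proof (rule s_span[OF _ _ H_subgroup])
  fix i j x w assume *: "i \<in> degs \<V>" "j \<in> degs \<V>" "x \<in> hcomp M i" "w \<in> hcomp W j"
  then have "s x w \<in> (\<Union>d\<in>degs \<V>. hom_degree \<V> k B N W d)"
    using s_hcomp[OF *] dplus_degs[OF *(1,2)] by blast
  then show "s x w \<in> carrier H" unfolding H_carrier by (rule generate.incl)
qed

end

section \<open>The module structure on the image\<close>

context induced_module
begin

abbreviation "X \<equiv> morita_image \<V> k A I B J C W"

interpretation E: abelian_group E by (rule E_abelian)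

lemma coset_act_J:
  assumes "b \<in> carrier B" "w \<in> carrier W"
  shows "coset_act W (BJ.cs b) w = lact W b w"
proof -
  have "lact W c w = lact W b w" if "c \<in> BJ.cs b" for c
  proof -
    have "c \<in> carrier B"
      using that assms(1) BJ.I_carrier by (auto simp: a_r_coset_def r_coset_def)
    moreover have "BJ.cs b = BJ.cs c"
      using BJ.A.a_repr_independence[OF that assms(1) BJ.I.a_subgroup] .
    ultimately show ?thesis
      using assms by (intro W.coset_act) auto
  qed
  moreover have "b \<in> BJ.cs b" using BJ.I.a_rcos_self[OF assms(1)] .
  ultimately have "(\<lambda>c. lact W c w) ` BJ.cs b = {lact W b w}" by blast
  then show ?thesis by (simp add: coset_act_def)
qed

text \<open>\<open>morita_map\<close> is the lift of the balanced map \<open>g\<close>, which agrees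
  with \<open>s\<close> on the carriers because \<open>coset_act\<close> does not depend on the
  representative. After this lemma the image is studied through its generators \<open>s x w\<close>
  alone.\<close>

lemma X_carrier: "carrier X = add_span H {s x w |x w. x \<in> carrier M \<and> w \<in> carrier W}"
proof -
  define g where "g = (\<lambda>(x, w). \<lambda>y\<in>carrier (mor_N C).
    coset_act W (mor_rho C (pure_tensor (quot_algebra A I) (mor_N C) (mor_M C) y x)) w)"
  have g: "g (x, w) = s x w" if "x \<in> carrier M" "w \<in> carrier W" for x w
  proof -
    have "coset_act W (mor_rho C (pure_tensor (quot_algebra A I) (mor_N C) (mor_M C) y x)) w =
        lact W (BA.e y x) w" if "y \<in> carrier (mor_N C)" for y
      using BA.e[OF that, of x] coset_act_J[of "BA.e y x" w] \<open>x \<in> carrier M\<close> \<open>w \<in> carrier W\<close>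
      by (simp add: inflate_simps)
    then show ?thesis by (auto simp: g_def s_def inflate_simps)
  qed
  interpret T: tensor B M W
    by (rule bimodule_tensor[OF AB.bimodM W.V.left_module])
  have gl: "add_hom M H (\<lambda>x. g (x, w))" if "w \<in> carrier W" for w
    using that add_hom_add[OF s_hom_left[OF that]]
    by (intro add_homI) (auto simp: g s_closed_H H_ops E_ops)
  have gr: "add_hom W H (\<lambda>w. g (x, w))" if "x \<in> carrier M" for x
    using that add_hom_add[OF s_hom_right[OF that]]
    by (intro add_homI) (auto simp: g s_closed_H H_ops E_ops)
  have gb: "g (ract M x b, w) = g (x, lact W b w)"
    if "x \<in> carrier M" "b \<in> carrier B" "w \<in> carrier W" for x b w
    using that W.act_e_ract[of b _ x w] by (auto simp: g T.ract_closed s_def)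
  have "carrier X = tensor_lift H g ` carrier (tensor_lmodule \<V> B M W)"
    by (simp add: morita_image_def morita_map_def Let_def g_def)
  also have "\<dots> = add_span H {tensor_lift H g (pure_tensor B M W x w) |x w. x \<in> carrier M \<and> w \<in> carrier W}"
    by (rule T.hom_span[OF H_abelian T.tensor_lift_add_hom[OF H_abelian gl gr gb]])
  also have "{tensor_lift H g (pure_tensor B M W x w) |x w. x \<in> carrier M \<and> w \<in> carrier W} =
      {s x w |x w. x \<in> carrier M \<and> w \<in> carrier W}"
    using T.tensor_lift_pure[OF H_abelian gl gr gb] g by (intro Collect_cong) metis
  finally show ?thesis .
qed

lemma X_ops:
  "\<zero>\<^bsub>X\<^esub> = (\<lambda>y\<in>carrier N. \<zero>\<^bsub>W\<^esub>)" "add X = (\<lambda>f g. \<lambda>y\<in>carrier N. f y \<oplus>\<^bsub>W\<^esub> g y)"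
  "smult X = (\<lambda>c f. \<lambda>y\<in>carrier N. c \<odot>\<^bsub>W\<^esub> f y)"
  "hcomp X d = hom_degree \<V> k B N W d \<inter> carrier X"
  "lact X = (\<lambda>a f. \<lambda>y\<in>carrier N. f (ract N y a))"
  by (auto simp: morita_image_def Let_def hom_lmodule_def)

lemma s_set: "{s x w |x w. x \<in> carrier M \<and> w \<in> carrier W} \<subseteq> carrier H"
  using s_closed_H by auto

lemma X_subset_H: "carrier X \<subseteq> carrier H"
  unfolding X_carrier
  using abelian_group.add_subgroupD(1)[OF H_abelian abelian_group.add_span_subgroup[OF H_abelian s_set]] .

lemma H_E_id: "add_hom H E (\<lambda>f. f)"
  using H_linear(1) by (auto simp: add_hom_def H_ops E_ops)

lemma X_subgroup: "add_subgroup E (carrier X)"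
proof -
  have "add_subgroup H (carrier X)"
    unfolding X_carrier by (rule abelian_group.add_span_subgroup[OF H_abelian s_set])
  then show ?thesis
    using add_hom_image_subgroup[OF H_abelian E_abelian H_E_id] by simp
qed

lemma X_abelian: "abelian_group X"
  by (rule abelian_group_subgroup[OF E_abelian X_subgroup]) (simp_all add: E_ops X_ops)

interpretation X: abelian_group X by (rule X_abelian)

lemma X_linear:
  assumes "f \<in> carrier X"
  shows "f \<in> carrier E" "add_hom N W f" "y \<in> carrier N \<Longrightarrow> f y \<in> carrier W"
    and "b \<in> carrier B \<Longrightarrow> y \<in> carrier N \<Longrightarrow> f (lact N b y) = lact W b (f y)"
  using H_linear[OF subsetD[OF X_subset_H assms]] by (auto intro: add_hom_closed)

lemma X_smult:
  assumes "f \<in> carrier X" "c \<in> carrier k" "y \<in> carrier N"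
  shows "f (c \<odot>\<^bsub>N\<^esub> y) = c \<odot>\<^bsub>W\<^esub> f y"
  using X_linear[OF assms(1)] assms
  by (simp add: AB.N.smult_eq_act W.V.smult_eq_act BJ.AV.smult_closed)

lemma s_closed_X: "x \<in> carrier M \<Longrightarrow> w \<in> carrier W \<Longrightarrow> s x w \<in> carrier X"
  unfolding X_carrier by (intro generate.incl) auto

lemma X_span: "carrier X = add_span X {s x w |x w. x \<in> carrier M \<and> w \<in> carrier W}"
proof
  have sX: "{s x w |x w. x \<in> carrier M \<and> w \<in> carrier W} \<subseteq> carrier X" using s_closed_X by auto
  have "add_hom X H (\<lambda>f. f)" using X_subset_H by (auto simp: add_hom_def H_ops X_ops)
  from add_span_subset[OF H_abelian X_abelian this sX]
  show "carrier X \<subseteq> add_span X {s x w |x w. x \<in> carrier M \<and> w \<in> carrier W}"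
    by (simp add: X_carrier)
  show "add_span X {s x w |x w. x \<in> carrier M \<and> w \<in> carrier W} \<subseteq> carrier X"
    using X.add_subgroupD(1)[OF X.add_span_subgroup[OF sX]] .
qed

lemma X_E_id: "add_hom X E (\<lambda>f. f)"
  using X_linear(1) by (auto simp: add_hom_def X_ops E_ops)

lemma X_eqI:
  assumes "f \<in> carrier X" "g \<in> carrier X" "\<And>y. y \<in> carrier N \<Longrightarrow> f y = g y"
  shows "f = g"
  using X_linear(1)[OF assms(1)] X_linear(1)[OF assms(2)] assms(3)
  by (intro extensionalityI[of _ "carrier N"]) (auto simp: E_ops PiE_iff)

text \<open>\<open>h\<close> is known to take values in \<open>E\<close> only; that it preserves the
  image is read off from the generators. It provides the actions of \<open>A\<close> and
  \<open>k\<close> on \<open>X\<close>.\<close>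

lemma X_closed_under:
  assumes h: "add_hom X E h" and s: "\<And>x w. x \<in> carrier M \<Longrightarrow> w \<in> carrier W \<Longrightarrow> h (s x w) \<in> carrier X"
    and f: "f \<in> carrier X"
  shows "h f \<in> carrier X"
proof (rule add_hom_span[OF X_abelian E_abelian h _ X_subgroup])
  show "f \<in> add_span X {s x w |x w. x \<in> carrier M \<and> w \<in> carrier W}" using f X_span by simp
  show "{s x w |x w. x \<in> carrier M \<and> w \<in> carrier W} \<subseteq> carrier X" using s_closed_X by auto
  show "h u \<in> carrier X" if "u \<in> {s x w |x w. x \<in> carrier M \<and> w \<in> carrier W}" for u
    using that s by auto
qed

text \<open>Acting by \<open>a\<close> evaluates at \<open>y a\<close>, and balancedness moves
  \<open>a\<close> over to \<open>x\<close>: on \<open>W\<close>, \<open>r(y a, x)\<close> acts as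
  \<open>r(y, a x)\<close>.\<close>

lemma act_s:
  assumes "a \<in> carrier A" "x \<in> carrier M" "w \<in> carrier W"
  shows "lact X a (s x w) = s (lact M a x) w"
  using assms N_right(1)
  by (auto simp: X_ops s_def W.act_e_balanced fun_eq_iff restrict_def)

lemma smult_s:
  assumes "c \<in> carrier k" "x \<in> carrier M" "w \<in> carrier W"
  shows "c \<odot>\<^bsub>X\<^esub> s x w = s x (c \<odot>\<^bsub>W\<^esub> w)"
proof -
  have "c \<odot>\<^bsub>W\<^esub> lact W b w = lact W b (c \<odot>\<^bsub>W\<^esub> w)" if "b \<in> carrier B" for b
    using W.V.left_module that assms by (simp add: left_module_def)
  then show ?thesis
    using assms by (auto simp: X_ops s_def fun_eq_iff restrict_def BA.e_closed)
qed

lemma act_closed: "a \<in> carrier A \<Longrightarrow> f \<in> carrier X \<Longrightarrow> lact X a f \<in> carrier X"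
proof (rule X_closed_under[where h = "lact X a"])
  assume a: "a \<in> carrier A"
  show "add_hom X E (lact X a)"
    using a X_linear(3) N_right(1) by (intro add_homI) (auto simp: X_ops E_ops fun_eq_iff)
  show "lact X a (s x w) \<in> carrier X" if "x \<in> carrier M" "w \<in> carrier W" for x w
    using that a by (simp add: act_s s_closed_X)
qed

lemma smult_closed: "c \<in> carrier k \<Longrightarrow> f \<in> carrier X \<Longrightarrow> c \<odot>\<^bsub>X\<^esub> f \<in> carrier X"
proof (rule X_closed_under[where h = "(\<odot>\<^bsub>X\<^esub>) c"])
  assume c: "c \<in> carrier k"
  show "add_hom X E ((\<odot>\<^bsub>X\<^esub>) c)"
    using c X_linear(3) by (intro add_homI) (auto simp: X_ops E_ops fun_eq_iff W.V.smult_r_distr)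
  show "c \<odot>\<^bsub>X\<^esub> s x w \<in> carrier X" if "x \<in> carrier M" "w \<in> carrier W" for x w
    using that c by (simp add: smult_s s_closed_X)
qed

lemma X_module: "module k X"
proof (rule moduleI[OF module.axioms(1)[OF W.V.module_axioms] X_abelian smult_closed])
  show "(c \<oplus>\<^bsub>k\<^esub> d) \<odot>\<^bsub>X\<^esub> f = c \<odot>\<^bsub>X\<^esub> f \<oplus>\<^bsub>X\<^esub> d \<odot>\<^bsub>X\<^esub> f"
    if "c \<in> carrier k" "d \<in> carrier k" "f \<in> carrier X" for c d f
    using that X_linear(3) by (auto simp: X_ops fun_eq_iff W.V.smult_l_distr)
  show "c \<odot>\<^bsub>X\<^esub> (f \<oplus>\<^bsub>X\<^esub> g) = c \<odot>\<^bsub>X\<^esub> f \<oplus>\<^bsub>X\<^esub> c \<odot>\<^bsub>X\<^esub> g"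
    if "c \<in> carrier k" "f \<in> carrier X" "g \<in> carrier X" for c f g
    using that X_linear(3) by (auto simp: X_ops fun_eq_iff W.V.smult_r_distr)
  show "(c \<otimes>\<^bsub>k\<^esub> d) \<odot>\<^bsub>X\<^esub> f = c \<odot>\<^bsub>X\<^esub> (d \<odot>\<^bsub>X\<^esub> f)"
    if "c \<in> carrier k" "d \<in> carrier k" "f \<in> carrier X" for c d f
    using that X_linear(3) by (auto simp: X_ops fun_eq_iff W.V.smult_assoc1)
  show "\<one>\<^bsub>k\<^esub> \<odot>\<^bsub>X\<^esub> f = f" if "f \<in> carrier X" for f
    using that X_linear(3)
    by (intro X_eqI smult_closed cring.cring_simprules(6)[OF module.axioms(1)[OF W.V.module_axioms]])
      (auto simp: X_ops)
qed

text \<open>The separating map required by \<open>vobjectI\<close> for \<open>f\<close> of degree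
  \<open>d\<close> is evaluation at a homogeneous \<open>y\<close> of degree \<open>i\<close> with
  \<open>f y \<noteq> 0\<close>, followed by the projection of \<open>W\<close> to degree
  \<open>i + d\<close>. Maps of another degree have their values at \<open>y\<close> in another
  degree.\<close>

lemma X_vobject: "vobject \<V> k X"
proof (rule vobjectI[OF X_module _ _ W.V.X_abelian])
  interpret Xm: module k X by (rule X_module)
  show "submodule (hcomp X d) k X" if d: "d \<in> degs \<V>" for d
  proof (rule Xm.submoduleI)
    note sg = E.add_subgroupD[OF hom_degree_subgroup[OF d]]
    have eE: "\<zero>\<^bsub>X\<^esub> = \<zero>\<^bsub>E\<^esub>" "add X = add E" by (simp_all add: X_ops E_ops)
    show "hcomp X d \<subseteq> carrier X" by (auto simp: X_ops)
    show "\<zero>\<^bsub>X\<^esub> \<in> hcomp X d" using sg(2) X.zero_closed by (auto simp: X_ops(4) eE)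
    show "\<ominus>\<^bsub>X\<^esub> f \<in> hcomp X d" if "f \<in> hcomp X d" for f
      using that sg(3) X.a_inv_closed[of f] add_hom_neg[OF X_abelian E_abelian X_E_id, of f]
      by (auto simp: X_ops(4))
    show "f \<oplus>\<^bsub>X\<^esub> g \<in> hcomp X d" if "f \<in> hcomp X d" "g \<in> hcomp X d" for f g
      using that sg(4)[of f g] X.a_closed[of f g] by (auto simp: X_ops(4) eE)
    show "c \<odot>\<^bsub>X\<^esub> f \<in> hcomp X d" if c: "c \<in> carrier k" and f: "f \<in> hcomp X d" for c f
    proof -
      have fX: "f \<in> carrier X" and fd: "\<And>i y. i \<in> degs \<V> \<Longrightarrow> y \<in> hcomp N i \<Longrightarrow> f y \<in> hcomp W (dplus \<V> i d)"
        using f by (auto simp: X_ops(4) hom_degree_iff)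
      note cf = smult_closed[OF c fX]
      have "(c \<odot>\<^bsub>X\<^esub> f) y \<in> hcomp W (dplus \<V> i d)" if "i \<in> degs \<V>" "y \<in> hcomp N i" for i y
        using fd[OF that] AB.N.hcomp_carrier[OF that] c d that
          submodule.smult_closed[OF W.V.hcomp_submodule[of "dplus \<V> i d"]]
        by (simp add: X_ops(3))
      then show ?thesis
        using cf X_linear[OF cf] by (auto simp: X_ops(4) hom_degree_iff)
    qed
  qed
next
  have sub: "homogeneous \<V> X \<subseteq> carrier X" by (auto simp: homogeneous_def X_ops(4))
  note sg = X.add_span_subgroup[OF sub]
  have EX: "add_subgroup E (add_span X (homogeneous \<V> X))"
    using add_hom_image_subgroup[OF X_abelian E_abelian X_E_id sg] by simp
  have "s x w \<in> add_span X (homogeneous \<V> X)" if "x \<in> carrier M" "w \<in> carrier W" for x w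
  proof (rule s_span[OF that EX])
    fix i j x w assume *: "i \<in> degs \<V>" "j \<in> degs \<V>" "x \<in> hcomp M i" "w \<in> hcomp W j"
    have "s x w \<in> hcomp X (dplus \<V> i j)"
      using s_hcomp[OF *] s_closed_X AB.M.hcomp_carrier[OF *(1,3)] W.V.hcomp_carrier[OF *(2,4)]
      by (simp add: X_ops(4))
    then have "s x w \<in> homogeneous \<V> X"
      unfolding homogeneous_def using dplus_degs[OF *(1,2)] by blast
    then show "s x w \<in> add_span X (homogeneous \<V> X)" by (rule generate.incl)
  qed
  then have "add_span X {s x w |x w. x \<in> carrier M \<and> w \<in> carrier W} \<subseteq> add_span X (homogeneous \<V> X)"
    by (intro X.add_span_incl[OF _ sg]) auto
  then show "carrier X \<subseteq> add_span X (homogeneous \<V> X)" using X_span by simp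
next
  fix d f assume d: "d \<in> degs \<V>" and f: "f \<in> hcomp X d" and ne: "f \<noteq> \<zero>\<^bsub>X\<^esub>"
  have fX: "f \<in> carrier X" using f by (simp add: X_ops(4))
  \<comment> \<open>A map that vanishes on all homogeneous \<open>y\<close> vanishes, since these
    span \<open>N\<close>.\<close>
  have "\<exists>y\<in>homogeneous \<V> N. f y \<noteq> \<zero>\<^bsub>W\<^esub>"
  proof (rule ccontr)
    assume "\<not> ?thesis"
    then have 0: "\<And>y. y \<in> homogeneous \<V> N \<Longrightarrow> f y \<in> {\<zero>\<^bsub>W\<^esub>}" by auto
    have "f y \<in> {\<zero>\<^bsub>W\<^esub>}" if "y \<in> carrier N" for y
      by (rule add_hom_span[OF AB.N.X_abelian W.V.X_abelian X_linear(2)[OF fX] AB.N.homogeneous_carrier _ 0])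
        (use that W.V.M.add.triv_subgroup AB.N.carrier_eq_span in auto)
    then have "f = \<zero>\<^bsub>X\<^esub>" by (intro X_eqI fX X.zero_closed) (auto simp: X_ops)
    then show False using ne by simp
  qed
  then obtain i y where i: "i \<in> degs \<V>" and y: "y \<in> hcomp N i" and fy: "f y \<noteq> \<zero>\<^bsub>W\<^esub>"
    unfolding homogeneous_def by blast
  have yN: "y \<in> carrier N" using AB.N.hcomp_carrier[OF i y] .
  have deg: "z y \<in> hcomp W (dplus \<V> i j)" if "z \<in> hcomp X j" for j z
    using that i y by (auto simp: X_ops(4) hom_degree_iff)
  have "add_hom X W (\<lambda>z. z y)"
    using add_hom_comp[OF X_E_id eval_hom[OF yN]] .
  then have "add_hom X W (\<lambda>z. hpart \<V> W (dplus \<V> i d) (z y))"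
    using add_hom_comp W.V.hpart_add_hom[of "dplus \<V> i d"] i d by fastforce
  moreover have "hpart \<V> W (dplus \<V> i d) (z y) = \<zero>\<^bsub>W\<^esub>" if "j \<in> degs \<V>" "j \<noteq> d" "z \<in> hcomp X j" for j z
    using W.V.hpart_homog[OF _ _ deg[OF that(3)], of "dplus \<V> i d"] that i d by (simp add: dplus_cancel)
  moreover have "hpart \<V> W (dplus \<V> i d) (f y) \<noteq> \<zero>\<^bsub>W\<^esub>"
    using W.V.hpart_homog[OF _ _ deg[OF f], of "dplus \<V> i d"] i d fy by simp
  ultimately show "\<exists>q. add_hom X W q \<and> q f \<noteq> \<zero>\<^bsub>W\<^esub> \<and>
      (\<forall>j\<in>degs \<V>. j \<noteq> d \<longrightarrow> (\<forall>z\<in>hcomp X j. q z = \<zero>\<^bsub>W\<^esub>))"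
    by (intro exI[of _ "\<lambda>z. hpart \<V> W (dplus \<V> i d) (z y)"]) blast
qed

lemma X_left_module: "left_module \<V> k A X"
  unfolding left_module_def
proof (intro conjI ballI X_vobject act_closed)
  fix a b f assume *: "a \<in> carrier A" "b \<in> carrier A" "f \<in> carrier X"
  show "lact X (a \<oplus>\<^bsub>A\<^esub> b) f = lact X a f \<oplus>\<^bsub>X\<^esub> lact X b f"
    using * by (auto simp: X_ops fun_eq_iff N_right add_hom_add[OF X_linear(2)])
  show "lact X (a \<otimes>\<^bsub>A\<^esub> b) f = lact X a (lact X b f)"
    using * by (auto simp: X_ops fun_eq_iff N_right)
next
  fix a f g assume "a \<in> carrier A" "f \<in> carrier X" "g \<in> carrier X"
  then show "lact X a (f \<oplus>\<^bsub>X\<^esub> g) = lact X a f \<oplus>\<^bsub>X\<^esub> lact X a g"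
    by (auto simp: X_ops fun_eq_iff N_right)
next
  fix c a f assume *: "c \<in> carrier k" "a \<in> carrier A" "f \<in> carrier X"
  show "lact X (c \<odot>\<^bsub>A\<^esub> a) f = c \<odot>\<^bsub>X\<^esub> lact X a f"
    using * by (auto simp: X_ops fun_eq_iff N_right X_smult)
  show "lact X a (c \<odot>\<^bsub>X\<^esub> f) = c \<odot>\<^bsub>X\<^esub> lact X a f"
    using * by (auto simp: X_ops fun_eq_iff N_right)
next
  fix f assume f: "f \<in> carrier X"
  show "lact X \<one>\<^bsub>A\<^esub> f = f"
    using f by (intro X_eqI act_closed) (auto simp: X_ops(5) N_right_one)
next
  fix i j a f assume i: "i \<in> degs \<V>" and j: "j \<in> degs \<V>" and a: "a \<in> hcomp A i" and f: "f \<in> hcomp X j"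
  have aA: "a \<in> carrier A" using AV.hcomp_carrier[OF i a] .
  have fX: "f \<in> carrier X" using f by (simp add: X_ops(4))
  note af = act_closed[OF aA fX]
  have "lact X a f y \<in> hcomp W (dplus \<V> l (dplus \<V> i j))" if l: "l \<in> degs \<V>" and y: "y \<in> hcomp N l" for l y
  proof -
    have "f (ract N y a) \<in> hcomp W (dplus \<V> (dplus \<V> l i) j)"
      using f N_right_hcomp[OF l i y a] dplus_degs[OF l i] by (auto simp: X_ops(4) hom_degree_iff)
    then show ?thesis
      using AB.N.hcomp_carrier[OF l y] by (simp add: X_ops(5) dplus_assoc)
  qed
  then show "lact X a f \<in> hcomp X (dplus \<V> i j)"
    using af X_linear[OF af] by (auto simp: X_ops(4) hom_degree_iff)
qed

lemma X_lmod: "lmod k X \<V> A"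
  by (rule lmodI[OF AB.A X_left_module])

interpretation Xl: lmod k X \<V> A by (rule X_lmod)

lemma X_half_context_module: "half_context_module \<V> k A B I M N AB.e X"
proof (intro half_context_module.intro half_context_module_axioms.intro AB.half_context X_lmod)
  fix a f assume a: "a \<in> I" and f: "f \<in> carrier X"
  have aA: "a \<in> carrier A" using a AB.I_carrier by auto
  have "lact X a f \<in> {\<zero>\<^bsub>X\<^esub>}"
  proof (rule add_hom_span[OF X_abelian X_abelian Xl.act_right_hom[OF aA]])
    show "f \<in> add_span X {s x w |x w. x \<in> carrier M \<and> w \<in> carrier W}" using f X_span by simp
    show "add_subgroup X {\<zero>\<^bsub>X\<^esub>}" using X.add.triv_subgroup by simp
    show "{s x w |x w. x \<in> carrier M \<and> w \<in> carrier W} \<subseteq> carrier X" using s_closed_X by auto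
    fix u assume "u \<in> {s x w |x w. x \<in> carrier M \<and> w \<in> carrier W}"
    then obtain x w where u: "u = s x w" "x \<in> carrier M" "w \<in> carrier W" by auto
    have "s \<zero>\<^bsub>M\<^esub> w = \<zero>\<^bsub>E\<^esub>"
      by (rule add_hom_zero[OF AB.M.X_abelian E_abelian s_hom_left[OF u(3)]])
    then show "lact X a u \<in> {\<zero>\<^bsub>X\<^esub>}"
      using u aA a AB.I_act by (simp add: act_s) (simp add: E_ops X_ops)
  qed
  then show "lact X a f = \<zero>\<^bsub>X\<^esub>" by simp
qed

text \<open>The law for \<open>\<sigma>\<tau>\<close> is the computation, for \<open>y'\<close> in
  \<open>N\<close>, that \<open>r(y', x) f(y) = f(r(y', x) y) = f(y' e(x, y))\<close>, by linearity
  of \<open>f\<close> over \<open>B\<close> and \<open>assoc_N\<close>. The law for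
  \<open>\<tau>\<sigma>\<close> is the definition of \<open>s\<close>.\<close>

lemma X_linked: "linked_modules \<V> k A B I J M N AB.e BA.e X W s (\<lambda>y f. f y)"
proof (intro linked_modules.intro linked_modules_axioms.intro morita_pair_axioms
    X_half_context_module W.half_context_module_axioms)
  have "pairing \<V> A B M W X s"
    unfolding pairing_def
  proof (intro conjI ballI)
    show "add_hom M X (\<lambda>x. s x w)" if "w \<in> carrier W" for w
      using add_hom_add[OF s_hom_left[OF that]] that
      by (intro add_homI) (auto simp: s_closed_X X_ops E_ops)
    show "add_hom W X (s x)" if "x \<in> carrier M" for x
      using add_hom_add[OF s_hom_right[OF that]] that
      by (intro add_homI) (auto simp: s_closed_X X_ops E_ops)
    show "s (lact M a x) w = lact X a (s x w)" if "a \<in> carrier A" "x \<in> carrier M" "w \<in> carrier W" for a x w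
      using that by (simp add: act_s)
    show "s (ract M x b) w = s x (lact W b w)" if "b \<in> carrier B" "x \<in> carrier M" "w \<in> carrier W" for b x w
      using that by (auto simp: s_def W.act_e_ract)
    show "s x w \<in> hcomp X (dplus \<V> i j)"
      if "i \<in> degs \<V>" "j \<in> degs \<V>" "x \<in> hcomp M i" "w \<in> hcomp W j" for i j x w
      using s_hcomp[OF that] s_closed_X AB.M.hcomp_carrier[OF that(1,3)] W.V.hcomp_carrier[OF that(2,4)]
      by (simp add: X_ops(4))
  qed
  moreover have "pairing \<V> B A N X W (\<lambda>y f. f y)"
    unfolding pairing_def
  proof (intro conjI ballI)
    show "add_hom N W (\<lambda>y. f y)" if "f \<in> carrier X" for f
      using X_linear(2)[OF that] by simp
    show "add_hom X W (\<lambda>f. f y)" if "y \<in> carrier N" for y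
      using add_hom_comp[OF X_E_id eval_hom[OF that]] .
    show "f (lact N b y) = lact W b (f y)" if "b \<in> carrier B" "y \<in> carrier N" "f \<in> carrier X" for b y f
      using that by (simp add: X_linear)
    show "f (ract N y a) = lact X a f y" if "a \<in> carrier A" "y \<in> carrier N" "f \<in> carrier X" for a y f
      using that by (simp add: X_ops)
    show "f y \<in> hcomp W (dplus \<V> i j)"
      if "i \<in> degs \<V>" "j \<in> degs \<V>" "y \<in> hcomp N i" "f \<in> hcomp X j" for i j y f
      using that by (auto simp: X_ops(4) hom_degree_iff)
  qed
  moreover have "s x (f y) = lact X (AB.e x y) f"
    if "x \<in> carrier M" "y \<in> carrier N" "f \<in> carrier X" for x y f
  proof (rule X_eqI)
    have xy: "AB.e x y \<in> carrier A" using that AB.e_closed by simp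
    show "s x (f y) \<in> carrier X" "lact X (AB.e x y) f \<in> carrier X"
      using that xy X_linear(3) by (auto intro!: s_closed_X act_closed)
    show "s x (f y) y' = lact X (AB.e x y) f y'" if y': "y' \<in> carrier N" for y'
    proof -
      have "s x (f y) y' = f (lact N (BA.e y' x) y)"
        using y' \<open>x \<in> carrier M\<close> \<open>y \<in> carrier N\<close> X_linear(4)[OF \<open>f \<in> carrier X\<close>]
        by (simp add: s_def BA.e_closed)
      also have "\<dots> = lact X (AB.e x y) f y'"
        using y' assoc_N[OF y' \<open>x \<in> carrier M\<close> \<open>y \<in> carrier N\<close>] by (simp add: X_ops)
      finally show ?thesis .
    qed
  qed
  moreover have "s x w y = lact W (BA.e y x) w"
    if "y \<in> carrier N" "x \<in> carrier M" "w \<in> carrier W" for y x w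
    using that by (simp add: s_def)
  ultimately show "linked \<V> A B M N AB.e BA.e X W s (\<lambda>y f. f y)"
    by (simp add: linked_def)
qed

text \<open>For the image module both conditions are built in: a function is zero if all its values
  are, and the generators are the values of \<open>s\<close>.\<close>

theorem X_simple:
  assumes "simple_between \<V> k B J BA.trace W"
  shows "simple_between \<V> k A I AB.trace X"
proof -
  interpret L: linked_modules \<V> k A B I J M N AB.e BA.e X W s "\<lambda>y f. f y" by (rule X_linked)
  show ?thesis
  proof (rule L.simple_of_linked[OF assms])
    show L.spanning unfolding L.spanning_def by (rule X_span)
    show L.separating
      unfolding L.separating_def
      by (intro ballI impI X_eqI X.zero_closed) (auto simp: X_ops)
  qed
qed

end

section \<open>The correspondence for one Morita context\<close>

lemma iso_class_eqI:
  assumes X: "lmod k X \<V> A" and Y: "lmod k Y \<V> A" and iso: "lmod_iso \<V> k A X Y"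
  shows "iso_class \<V> k A X = iso_class \<V> k A Y"
  using lmod_iso_trans[OF lmod_iso_sym[OF X Y iso]] lmod_iso_trans[OF iso]
  by (auto simp: iso_class_def)

lemma lmod_of_simple_between: "valgebra \<V> k A \<Longrightarrow> simple_between \<V> k A J I V \<Longrightarrow> lmod k V \<V> A"
  by (intro lmodI) (auto simp: simple_between_def simple_module_def)

text \<open>Induced modules consist of functions and do not have their carrier in \<open>'u\<close>;
  this provides copies there without leaving the layer.\<close>

lemma simple_between_representative:
  fixes e :: "'a \<Rightarrow> 'u"
  assumes A: "valgebra \<V> k A" and V: "simple_between \<V> k A J I V"
    and JI: "J \<subseteq> carrier A" "I \<subseteq> carrier A" and e: "inj_on e (carrier A)"
  shows "\<exists>Y :: ('k, 'a, 'u) lmodule. simple_between \<V> k A J I Y \<and> lmod k Y \<V> A \<and> lmod_iso \<V> k A V Y"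
proof -
  interpret V: lmod k V \<V> A by (rule lmod_of_simple_between[OF A V])
  obtain Y :: "('k, 'a, 'u) lmodule" where Y: "left_module \<V> k A Y" "lmod_iso \<V> k A V Y"
    using V.simple_module_transport[OF _ e] V by (auto simp: simple_between_def)
  then show ?thesis
    using simple_between_iso[OF V.lmod_axioms lmodI[OF A Y(1)] Y(2) V JI] lmodI[OF A Y(1)] by blast
qed

text \<open>\<open>V\<close> may have its carrier in any type; its copy in \<open>'u\<close> has the
  same class and witnesses membership.\<close>

lemma Irr_betweenI:
  fixes e :: "'a \<Rightarrow> 'u"
  assumes A: "valgebra \<V> k A" and V: "simple_between \<V> k A J I V"
    and JI: "J \<subseteq> carrier A" "I \<subseteq> carrier A" and e: "inj_on e (carrier A)"
  shows "iso_class \<V> k A V \<in> (Irr_between \<V> k A J I :: ('k, 'a, 'u) lmodule set set)"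
proof -
  obtain Y :: "('k, 'a, 'u) lmodule" where Y: "simple_between \<V> k A J I Y" "lmod k Y \<V> A"
    and iso: "lmod_iso \<V> k A V Y"
    using simple_between_representative[OF assms] by blast
  have "(iso_class \<V> k A V :: ('k, 'a, 'u) lmodule set) = iso_class \<V> k A Y"
    by (rule iso_class_eqI[OF lmod_of_simple_between[OF A V] Y(2) iso])
  then show ?thesis using Y by (auto simp: Irr_between_def)
qed

text \<open>Unlike in \<open>iso_class_eq_iff\<close>, neither module is in \<open>'u\<close>. A
  copy of \<open>W\<close> there ensures that the common class is not empty.\<close>

lemma lmod_iso_of_class_eq:
  fixes e :: "'a \<Rightarrow> 'u"
  assumes A: "valgebra \<V> k A" and V: "lmod k V \<V> A" and W: "simple_between \<V> k A J I W"
    and JI: "J \<subseteq> carrier A" "I \<subseteq> carrier A" and e: "inj_on e (carrier A)"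
    and eq: "iso_class \<V> k A V = (iso_class \<V> k A W :: ('k, 'a, 'u) lmodule set)"
  shows "lmod_iso \<V> k A V W"
proof -
  note W' = lmod_of_simple_between[OF A W]
  obtain Y :: "('k, 'a, 'u) lmodule" where Y: "lmod k Y \<V> A" and iso: "lmod_iso \<V> k A W Y"
    using simple_between_representative[OF A W JI e] by blast
  have "iso_class \<V> k A V = (iso_class \<V> k A Y :: ('k, 'a, 'u) lmodule set)"
    using eq iso_class_eqI[OF W' Y iso] by simp
  then have "lmod_iso \<V> k A V Y"
    using iso_class_eq_iff[OF V Y lmod.left_module[OF Y]] by simp
  then show ?thesis
    using lmod_iso_sym[OF W' Y iso] by (rule lmod_iso_trans)
qed

definition morita_swap :: "('k, 'a, 'b, 'm, 'n) morita \<Rightarrow> ('k, 'b, 'a, 'n, 'm) morita" where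
  "morita_swap C = \<lparr>mor_M = mor_N C, mor_N = mor_M C, mor_eta = mor_rho C, mor_rho = mor_eta C\<rparr>"

context context_data
begin

lemma A_valgebra: "valgebra \<V> k A" and B_valgebra: "valgebra \<V> k B"
  by (fact valgebra BJ.valgebra)+

lemmas I_sub = I_carrier
lemmas J_sub = BJ.I_carrier

lemma induced_moduleI:
  assumes W: "simple_between \<V> k B J BA.trace W"
  shows "induced_module A I B J \<V> k C W"
proof -
  interpret W: lmod k W \<V> B by (rule lmod_of_simple_between[OF B_valgebra W])
  have "\<forall>b\<in>J. \<forall>w\<in>carrier W. lact W b w = \<zero>\<^bsub>W\<^esub>"
    using W W.ideal_act_zero_iff[OF J_sub] by (simp add: simple_between_def)
  then have "half_context_module \<V> k B A J (inflate B J A I (mor_N C)) (inflate A I B J (mor_M C)) BA.e W"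
    by (intro half_context_module.intro half_context_module_axioms.intro BA.half_context W.lmod_axioms)
      auto
  then show ?thesis
    by (intro induced_module.intro context_data_axioms)
qed

abbreviation "im \<equiv> morita_image \<V> k A I B J C"

lemma im_linked:
  assumes "simple_between \<V> k B J BA.trace W"
  shows "\<exists>\<sigma> \<tau>. linked_modules \<V> k A B I J (inflate A I B J (mor_M C)) (inflate B J A I (mor_N C))
    AB.e BA.e (im W) W \<sigma> \<tau>"
  using induced_module.X_linked[OF induced_moduleI[OF assms]] by blast

lemma im_simple:
  "simple_between \<V> k B J BA.trace W \<Longrightarrow> simple_between \<V> k A I AB.trace (im W)"
  using induced_module.X_simple[OF induced_moduleI] by blast

lemma im_lmod: "simple_between \<V> k B J BA.trace W \<Longrightarrow> lmod k (im W) \<V> A"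
  using lmod_of_simple_between[OF A_valgebra im_simple] .

text \<open>An isomorphism on one side lets both modules of the other side be linked to the same
  module, and uniqueness applies. The two directions are one argument, for the context and for its
  swap.\<close>

lemma im_iso_iff:
  assumes W: "simple_between \<V> k B J BA.trace W" and W': "simple_between \<V> k B J BA.trace W'"
  shows "lmod_iso \<V> k A (im W) (im W') \<longleftrightarrow> lmod_iso \<V> k B W W'"
proof
  obtain \<sigma> \<tau> where L: "linked_modules \<V> k A B I J (inflate A I B J (mor_M C)) (inflate B J A I (mor_N C))
    AB.e BA.e (im W) W \<sigma> \<tau>" using im_linked[OF W] by blast
  obtain \<sigma>' \<tau>' where L': "linked_modules \<V> k A B I J (inflate A I B J (mor_M C)) (inflate B J A I (mor_N C))
    AB.e BA.e (im W') W' \<sigma>' \<tau>'" using im_linked[OF W'] by blast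
  interpret L: linked_modules \<V> k A B I J "inflate A I B J (mor_M C)" "inflate B J A I (mor_N C)"
    AB.e BA.e "im W" W \<sigma> \<tau> by (rule L)
  interpret L': linked_modules \<V> k A B I J "inflate A I B J (mor_M C)" "inflate B J A I (mor_N C)"
    AB.e BA.e "im W'" W' \<sigma>' \<tau>' by (rule L')
  show "lmod_iso \<V> k A (im W) (im W')" if iso: "lmod_iso \<V> k B W W'"
    using linked_modules_iso[OF L L'.W.half_context_module_axioms iso]
      iso_of_linked_simple[OF _ L' im_simple[OF W] im_simple[OF W']] by blast
  show "lmod_iso \<V> k B W W'" if iso: "lmod_iso \<V> k A (im W) (im W')"
    using linked_modules_iso[OF L.swap_linked L'.V.half_context_module_axioms iso]
      iso_of_linked_simple[OF _ L'.swap_linked W W'] by blast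
qed

lemma swap_context: "context_data B J A I \<V> k (morita_swap C)"
  using C by unfold_locales (simp add: morita_context_def morita_swap_def Let_def)

text \<open>The preimage is the module that the swapped context induces from \<open>V\<close>,
  copied into \<open>'u\<close>. It is linked to \<open>V\<close> and to its own induced module, so
  uniqueness over \<open>A\<close> identifies these two.\<close>

lemma im_surjective:
  fixes e :: "'b \<Rightarrow> 'u" and V :: "('k, 'a, 'v) lmodule"
  assumes V: "simple_between \<V> k A I AB.trace V" and e: "inj_on e (carrier B)"
  shows "\<exists>W :: ('k, 'b, 'u) lmodule. simple_between \<V> k B J BA.trace W \<and> lmod_iso \<V> k A (im W) V"
proof -
  interpret S: context_data B J A I \<V> k "morita_swap C" by (rule swap_context)
  have eqs: "mor_rho (morita_swap C) = mor_eta C" "mor_eta (morita_swap C) = mor_rho C" "mor_M (morita_swap C) = mor_N C" "mor_N (morita_swap C) = mor_M C"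
    by (simp_all add: morita_swap_def)
  have V': "simple_between \<V> k A I S.BA.trace V" using V unfolding eqs .
  obtain \<sigma> \<tau> where L: "linked_modules \<V> k B A J I (inflate B J A I (mor_N C)) (inflate A I B J (mor_M C))
      BA.e AB.e (S.im V) V \<sigma> \<tau>"
    using S.im_linked[OF V'] unfolding eqs by blast
  have simple: "simple_between \<V> k B J BA.trace (S.im V)"
    using S.im_simple[OF V'] unfolding eqs .
  obtain W :: "('k, 'b, 'u) lmodule" where W: "simple_between \<V> k B J BA.trace W"
    and iso: "lmod_iso \<V> k B (S.im V) W"
    using simple_between_representative[OF B_valgebra simple J_sub BA.trace_carrier e] by blast
  obtain \<sigma>' \<tau>' where L': "linked_modules \<V> k A B I J (inflate A I B J (mor_M C)) (inflate B J A I (mor_N C))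
    AB.e BA.e (im W) W \<sigma>' \<tau>'" using im_linked[OF W] by blast
  interpret L': linked_modules \<V> k A B I J "inflate A I B J (mor_M C)" "inflate B J A I (mor_N C)"
    AB.e BA.e "im W" W \<sigma>' \<tau>' by (rule L')
  obtain \<sigma>'' \<tau>'' where "linked_modules \<V> k A B I J (inflate A I B J (mor_M C)) (inflate B J A I (mor_N C))
    AB.e BA.e V W \<sigma>'' \<tau>''"
    using linked_modules_iso[OF linked_modules.swap_linked[OF L] L'.W.half_context_module_axioms iso] by blast
  then have "lmod_iso \<V> k A (im W) V"
    by (rule iso_of_linked_simple[OF L' _ im_simple[OF W] V])
  then show ?thesis using W by blast
qed

text \<open>A map on classes has to choose a module in the class; \<open>im_iso_iff\<close> makes
  the result independent of the choice.\<close>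

definition class_map :: "('k, 'b, 'u) lmodule set \<Rightarrow> ('k, 'a, 'u) lmodule set" where
  "class_map D = iso_class \<V> k A
     (im (SOME W :: ('k, 'b, 'u) lmodule. simple_between \<V> k B J BA.trace W \<and> D = iso_class \<V> k B W))"

lemma class_map:
  fixes W :: "('k, 'b, 'u) lmodule"
  assumes W: "simple_between \<V> k B J BA.trace W"
  shows "class_map (iso_class \<V> k B W) = (iso_class \<V> k A (im W) :: ('k, 'a, 'u) lmodule set)"
proof -
  define W' where "W' = (SOME W' :: ('k, 'b, 'u) lmodule. simple_between \<V> k B J BA.trace W' \<and>
    iso_class \<V> k B W = (iso_class \<V> k B W' :: ('k, 'b, 'u) lmodule set))"
  have "\<exists>W' :: ('k, 'b, 'u) lmodule. simple_between \<V> k B J BA.trace W' \<and>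
      iso_class \<V> k B W = (iso_class \<V> k B W' :: ('k, 'b, 'u) lmodule set)"
    using W by blast
  from someI_ex[OF this, folded W'_def]
  have W': "simple_between \<V> k B J BA.trace W'"
    and eq: "iso_class \<V> k B W = (iso_class \<V> k B W' :: ('k, 'b, 'u) lmodule set)" by auto
  note lW' = lmod_of_simple_between[OF B_valgebra W']
  have "lmod_iso \<V> k B W W'"
    using iso_class_eq_iff[OF lmod_of_simple_between[OF B_valgebra W] lW' lmod.left_module[OF lW']] eq
    by simp
  then have "lmod_iso \<V> k A (im W) (im W')" using im_iso_iff[OF W W'] by simp
  then have "(iso_class \<V> k A (im W) :: ('k, 'a, 'u) lmodule set) = iso_class \<V> k A (im W')"
    by (rule iso_class_eqI[OF im_lmod[OF W] im_lmod[OF W']])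
  then show ?thesis unfolding class_map_def W'_def by simp
qed

text \<open>The embedding of \<open>A\<close> places induced modules in \<open>'u\<close>, so that
  their classes lie in the target; the embedding of \<open>B\<close> does the same for the
  preimages.\<close>

theorem class_map_bij:
  fixes e :: "'a \<Rightarrow> 'u" and e' :: "'b \<Rightarrow> 'u"
  assumes e: "inj_on e (carrier A)" and e': "inj_on e' (carrier B)"
  shows "bij_betw (class_map :: ('k, 'b, 'u) lmodule set \<Rightarrow> ('k, 'a, 'u) lmodule set)
    (Irr_between \<V> k B J BA.trace) (Irr_between \<V> k A I AB.trace)"
  unfolding bij_betw_def
proof
  show "inj_on (class_map :: ('k, 'b, 'u) lmodule set \<Rightarrow> ('k, 'a, 'u) lmodule set) (Irr_between \<V> k B J BA.trace)"
  proof (rule inj_onI)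
    fix D D' :: "('k, 'b, 'u) lmodule set"
    assume "D \<in> Irr_between \<V> k B J BA.trace" "D' \<in> Irr_between \<V> k B J BA.trace"
      and eq: "class_map D = (class_map D' :: ('k, 'a, 'u) lmodule set)"
    then obtain W W' :: "('k, 'b, 'u) lmodule" where
      W: "simple_between \<V> k B J BA.trace W" "D = iso_class \<V> k B W" and
      W': "simple_between \<V> k B J BA.trace W'" "D' = iso_class \<V> k B W'"
      by (auto simp: Irr_between_def)
    have "iso_class \<V> k A (im W) = (iso_class \<V> k A (im W') :: ('k, 'a, 'u) lmodule set)"
      using eq W W' by (simp add: class_map)
    then have "lmod_iso \<V> k A (im W) (im W')"
      by (rule lmod_iso_of_class_eq[OF A_valgebra im_lmod[OF W(1)] im_simple[OF W'(1)] I_sub AB.trace_carrier e])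
    then show "D = D'"
      using im_iso_iff[OF W(1) W'(1)] W(2) W'(2)
        iso_class_eqI[OF lmod_of_simple_between[OF B_valgebra W(1)] lmod_of_simple_between[OF B_valgebra W'(1)]]
      by simp
  qed
  show "class_map ` (Irr_between \<V> k B J BA.trace :: ('k, 'b, 'u) lmodule set set) =
      (Irr_between \<V> k A I AB.trace :: ('k, 'a, 'u) lmodule set set)"
  proof (intro subset_antisym subsetI)
    fix D :: "('k, 'a, 'u) lmodule set"
    assume "D \<in> class_map ` (Irr_between \<V> k B J BA.trace :: ('k, 'b, 'u) lmodule set set)"
    then obtain W :: "('k, 'b, 'u) lmodule" where W: "simple_between \<V> k B J BA.trace W"
      and D: "D = class_map (iso_class \<V> k B W)"
      by (auto simp: Irr_between_def)
    show "D \<in> Irr_between \<V> k A I AB.trace"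
      unfolding D class_map[OF W]
      by (rule Irr_betweenI[OF A_valgebra im_simple[OF W] I_sub AB.trace_carrier e])
  next
    fix D :: "('k, 'a, 'u) lmodule set"
    assume "D \<in> Irr_between \<V> k A I AB.trace"
    then obtain V :: "('k, 'a, 'u) lmodule" where V: "simple_between \<V> k A I AB.trace V"
      and D: "D = iso_class \<V> k A V"
      by (auto simp: Irr_between_def)
    obtain W :: "('k, 'b, 'u) lmodule" where W: "simple_between \<V> k B J BA.trace W"
      and iso: "lmod_iso \<V> k A (im W) V"
      using im_surjective[OF V e'] by blast
    have "class_map (iso_class \<V> k B W) = D"
      unfolding D class_map[OF W]
      by (rule iso_class_eqI[OF im_lmod[OF W] lmod_of_simple_between[OF A_valgebra V] iso])
    moreover have "iso_class \<V> k B W \<in> (Irr_between \<V> k B J BA.trace :: ('k, 'b, 'u) lmodule set set)"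
      using W by (auto simp: Irr_between_def)
    ultimately show "D \<in> class_map ` (Irr_between \<V> k B J BA.trace :: ('k, 'b, 'u) lmodule set set)"
      by blast
  qed
qed

end

section \<open>Ideal filters\<close>

locale filtered_algebra =
  fixes \<V> :: vcat and k :: "'k ring" and \<Lambda> :: "'l::order set" and A :: "('k, 'a) vobj"
    and F :: "'l \<Rightarrow> 'a set"
  assumes A: "valgebra \<V> k A" and filter: "ideal_filter \<V> k \<Lambda> A F"
begin

interpretation A: ring A using A by (simp add: valgebra_def)

lemma F_videal: "l \<in> \<Lambda> \<Longrightarrow> videal \<V> k A (F l)"
  and F_mono: "l \<in> \<Lambda> \<Longrightarrow> m \<in> \<Lambda> \<Longrightarrow> l \<le> m \<Longrightarrow> F l \<subseteq> F m"
  and F_sum: "carrier A = add_span A (\<Union>l\<in>\<Lambda>. F l)"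
  and F_prod: "l \<in> \<Lambda> \<Longrightarrow> m \<in> \<Lambda> \<Longrightarrow> F l \<cdot>\<^bsub>A\<^esub> F m \<subseteq> add_span A (\<Union>n\<in>{n\<in>\<Lambda>. n \<le> l \<and> n \<le> m}. F n)"
  using filter by (auto simp: ideal_filter_def ideal_sum_def)

lemma F_ideal: "l \<in> \<Lambda> \<Longrightarrow> ideal (F l) A"
  using F_videal by (simp add: videal_def)

lemma F_subgroup: "l \<in> \<Lambda> \<Longrightarrow> add_subgroup A (F l)"
  using additive_subgroup.a_subgroup[OF ideal.axioms(1)[OF F_ideal]] .

lemma F_carrier: "l \<in> \<Lambda> \<Longrightarrow> F l \<subseteq> carrier A"
  using A.add_subgroupD(1)[OF F_subgroup] .

lemma below_eq: "below \<Lambda> A F l = add_span A (\<Union>m\<in>{m\<in>\<Lambda>. m < l}. F m)"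
  by (simp add: below_def ideal_sum_def)

lemma below_ideal: "ideal (below \<Lambda> A F l) A"
proof -
  let ?S = "\<Union>m\<in>{m\<in>\<Lambda>. m < l}. F m"
  have S: "?S \<subseteq> carrier A" using F_carrier by auto
  note sg = A.add_span_subgroup[OF S]
  have ab: "abelian_group A" by (rule A.abelian_group_axioms)
  show ?thesis
    unfolding below_eq
  proof (rule idealI[OF A.ring_axioms sg])
    fix u x assume u: "u \<in> add_span A ?S" and x: "x \<in> carrier A"
    have "add_hom A A (\<lambda>u. x \<otimes>\<^bsub>A\<^esub> u)" "add_hom A A (\<lambda>u. u \<otimes>\<^bsub>A\<^esub> x)"
      using x by (auto intro!: add_homI simp: A.r_distr A.l_distr)
    note hom = add_hom_span[OF ab ab this(1) S sg _ u] add_hom_span[OF ab ab this(2) S sg _ u]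
    show "x \<otimes>\<^bsub>A\<^esub> u \<in> add_span A ?S"
      using ideal.I_l_closed[OF F_ideal _ x] by (intro hom(1) generate.incl) auto
    show "u \<otimes>\<^bsub>A\<^esub> x \<in> add_span A ?S"
      using ideal.I_r_closed[OF F_ideal _ x] by (intro hom(2) generate.incl) auto
  qed
qed

lemma below_carrier: "below \<Lambda> A F l \<subseteq> carrier A"
  using additive_subgroup.a_subset[OF ideal.axioms(1)[OF below_ideal]] .

lemma below_subset: "l \<in> \<Lambda> \<Longrightarrow> below \<Lambda> A F l \<subseteq> F l"
  unfolding below_eq using F_mono by (intro A.add_span_incl F_subgroup) (auto dest: less_imp_le)

lemma simple_in_layer:
  assumes wf: "well_founded_poset \<Lambda>" and V: "simple_module \<V> k A V"
  shows "\<exists>l\<in>\<Lambda>. simple_between \<V> k A (below \<Lambda> A F l) (F l) V"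
proof -
  interpret V: lmod k V \<V> A using V A by (intro lmodI) (auto simp: simple_module_def)
  have annih: "lact V a v = \<zero>\<^bsub>V\<^esub>"
    if "a \<in> add_span A T" "T \<subseteq> carrier A" "\<And>t. t \<in> T \<Longrightarrow> lact V t v = \<zero>\<^bsub>V\<^esub>" "v \<in> carrier V" for a T v
    using add_hom_span[OF V.A_abelian V.X_abelian V.act_left_hom[OF that(4)] that(2), of "{\<zero>\<^bsub>V\<^esub>}" a]
      that V.M.add.triv_subgroup by auto
  define S where "S = {l \<in> \<Lambda>. \<exists>a\<in>F l. \<exists>v\<in>carrier V. lact V a v \<noteq> \<zero>\<^bsub>V\<^esub>}"
  \<comment> \<open>Otherwise all ideals of the filter kill \<open>V\<close>, and so does the unit,
    which lies in their sum.\<close>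
  have "S \<noteq> {}"
  proof
    assume "S = {}"
    then have 0: "lact V t v = \<zero>\<^bsub>V\<^esub>" if "t \<in> (\<Union>l\<in>\<Lambda>. F l)" "v \<in> carrier V" for t v
      using that by (auto simp: S_def)
    have 1: "\<one>\<^bsub>A\<^esub> \<in> add_span A (\<Union>l\<in>\<Lambda>. F l)"
      using A.one_closed F_sum by blast
    have "v = \<zero>\<^bsub>V\<^esub>" if "v \<in> carrier V" for v
      using annih[OF 1 _ 0[OF _ that] that] V.act_one[OF that] F_carrier by auto
    then have "carrier V = {\<zero>\<^bsub>V\<^esub>}" using V.M.zero_closed by blast
    then show False using V by (simp add: V.simple_module_iff)
  qed
  moreover have "S \<subseteq> \<Lambda>" by (auto simp: S_def)
  ultimately obtain l where l: "l \<in> S" "\<forall>m\<in>S. \<not> m < l"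
    using wf unfolding well_founded_poset_def by blast
  then have l\<Lambda>: "l \<in> \<Lambda>" by (simp add: S_def)
  have "\<forall>a\<in>below \<Lambda> A F l. \<forall>v\<in>carrier V. lact V a v = \<zero>\<^bsub>V\<^esub>"
  proof (intro ballI)
    fix a v assume a: "a \<in> below \<Lambda> A F l" and v: "v \<in> carrier V"
    show "lact V a v = \<zero>\<^bsub>V\<^esub>"
    proof (rule annih[OF a[unfolded below_eq] _ _ v])
      show "(\<Union>m\<in>{m\<in>\<Lambda>. m < l}. F m) \<subseteq> carrier A" using F_carrier by auto
      fix t assume "t \<in> (\<Union>m\<in>{m\<in>\<Lambda>. m < l}. F m)"
      then obtain m where m: "m \<in> \<Lambda>" "m < l" "t \<in> F m" by auto
      then have "m \<notin> S" using l by auto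
      then show "lact V t v = \<zero>\<^bsub>V\<^esub>" using m v unfolding S_def by blast
    qed
  qed
  then have "ideal_act (below \<Lambda> A F l) V = {\<zero>\<^bsub>V\<^esub>}"
    using V.ideal_act_zero_iff[OF below_carrier] by simp
  moreover have "ideal_act (F l) V \<noteq> {\<zero>\<^bsub>V\<^esub>}"
    using V.ideal_act_zero_iff[OF F_carrier[OF l\<Lambda>]] l(1) unfolding S_def by blast
  then have "ideal_act (F l) V = carrier V"
    using V V.ideal_act_lsub[OF F_videal[OF l\<Lambda>]] unfolding V.simple_module_iff by blast
  ultimately show ?thesis using V l\<Lambda> unfolding simple_between_def by blast
qed

text \<open>If \<open>l\<close> is not below \<open>m\<close>, every index below both is strictly
  below \<open>l\<close>. Then \<open>F l F m\<close> lies in \<open>below \<Lambda> A F l\<close>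
  and kills \<open>V\<close>, although \<open>F m V = V\<close> and
  \<open>F l V = V \<noteq> 0\<close>. Used in both directions, it yields \<open>l = m\<close> by
  antisymmetry.\<close>

lemma layers_comparable:
  assumes l: "l \<in> \<Lambda>" and m: "m \<in> \<Lambda>"
    and V: "simple_between \<V> k A (below \<Lambda> A F l) (F l) V" "simple_between \<V> k A (below \<Lambda> A F m) (F m) V"
  shows "l \<le> m"
proof (rule ccontr)
  assume nle: "\<not> l \<le> m"
  interpret V: lmod k V \<V> A by (rule lmod_of_simple_between[OF A V(1)])
  have 0: "\<forall>a\<in>below \<Lambda> A F l. \<forall>v\<in>carrier V. lact V a v = \<zero>\<^bsub>V\<^esub>"
    using V(1) V.ideal_act_zero_iff[OF below_carrier] by (simp add: simple_between_def)
  have "(\<Union>n\<in>{n\<in>\<Lambda>. n \<le> l \<and> n \<le> m}. F n) \<subseteq> (\<Union>n\<in>{n\<in>\<Lambda>. n < l}. F n)"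
    using nle by (auto simp: order.order_iff_strict)
  then have prod: "F l \<cdot>\<^bsub>A\<^esub> F m \<subseteq> below \<Lambda> A F l"
    using F_prod[OF l m] A.add.mono_generate unfolding below_eq by blast
  have Fm: "ideal_act (F m) V = carrier V" and Fl: "ideal_act (F l) V = carrier V"
    and ne: "carrier V \<noteq> {\<zero>\<^bsub>V\<^esub>}"
    using V by (auto simp: simple_between_def V.simple_module_iff)
  have "lact V a v = \<zero>\<^bsub>V\<^esub>" if a: "a \<in> F l" and v: "v \<in> carrier V" for a v
  proof -
    have aA: "a \<in> carrier A" using a F_carrier[OF l] by auto
    have "lact V a v \<in> {\<zero>\<^bsub>V\<^esub>}"
    proof (rule add_hom_span[OF V.X_abelian V.X_abelian V.act_right_hom[OF aA]])
      show "v \<in> add_span V {lact V b u |b u. b \<in> F m \<and> u \<in> carrier V}"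
        using v Fm by (simp add: ideal_act_def)
      show "{lact V b u |b u. b \<in> F m \<and> u \<in> carrier V} \<subseteq> carrier V" using F_carrier[OF m] by auto
      show "add_subgroup V {\<zero>\<^bsub>V\<^esub>}" using V.M.add.triv_subgroup by simp
      fix u assume "u \<in> {lact V b u |b u. b \<in> F m \<and> u \<in> carrier V}"
      then obtain b w where u: "u = lact V b w" "b \<in> F m" "w \<in> carrier V" by auto
      then have "lact V a u = lact V (a \<otimes>\<^bsub>A\<^esub> b) w"
        using aA F_carrier[OF m] by (auto simp: V.act_mult)
      moreover have "a \<otimes>\<^bsub>A\<^esub> b \<in> below \<Lambda> A F l"
        using prod ideal_prod.prod[OF a u(2)] by blast
      ultimately show "lact V a u \<in> {\<zero>\<^bsub>V\<^esub>}" using 0 u by simp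
    qed
    then show ?thesis by simp
  qed
  then have "ideal_act (F l) V = {\<zero>\<^bsub>V\<^esub>}"
    using V.ideal_act_zero_iff[OF F_carrier[OF l]] by simp
  then show False using Fl ne by simp
qed

lemma Irr_eq_layers:
  assumes "well_founded_poset \<Lambda>"
  shows "(Irr \<V> k A :: ('k, 'a, 'u) lmodule set set) =
    (\<Union>l\<in>\<Lambda>. Irr_between \<V> k A (below \<Lambda> A F l) (F l))"
  using simple_in_layer[OF assms] unfolding Irr_def Irr_between_def
  by (fastforce simp: simple_between_def)

lemma layers_disjoint:
  "disjoint_family_on
    (\<lambda>l. Irr_between \<V> k A (below \<Lambda> A F l) (F l) :: ('k, 'a, 'u) lmodule set set) \<Lambda>"
proof (unfold disjoint_family_on_def, intro ballI impI equals0I)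
  fix l m and D :: "('k, 'a, 'u) lmodule set"
  assume l: "l \<in> \<Lambda>" and m: "m \<in> \<Lambda>" and lm: "l \<noteq> m"
    and "D \<in> Irr_between \<V> k A (below \<Lambda> A F l) (F l) \<inter> Irr_between \<V> k A (below \<Lambda> A F m) (F m)"
  then obtain V V' :: "('k, 'a, 'u) lmodule" where
    V: "simple_between \<V> k A (below \<Lambda> A F l) (F l) V" "D = iso_class \<V> k A V" and
    V': "simple_between \<V> k A (below \<Lambda> A F m) (F m) V'" "D = iso_class \<V> k A V'"
    by (auto simp: Irr_between_def)
  note lV = lmod_of_simple_between[OF A V(1)] and lV' = lmod_of_simple_between[OF A V'(1)]
  have "lmod_iso \<V> k A V V'"
    using iso_class_eq_iff[OF lV lV' lmod.left_module[OF lV']] V(2) V'(2) by simp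
  then have "simple_between \<V> k A (below \<Lambda> A F l) (F l) V'"
    by (rule simple_between_iso[OF lV lV' _ V(1) below_carrier F_carrier[OF l]])
  then show False
    using layers_comparable[OF l m _ V'(1)] layers_comparable[OF m l V'(1)] lm by auto
qed

end

section \<open>The contexts of a prestandard filter and the final bijection\<close>

lemma prestandard_context:
  assumes A: "valgebra \<V> k A" and B: "\<forall>l\<in>\<Lambda>. valgebra \<V> k (B l)"
    and P: "prestandard_filter \<V> k \<Lambda> A B P" and l: "l \<in> \<Lambda>"
  shows "context_data A (below \<Lambda> A (flt P) l) (B l) (bideal P l) \<V> k (ctx P l)"
proof -
  interpret filtered_algebra \<V> k \<Lambda> A "flt P"
    using A P by unfold_locales (auto simp: prestandard_filter_def)
  show ?thesis
    using P B A l
    by (intro context_data.intro context_data_axioms.intro algebra_idealI below_ideal)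
      (auto simp: prestandard_filter_def videal_def)
qed

text \<open>All four sets are full preimages of trace ideals: \<open>trace\<close> by
  \<open>mem_trace_iff\<close>, \<open>btrace\<close> by definition, and \<open>flt P l\<close>
  because it contains \<open>below\<close>. So it suffices to compare residue classes.\<close>

lemma prestandard_traces:
  assumes A: "valgebra \<V> k A" and B: "\<forall>l\<in>\<Lambda>. valgebra \<V> k (B l)"
    and P: "prestandard_filter \<V> k \<Lambda> A B P" and l: "l \<in> \<Lambda>"
  defines "I \<equiv> below \<Lambda> A (flt P) l" and "J \<equiv> bideal P l" and "C \<equiv> ctx P l"
  shows "half_context.trace A I (inflate A I (B l) J (mor_M C)) (inflate (B l) J A I (mor_N C))
      (repr A I (quot_algebra (B l) J) (mor_M C) (mor_N C) (mor_eta C)) = flt P l"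
    and "half_context.trace (B l) J (inflate (B l) J A I (mor_N C)) (inflate A I (B l) J (mor_M C))
      (repr (B l) J (quot_algebra A I) (mor_N C) (mor_M C) (mor_rho C)) = btrace \<V> \<Lambda> A B P l"
proof -
  interpret F: filtered_algebra \<V> k \<Lambda> A "flt P"
    using A P by unfold_locales (auto simp: prestandard_filter_def)
  interpret context_data A I "B l" J \<V> k C
    unfolding I_def J_def C_def by (rule prestandard_context[OF A B P l])
  have tl: "mor_eta C ` carrier (tensor_lmodule \<V> BJ.Q (mor_M C) (mor_N C)) = (\<lambda>a. I +>\<^bsub>A\<^esub> a) ` flt P l"
    using P l by (simp add: prestandard_filter_def trace_left_def I_def J_def C_def)
  have F: "flt P l \<subseteq> carrier A" "I \<subseteq> flt P l" "add_subgroup A (flt P l)"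
    using F.F_carrier[OF l] F.below_subset[OF l] F.F_subgroup[OF l] by (auto simp: I_def)
  show "AB.trace = flt P l"
  proof (intro subset_antisym subsetI)
    fix a assume a: "a \<in> AB.trace"
    then have aA: "a \<in> carrier A" using AB.trace_carrier by auto
    then obtain b where b: "b \<in> flt P l" "I +>\<^bsub>A\<^esub> a = I +>\<^bsub>A\<^esub> b"
      using a AB.mem_trace_iff tl by auto
    then obtain i where "i \<in> I" "a = i \<oplus>\<^bsub>A\<^esub> b" using coset_eq_iff[OF aA, of b] F by auto
    then show "a \<in> flt P l" using F b A.add_subgroupD(4)[OF F(3)] by auto
  next
    fix a assume "a \<in> flt P l"
    then show "a \<in> AB.trace" using F(1) AB.mem_trace_iff[of a] tl by auto
  qed
  show "BA.trace = btrace \<V> \<Lambda> A B P l"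
    using BA.mem_trace_iff BA.trace_carrier
    by (auto simp: btrace_def trace_right_def I_def[symmetric] J_def[symmetric] C_def[symmetric])
qed

text \<open>The embeddings make \<open>'u\<close> large enough for a copy of every simple module
  over \<open>A\<close> and over each \<open>B l\<close>. The formula for \<open>\<Phi>\<close> on
  the class of each \<open>W\<close> is what makes the bijection the one induced by the Morita
  contexts.\<close>

theorem theorem4p7:
  fixes \<V> :: vcat
    and k :: "'k ring"
    and \<Lambda> :: "'l::order set"
    and A :: "('k, 'a) vobj"
    and B :: "'l \<Rightarrow> ('k, 'b) vobj"
    and S :: "('k, 'l, 'a, 'b, 'm0, 'n0) filter_data"
    and P :: "('k, 'l, 'a, 'b, 'm, 'n) filter_data"
  assumes "cring k"
    and "well_founded_poset \<Lambda>"
    and "\<forall>l\<in>\<Lambda>. valgebra \<V> k (B l)"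
    and "valgebra \<V> k A"
    and "standard_filter \<V> k \<Lambda> A B S"
    and "prestandard_filter \<V> k \<Lambda> A B P"
    and "\<exists>e :: 'a \<Rightarrow> 'u. inj_on e (carrier A)"
    and "\<forall>l\<in>\<Lambda>. \<exists>e :: 'b \<Rightarrow> 'u. inj_on e (carrier (B l))"
  shows
    "(Irr \<V> k A :: ('k, 'a, 'u) lmodule set set) =
       (\<Union>l\<in>\<Lambda>. Irr_between \<V> k A (below \<Lambda> A (flt P) l) (flt P l)) \<and>
     disjoint_family_on
       (\<lambda>l. Irr_between \<V> k A (below \<Lambda> A (flt P) l) (flt P l) :: ('k, 'a, 'u) lmodule set set) \<Lambda> \<and>
     (\<exists>\<Phi> :: 'l \<Rightarrow> ('k, 'b, 'u) lmodule set \<Rightarrow> ('k, 'a, 'u) lmodule set.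
        (\<forall>l\<in>\<Lambda>. \<forall>W :: ('k, 'b, 'u) lmodule.
           simple_between \<V> k (B l) (bideal P l) (btrace \<V> \<Lambda> A B P l) W \<longrightarrow>
           \<Phi> l (iso_class \<V> k (B l) W) =
             iso_class \<V> k A
               (morita_image \<V> k A (below \<Lambda> A (flt P) l) (B l) (bideal P l) (ctx P l) W)) \<and>
        (\<forall>l\<in>\<Lambda>. bij_betw (\<Phi> l)
           (Irr_between \<V> k (B l) (bideal P l) (btrace \<V> \<Lambda> A B P l))
           (Irr_between \<V> k A (below \<Lambda> A (flt P) l) (flt P l))) \<and>
        bij_betw (\<lambda>(l, C). \<Phi> l C)
          (SIGMA l:\<Lambda>. Irr_between \<V> k (B l) (bideal P l) (btrace \<V> \<Lambda> A B P l))
          (Irr \<V> k A))"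
proof -
  define F where "F = flt P"
  define I where "I l = below \<Lambda> A F l" for l
  note wf = assms(2) and B = assms(3) and A = assms(4) and P = assms(6)
  interpret F: filtered_algebra \<V> k \<Lambda> A F
    using A P by unfold_locales (auto simp: prestandard_filter_def F_def)
  define IrrA where "IrrA l = (Irr_between \<V> k A (I l) (F l) :: ('k, 'a, 'u) lmodule set set)" for l
  define IrrB where "IrrB l = (Irr_between \<V> k (B l) (bideal P l) (btrace \<V> \<Lambda> A B P l)
    :: ('k, 'b, 'u) lmodule set set)" for l
  define \<Phi> :: "'l \<Rightarrow> ('k, 'b, 'u) lmodule set \<Rightarrow> ('k, 'a, 'u) lmodule set"
    where "\<Phi> l = context_data.class_map A (I l) (B l) (bideal P l) \<V> k (ctx P l)" for l
  have \<Phi>: "\<Phi> l (iso_class \<V> k (B l) W) =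
      iso_class \<V> k A (morita_image \<V> k A (I l) (B l) (bideal P l) (ctx P l) W)"
    if "l \<in> \<Lambda>" "simple_between \<V> k (B l) (bideal P l) (btrace \<V> \<Lambda> A B P l) W"
    for l and W :: "('k, 'b, 'u) lmodule"
    \<comment> \<open>Unfolding \<open>prestandard_traces\<close> turns the traces of the single
      context into \<open>btrace\<close> and \<open>flt P l\<close>.\<close>
    using context_data.class_map[OF prestandard_context[OF A B P that(1)],
        unfolded prestandard_traces[OF A B P that(1)], OF that(2)]
    by (simp add: \<Phi>_def I_def F_def)
  have bij: "bij_betw (\<Phi> l) (IrrB l) (IrrA l)" if l: "l \<in> \<Lambda>" for l
  proof -
    obtain e :: "'a \<Rightarrow> 'u" and e' :: "'b \<Rightarrow> 'u" where "inj_on e (carrier A)" "inj_on e' (carrier (B l))"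
      using assms(7,8) l by blast
    then show ?thesis
      using context_data.class_map_bij[OF prestandard_context[OF A B P l],
          unfolded prestandard_traces[OF A B P l]]
      by (simp add: \<Phi>_def I_def F_def IrrA_def IrrB_def)
  qed
  have union: "(Irr \<V> k A :: ('k, 'a, 'u) lmodule set set) = (\<Union>l\<in>\<Lambda>. IrrA l)"
    unfolding IrrA_def I_def by (rule F.Irr_eq_layers[OF wf])
  have disj: "disjoint_family_on IrrA \<Lambda>"
    using F.layers_disjoint unfolding IrrA_def I_def .
  have "bij_betw (\<lambda>(l, C). \<Phi> l C) (SIGMA l:\<Lambda>. IrrB l) (Irr \<V> k A)"
    unfolding bij_betw_def
  proof
    show "inj_on (\<lambda>(l, C). \<Phi> l C) (SIGMA l:\<Lambda>. IrrB l)"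
    proof (rule inj_onI, clarify)
      fix l C m D
      assume l: "l \<in> \<Lambda>" "C \<in> IrrB l" and m: "m \<in> \<Lambda>" "D \<in> IrrB m" and eq: "\<Phi> l C = \<Phi> m D"
      \<comment> \<open>A common value lies in both layers, so disjointness forces equal indices;
        within one layer \<open>\<Phi> l\<close> is injective.\<close>
      have "\<Phi> l C \<in> IrrA l \<inter> IrrA m"
        using bij_betwE[OF bij[OF l(1)]] bij_betwE[OF bij[OF m(1)]] l m eq by auto
      then have "l = m" using disj l(1) m(1) unfolding disjoint_family_on_def by blast
      then show "l = m \<and> C = D"
        using inj_onD[OF bij_betw_imp_inj_on[OF bij[OF l(1)]]] l m eq by auto
    qed
    show "(\<lambda>(l, C). \<Phi> l C) ` (SIGMA l:\<Lambda>. IrrB l) = Irr \<V> k A"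
    proof -
      have "(\<lambda>(l, C). \<Phi> l C) ` (SIGMA l:\<Lambda>. IrrB l) = (\<Union>l\<in>\<Lambda>. \<Phi> l ` IrrB l)"
        by (auto simp: image_iff)
      also have "\<dots> = (\<Union>l\<in>\<Lambda>. IrrA l)"
        using bij_betw_imp_surj_on[OF bij] by simp
      finally show ?thesis using union by simp
    qed
  qed
  note results = union disj \<Phi> bij this
  note results = results[unfolded IrrA_def[abs_def] IrrB_def[abs_def] I_def F_def]
  show ?thesis
    by (intro conjI exI[of _ \<Phi>] ballI allI impI) (rule results; assumption)+
qed

end
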